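(* Let $S$ be a Dedekind domain (not a field) whose Dedekind zeta function is defined. Then, as formal Dirichlet series, $$\widehat{\zeta}_{S[T]}(s)=\prod_{i\geq 1}\prod_{j\geq 1} \zeta_S(is+j-1).$$
   Context: We say the Dedekind zeta function of a Dedekind domain $S$ is defined if the residue field of every maximal ideal of $S$ is finite and, for every bound, there are only finitely many maximal ideals of $S$ of index at most that bound. In that case $\zeta_S(s)=\sum_{I\subseteq S}|S/I|^{-s}$, summed over all finite-index ideals $I$ of $S$. For a commutative ring $R$ (with finitely many isomorphism classes of finite modules of each cardinality), $\widehat{\zeta}_R(s)=\sum_{M}\frac{1}{|\mathrm{Aut}_R(M)|}|M|^{-s}$, summed over isomorphism classes of finite-cardinality $R$-modules $M$. All these are formal Dirichlet series, i.e. formal expressions $f(s)=\sum_{n\geq 1}a_n n^{-s}$ with $a_n\in\mathbb{C}$, added termwise and multiplied by Dirichlet convolution. For integers $m\geq 1$ and $k$, $f(ms+k):=\sum_{n\ge1} a_n n^{-k}(n^m)^{-s}$. Infinite products are understood coefficientwise, with coefficients converging in $\mathbb{C}$. *)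

theory Defs
  imports "HOL-Algebra.Algebra"
    "HOL-Algebra.Algebraic_Closure_Type"
    "HOL-Computational_Algebra.Polynomial_Factorial"
    Complex_Main
begin

section \<open>Formal Dirichlet series\<close>

text \<open>
  The formal Dirichlet series with coefficients $a_1, a_2, \ldots$ is the function
  $n \mapsto a_n$; the value at \<open>0\<close> carries no meaning and is never inspected.
\<close>

type_synonym dirichlet_series = "nat \<Rightarrow> complex"

definition dir_one :: dirichlet_series where
  "dir_one n = (if n = 1 then 1 else 0)"

definition dir_mult :: "dirichlet_series \<Rightarrow> dirichlet_series \<Rightarrow> dirichlet_series" where
  "dir_mult f g n = (\<Sum>d | d dvd n. f d * g (n div d))"

text \<open>
  \<open>dir_subst m k f\<close> is $f(ms+k) = \sum_n a_n n^{-k} (n^m)^{-s}$ for \<open>m \<ge> 1\<close>; the index set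
  of the sum below then has at most one element.
\<close>

definition dir_subst :: "nat \<Rightarrow> int \<Rightarrow> dirichlet_series \<Rightarrow> dirichlet_series" where
  "dir_subst m k f N = (\<Sum>n | n \<ge> 1 \<and> n ^ m = N. f n * of_nat n powi (- k))"

primrec dir_partial_prod :: "(nat \<Rightarrow> dirichlet_series) \<Rightarrow> nat \<Rightarrow> dirichlet_series" where
  "dir_partial_prod F 0 = dir_one"
| "dir_partial_prod F (Suc N) = dir_mult (dir_partial_prod F N) (F (Suc N))"

text \<open>
  The infinite product of \<open>F 1, F 2, \<dots>\<close> (the value \<open>F 0\<close> is not a factor) exists and equals
  \<open>P\<close>: every coefficient of the partial products converges in the complex numbers to that
  of \<open>P\<close>.
\<close>

definition dir_has_prod :: "(nat \<Rightarrow> dirichlet_series) \<Rightarrow> dirichlet_series \<Rightarrow> bool" where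
  "dir_has_prod F P \<longleftrightarrow> (\<forall>n\<ge>1. (\<lambda>N. dir_partial_prod F N n) \<longlonglongrightarrow> P n)"


section \<open>Dedekind domains and their zeta functions\<close>

text \<open>
  The ring is given as a type; \<^const>\<open>ring_of_type_algebra\<close> is its ring structure as a record
  with carrier \<open>UNIV\<close>.
\<close>

definition integrally_closed :: "'a::idom itself \<Rightarrow> bool" where
  "integrally_closed _ \<longleftrightarrow>
     (\<forall>x::'a fract. (\<exists>p::'a poly. lead_coeff p = 1 \<and> poly (map_poly to_fract p) x = 0)
        \<longrightarrow> x \<in> range to_fract)"

text \<open>Fields are Dedekind domains in this convention.\<close>

definition dedekind_domain :: "'a::idom itself \<Rightarrow> bool" where
  "dedekind_domain T \<longleftrightarrow>
     noetherian_ring (ring_of_type_algebra :: 'a ring) \<and>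
     integrally_closed T \<and>
     (\<forall>P. primeideal P (ring_of_type_algebra :: 'a ring) \<and> P \<noteq> {0}
        \<longrightarrow> maximalideal P (ring_of_type_algebra :: 'a ring))"

definition ideal_index :: "('a, 'm) ring_scheme \<Rightarrow> 'a set \<Rightarrow> nat" where
  "ideal_index R I = card (carrier (R Quot I))"

definition dedekind_zeta_defined :: "('a, 'm) ring_scheme \<Rightarrow> bool" where
  "dedekind_zeta_defined R \<longleftrightarrow>
     (\<forall>I. maximalideal I R \<longrightarrow> finite (carrier (R Quot I))) \<and>
     (\<forall>B. finite {I. maximalideal I R \<and> ideal_index R I \<le> B})"

definition dedekind_zeta :: "('a, 'm) ring_scheme \<Rightarrow> dirichlet_series" where
  "dedekind_zeta R n =
     of_nat (card {I. ideal I R \<and> finite (carrier (R Quot I)) \<and> ideal_index R I = n})"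


section \<open>The zeta function counting finite modules\<close>

text \<open>
  Isomorphisms are required to be extensional so that they are determined by their values on
  the carrier; otherwise a finite module would have infinitely many automorphisms.
\<close>

definition module_isos ::
    "('a, 'r) ring_scheme \<Rightarrow> ('a, 'b, 'm) module_scheme \<Rightarrow> ('a, 'c, 'n) module_scheme \<Rightarrow> ('b \<Rightarrow> 'c) set" where
  "module_isos R M N =
     {f \<in> extensional (carrier M). f \<in> iso (add_monoid M) (add_monoid N) \<and>
        (\<forall>r\<in>carrier R. \<forall>x\<in>carrier M. f (r \<odot>\<^bsub>M\<^esub> x) = r \<odot>\<^bsub>N\<^esub> f x)}"

abbreviation module_auts :: "('a, 'r) ring_scheme \<Rightarrow> ('a, 'b, 'm) module_scheme \<Rightarrow> ('b \<Rightarrow> 'b) set" where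
  "module_auts R M \<equiv> module_isos R M M"

text \<open>
  Every finite module is isomorphic to one whose carrier is a set of natural numbers, so
  these represent all isomorphism classes of modules with \<open>n\<close> elements. (The ring
  multiplication and unit that a module record also contains are irrelevant, and ignored by
  \<^const>\<open>module\<close> and \<^const>\<open>module_isos\<close>.)
\<close>

definition finite_modules :: "('a, 'r) ring_scheme \<Rightarrow> nat \<Rightarrow> ('a, nat) module set" where
  "finite_modules R n = {M. module R M \<and> finite (carrier M) \<and> card (carrier M) = n}"

definition finite_module_classes :: "('a, 'r) ring_scheme \<Rightarrow> nat \<Rightarrow> ('a, nat) module set set" where
  "finite_module_classes R n =
     finite_modules R n //
       {(M, N). M \<in> finite_modules R n \<and> N \<in> finite_modules R n \<and> module_isos R M N \<noteq> {}}"

definition module_zeta_defined :: "('a, 'r) ring_scheme \<Rightarrow> bool" where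
  "module_zeta_defined R \<longleftrightarrow> (\<forall>n. finite (finite_module_classes R n))"

definition module_zeta :: "('a, 'r) ring_scheme \<Rightarrow> dirichlet_series" where
  "module_zeta R n =
     (\<Sum>C\<in>finite_module_classes R n. 1 / of_nat (card (module_auts R (SOME M. M \<in> C))))"

end

theory Submission
  imports Defs
begin

text \<open>
  A finite module over \<open>S[T]\<close> is a finite \<open>S\<close>-module \<open>M\<close> with an endomorphism, so counting the
  orbits of \<open>Aut M\<close> on \<open>End M\<close> turns the left-hand side into the sum over finite \<open>S\<close>-modules of
  \<open>|End M| / |Aut M| |M|\<^sup>-\<^sup>s\<close>. A finite \<open>S\<close>-module is a direct sum of modules \<open>S / P\<^sup>e\<close>, that is a
  multiset of pairs \<open>(P, e)\<close>, and splitting off a summand with \<open>e\<close> maximal shows by induction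
  that \<open>|End M| / |Aut M|\<close> is the product over all \<open>(P, e)\<close> of \<open>\<Prod>k\<le>m. 1 / (1 - q\<^sup>-\<^sup>k)\<close>, where \<open>m\<close> is
  the multiplicity of \<open>(P, e)\<close> and \<open>q = |S / P|\<close>. The series therefore is the product over \<open>i\<close>
  of the series of the multisets with all \<open>e = i\<close>. Since finite index ideals are multisets of
  maximal ideals, the latter is the product of the \<open>\<zeta>(is + j - 1)\<close> by the \<open>q\<close>-binomial theorem,
  applied at each \<open>P\<close>.
\<close>

section \<open>Ideals and uniformizers\<close>

text \<open>An isomorphism class of pairs \<open>(M, \<phi>)\<close> is an orbit of
  \<open>Aut M\<close> on \<open>End M\<close> and its automorphism group is a stabilizer, whence
  the total weight \<open>|End M| / |Aut M|\<close>. A summand \<open>S / P ^ e\<close> is taken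
  with \<open>e\<close> maximal because only then does every element with annihilator
  \<open>P ^ e\<close> generate a direct summand. Automorphisms permute these elements transitively
  only if all the complements are isomorphic; this cancellation is why the uniqueness half of the
  classification is needed and not just the existence of decompositions. The two infinite products
  converge for different reasons. In the product over \<open>i\<close> each coefficient is
  eventually constant, as \<open>S / P ^ i\<close> has at least \<open>2 ^ i\<close> elements. In
  the product over \<open>j\<close> a limit remains: the first \<open>J\<close> factors give
  products of Gaussian binomial coefficients in \<open>1 / q\<close>, which become the factors
  \<open>1 / (1 - q ^ (-k))\<close> only as \<open>J\<close> tends to infinity. The localization at
  \<open>P\<close> is never formed. Its fractions are replaced by multiplication with elements
  outside \<open>P\<close>, so that all constructions stay in \<open>S\<close>.\<close>

abbreviation "type_ring \<equiv> (ring_of_type_algebra :: 'a::idom ring)"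

lemma type_ring_simps [simp]:
  "carrier type_ring = UNIV" "\<zero>\<^bsub>type_ring\<^esub> = 0" "\<one>\<^bsub>type_ring\<^esub> = 1"
  "x \<oplus>\<^bsub>type_ring\<^esub> y = x + y" "x \<otimes>\<^bsub>type_ring\<^esub> y = x * y"
  by (simp_all add: ring_of_type_algebra_def)

lemma cring_type_ring: "cring (type_ring :: 'a::idom ring)"
  by (rule cring_from_type_algebra)

definition is_ideal :: "'a::idom set \<Rightarrow> bool" where
  "is_ideal I \<longleftrightarrow> 0 \<in> I \<and> (\<forall>x\<in>I. \<forall>y\<in>I. x + y \<in> I) \<and> (\<forall>r. \<forall>x\<in>I. r * x \<in> I)"

lemma is_idealI:
  assumes "0 \<in> I" "\<And>x y. x \<in> I \<Longrightarrow> y \<in> I \<Longrightarrow> x + y \<in> I" "\<And>r x. x \<in> I \<Longrightarrow> r * x \<in> I"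
  shows "is_ideal I"
  using assms by (auto simp: is_ideal_def)

lemma
  assumes "is_ideal I"
  shows is_ideal_zero: "0 \<in> I"
    and is_ideal_add: "x \<in> I \<Longrightarrow> y \<in> I \<Longrightarrow> x + y \<in> I"
    and is_ideal_mult: "x \<in> I \<Longrightarrow> r * x \<in> I"
    and is_ideal_mult_right: "x \<in> I \<Longrightarrow> x * r \<in> I"
    and is_ideal_minus: "x \<in> I \<Longrightarrow> - x \<in> I"
    and is_ideal_diff: "x \<in> I \<Longrightarrow> y \<in> I \<Longrightarrow> x - y \<in> I"
proof -
  show "0 \<in> I" using assms by (simp add: is_ideal_def)
  show add: "x \<in> I \<Longrightarrow> y \<in> I \<Longrightarrow> x + y \<in> I" for x y
    using assms by (simp add: is_ideal_def)
  show mult: "x \<in> I \<Longrightarrow> r * x \<in> I" for r x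
    using assms by (simp add: is_ideal_def)
  show "x \<in> I \<Longrightarrow> x * r \<in> I" using mult[of x r] by (simp add: mult.commute)
  show minus: "x \<in> I \<Longrightarrow> - x \<in> I" for x using mult[of x "-1"] by simp
  show "x \<in> I \<Longrightarrow> y \<in> I \<Longrightarrow> x - y \<in> I" using add[of x "-y"] minus[of y] by simp
qed

lemma is_ideal_UNIV: "is_ideal UNIV"
  by (simp add: is_ideal_def)

lemma is_ideal_Int: "is_ideal I \<Longrightarrow> is_ideal J \<Longrightarrow> is_ideal (I \<inter> J)"
  by (auto simp: is_ideal_def)

lemma ideal_type_ring_iff: "ideal I (type_ring :: 'a::idom ring) \<longleftrightarrow> is_ideal I"
proof
  interpret cring "type_ring :: 'a ring" by (rule cring_type_ring)
  assume "ideal I (type_ring :: 'a ring)"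
  then interpret ideal I "type_ring :: 'a ring" .
  show "is_ideal I"
    using additive_subgroup.zero_closed[OF additive_subgroup_axioms]
      additive_subgroup.a_closed[OF additive_subgroup_axioms] I_l_closed
    by (intro is_idealI) simp_all
next
  assume I: "is_ideal I"
  interpret cring "type_ring :: 'a ring" by (rule cring_type_ring)
  have minus: "\<ominus>\<^bsub>type_ring\<^esub> x = - x" for x :: 'a
    by (rule minus_equality) simp_all
  show "ideal I (type_ring :: 'a ring)"
  proof (rule idealI)
    show "ring (type_ring :: 'a ring)" by (rule ring_axioms)
    show "subgroup I (add_monoid (type_ring :: 'a ring))"
      using I by (intro add.subgroupI)
        (auto simp: minus is_ideal_add is_ideal_minus dest: is_ideal_zero)
  qed (use I in \<open>auto simp: is_ideal_mult is_ideal_mult_right\<close>)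
qed

text \<open>The quotient \<open>S / I\<close> is modelled on a set of representatives, so that it lives in the type of \<open>S\<close>.\<close>

definition residue_rep :: "'a::idom set \<Rightarrow> 'a \<Rightarrow> 'a" where
  "residue_rep I x = (SOME y. y - x \<in> I)"

definition residues :: "'a::idom set \<Rightarrow> 'a set" where
  "residues I = range (residue_rep I)"

lemma residue_rep_diff:
  assumes "is_ideal I" shows "residue_rep I x - x \<in> I"
  unfolding residue_rep_def by (rule someI[of _ x]) (simp add: assms is_ideal_zero)

lemma residue_rep_eq_iff:
  assumes I: "is_ideal I" shows "residue_rep I x = residue_rep I y \<longleftrightarrow> x - y \<in> I"
proof
  assume "residue_rep I x = residue_rep I y"
  then show "x - y \<in> I"
    using is_ideal_diff[OF I residue_rep_diff[OF I, of y] residue_rep_diff[OF I, of x]] by simp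
next
  assume xy: "x - y \<in> I"
  \<comment> \<open>The predicates under \<open>SOME\<close> agree for \<open>x\<close> and
    \<open>y\<close>, so the choice operator returns the same representative.\<close>
  have "z - x \<in> I \<longleftrightarrow> z - y \<in> I" for z
    using is_ideal_add[OF I _ xy, of "z - x"] is_ideal_diff[OF I _ xy, of "z - y"] by auto
  then show "residue_rep I x = residue_rep I y" by (simp add: residue_rep_def)
qed

lemma residue_rep_residue [simp]:
  assumes "is_ideal I" "x \<in> residues I" shows "residue_rep I x = x"
  using assms residue_rep_diff[OF assms(1)]
  by (auto simp: residues_def residue_rep_eq_iff)

lemma residue_rep_in [simp]: "residue_rep I x \<in> residues I"
  by (simp add: residues_def)

lemma residue_rep_eq_zero_iff:
  "is_ideal I \<Longrightarrow> residue_rep I x = residue_rep I 0 \<longleftrightarrow> x \<in> I"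
  by (simp add: residue_rep_eq_iff)

text \<open>The representatives form a transversal of the cosets of \<open>I\<close>. Elements of
  the quotient ring are sets of ring elements; this lemma allows representatives to be counted
  instead.\<close>

lemma residues_Quot:
  assumes I: "is_ideal I"
  shows "finite (carrier ((type_ring :: 'a::idom ring) Quot I)) \<longleftrightarrow> finite (residues I)"
    and "ideal_index (type_ring :: 'a ring) I = card (residues I)"
proof -
  let ?c = "\<lambda>x. (\<lambda>h. h + x) ` I"
  have carr: "carrier ((type_ring :: 'a ring) Quot I) = range ?c"
    by (auto simp: FactRing_def A_RCOSETS_def' a_r_coset_def' image_iff)
  have c: "?c x = {y. y - x \<in> I}" for x
    by (force simp: image_iff)
  have eq: "?c x = ?c y \<longleftrightarrow> x - y \<in> I" for x y
  proof
    assume "?c x = ?c y"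
    moreover have "x \<in> ?c x" using is_ideal_zero[OF I] by (auto simp: c)
    ultimately show "x - y \<in> I" by (auto simp: c)
  next
    assume xy: "x - y \<in> I"
    have "z - x \<in> I \<longleftrightarrow> z - y \<in> I" for z
      using is_ideal_add[OF I _ xy, of "z - x"] is_ideal_diff[OF I _ xy, of "z - y"] by auto
    then show "?c x = ?c y" by (simp add: c)
  qed
  have rep: "residue_rep I x - x \<in> I" for x by (rule residue_rep_diff[OF I])
  have bij: "bij_betw ?c (residues I) (carrier ((type_ring :: 'a ring) Quot I))"
    unfolding carr bij_betw_def
  proof
    show "inj_on ?c (residues I)"
      by (auto simp: inj_on_def eq residue_rep_eq_iff[OF I, symmetric] I)
    show "?c ` residues I = range ?c"
    proof safe
      fix x show "?c x \<in> ?c ` residues I"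
        by (rule image_eqI[of _ _ "residue_rep I x"])
          (use rep[of x] eq[of "residue_rep I x" x] in auto)
    qed auto
  qed
  show "finite (carrier ((type_ring :: 'a ring) Quot I)) \<longleftrightarrow> finite (residues I)"
    using bij_betw_finite[OF bij] by simp
  show "ideal_index (type_ring :: 'a ring) I = card (residues I)"
    using bij_betw_same_card[OF bij] by (simp add: ideal_index_def)
qed

lemma residues_UNIV: "residues (UNIV :: 'a::idom set) = {residue_rep UNIV 0}"
proof -
  have "residue_rep UNIV = (\<lambda>x::'a. residue_rep UNIV 0)"
    by (rule ext) (simp add: residue_rep_eq_iff is_ideal_UNIV)
  then show ?thesis
    unfolding residues_def by (metis UNIV_not_empty image_constant_conv)
qed

text \<open>The hypotheses say that multiplication by \<open>t\<close> induces an isomorphism of \<open>S / K\<close> onto \<open>I / J\<close>.\<close>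

lemma card_residues_mult:
  assumes I: "is_ideal I" and J: "is_ideal J" and K: "is_ideal K"
    and JI: "J \<subseteq> I" and t_in: "\<And>y. t * y \<in> I"
    and t_iff: "\<And>y. t * y \<in> J \<longleftrightarrow> y \<in> K" and surj: "\<And>x. x \<in> I \<Longrightarrow> \<exists>y. x - t * y \<in> J"
  shows "card (residues J) = card (residues I) * card (residues K)"
    and "finite (residues I) \<Longrightarrow> finite (residues K) \<Longrightarrow> finite (residues J)"
proof -
  \<comment> \<open>\<open>S / J\<close> maps onto \<open>S / I\<close> with fibres the translates
    of \<open>I / J\<close>, and \<open>I / J\<close> is \<open>t\<close> times
    \<open>S / K\<close>; so \<open>c + t * d\<close> meets every coset of \<open>J\<close>
    once.\<close>
  define f where "f = (\<lambda>(c, d). residue_rep J (c + t * d))"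
  have "bij_betw f (residues I \<times> residues K) (residues J)"
    unfolding bij_betw_def
  proof
    show "inj_on f (residues I \<times> residues K)"
    proof (rule inj_onI, clarsimp simp: f_def)
      fix c d c' d'
      assume mem: "c \<in> residues I" "d \<in> residues K" "c' \<in> residues I" "d' \<in> residues K"
        and "residue_rep J (c + t * d) = residue_rep J (c' + t * d')"
      then have *: "(c - c') + t * (d - d') \<in> J"
        by (simp add: residue_rep_eq_iff[OF J] algebra_simps)
      then have "c - c' \<in> I"
        using is_ideal_diff[OF I _ t_in[of "d - d'"], of "(c - c') + t * (d - d')"] JI by auto
      then have c: "c = c'" using mem I by (metis residue_rep_eq_iff residue_rep_residue)
      with * have "d - d' \<in> K" by (simp add: t_iff)
      then have "d = d'" using mem K by (metis residue_rep_eq_iff residue_rep_residue)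
      with c show "c = c' \<and> d = d'" by simp
    qed
    show "f ` (residues I \<times> residues K) = residues J"
    proof safe
      fix z assume z: "z \<in> residues J"
      have "z - residue_rep I z \<in> I"
        using is_ideal_minus[OF I residue_rep_diff[OF I, of z]] by simp
      from surj[OF this] obtain y where y: "z - residue_rep I z - t * y \<in> J" by blast
      have "t * (y - residue_rep K y) \<in> J"
        using is_ideal_minus[OF K residue_rep_diff[OF K, of y]] by (simp add: t_iff)
      from is_ideal_add[OF J y this]
      have "z - (residue_rep I z + t * residue_rep K y) \<in> J" by (simp add: algebra_simps)
      then have "z = f (residue_rep I z, residue_rep K y)"
        using z J by (simp add: f_def residue_rep_eq_iff[symmetric])
      then show "z \<in> f ` (residues I \<times> residues K)" by auto
    qed (auto simp: f_def)
  qed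
  then show "card (residues J) = card (residues I) * card (residues K)"
    and "finite (residues I) \<Longrightarrow> finite (residues K) \<Longrightarrow> finite (residues J)"
    using bij_betw_same_card bij_betw_finite by (fastforce simp: card_cartesian_product)+
qed

text \<open>
  For a maximal ideal of a Dedekind domain this is the ordinary power of \<open>P\<close>; passing to the
  localization at \<open>P\<close> in every step avoids sums of products.
\<close>

primrec prime_power :: "'a::idom set \<Rightarrow> nat \<Rightarrow> 'a set" where
  "prime_power P 0 = UNIV"
| "prime_power P (Suc n) = {r. \<exists>u p y. u \<notin> P \<and> p \<in> P \<and> y \<in> prime_power P n \<and> u * r = p * y}"

declare prime_power.simps(2) [simp del]

text \<open>
  The conditions \<open>s * P \<subseteq> t * S\<close>, \<open>t \<in> P\<close>, \<open>s \<notin> P\<close> say that \<open>t\<close> generates the maximal ideal of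
  the localization of \<open>S\<close> at \<open>P\<close>.
\<close>

locale uniformizer =
  fixes P :: "'a::idom set" and t s :: 'a
  assumes ideal_P: "is_ideal P" and one_notin: "1 \<notin> P"
    and inv_mod_P: "\<And>r. r \<notin> P \<Longrightarrow> \<exists>v. v * r - 1 \<in> P"
    and t_in: "t \<in> P" and t_nz: "t \<noteq> 0" and s_notin: "s \<notin> P"
    and s_P: "\<And>p. p \<in> P \<Longrightarrow> \<exists>y. s * p = t * y"
    and finite_residues_P: "finite (residues P)"
begin

lemma mult_notin: "u \<notin> P \<Longrightarrow> v \<notin> P \<Longrightarrow> u * v \<notin> P"
proof
  assume u: "u \<notin> P" and v: "v \<notin> P" and uv: "u * v \<in> P"
  obtain a where "a * u - 1 \<in> P" using inv_mod_P[OF u] by blast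
  then have "a * (u * v) - v * (a * u - 1) \<in> P"
    using uv is_ideal_diff[OF ideal_P] is_ideal_mult[OF ideal_P] by blast
  moreover have "a * (u * v) - v * (a * u - 1) = v" by (simp add: algebra_simps)
  ultimately show False using v by simp
qed

lemma power_notin: "u \<notin> P \<Longrightarrow> u ^ n \<notin> P"
  by (induction n) (auto simp: one_notin mult_notin)

text \<open>Each factor from \<open>P\<close> can be exchanged for \<open>t\<close> at the cost of
  the denominator \<open>s\<close>, so the recursion collapses to: \<open>r\<close> is a multiple of
  \<open>t ^ n\<close> in the localization at \<open>P\<close>. Equations
  \<open>u * r = y * t ^ n\<close> with \<open>u\<close> outside \<open>P\<close> replace fractions
  from here on.\<close>

lemma prime_power_iff: "r \<in> prime_power P n \<longleftrightarrow> (\<exists>u y. u \<notin> P \<and> u * r = y * t ^ n)"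
proof (induction n arbitrary: r)
  case 0
  show ?case using one_notin by (auto intro!: exI[of _ 1])
next
  case (Suc n)
  show ?case
  proof
    assume "r \<in> prime_power P (Suc n)"
    then obtain u p y where 1: "u \<notin> P" "p \<in> P" "y \<in> prime_power P n" "u * r = p * y" by (auto simp: prime_power.simps(2))
    from 1(3) Suc obtain u' z where 2: "u' \<notin> P" "u' * y = z * t ^ n" by blast
    from s_P[OF 1(2)] obtain p' where 3: "s * p = t * p'" by blast
    have "(s * u' * u) * r = s * u' * (u * r)" by (simp add: algebra_simps)
    also have "\<dots> = (s * p) * (u' * y)" unfolding 1(4) by (simp only: ac_simps)
    also have "\<dots> = (p' * z) * t ^ Suc n" unfolding 2(2) 3 by (simp add: ac_simps)
    finally show "\<exists>u y. u \<notin> P \<and> u * r = y * t ^ Suc n"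
      using mult_notin[OF mult_notin[OF s_notin 2(1)] 1(1)] by blast
  next
    assume "\<exists>u y. u \<notin> P \<and> u * r = y * t ^ Suc n"
    then obtain u y where 1: "u \<notin> P" "u * r = t * (y * t ^ n)" by (auto simp: algebra_simps)
    have "y * t ^ n \<in> prime_power P n" unfolding Suc using one_notin by (auto intro!: exI[of _ 1])
    with 1 t_in show "r \<in> prime_power P (Suc n)" by (auto simp: prime_power.simps(2))
  qed
qed

lemma t_power_in: "y * t ^ n \<in> prime_power P n"
  unfolding prime_power_iff using one_notin by (auto intro!: exI[of _ 1])

lemma is_ideal_prime_power: "is_ideal (prime_power P n)"
proof (rule is_idealI)
  show "0 \<in> prime_power P n" using t_power_in[of 0 n] by simp
next
  fix x y assume "x \<in> prime_power P n" "y \<in> prime_power P n"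
  then obtain u a v b where 1: "u \<notin> P" "u * x = a * t ^ n" and 2: "v \<notin> P" "v * y = b * t ^ n"
    by (auto simp: prime_power_iff)
  have "(u * v) * (x + y) = v * (u * x) + u * (v * y)" by (simp add: algebra_simps)
  also have "\<dots> = (v * a + u * b) * t ^ n" unfolding 1(2) 2(2) by (simp add: algebra_simps)
  finally show "x + y \<in> prime_power P n" using mult_notin[OF 1(1) 2(1)] by (auto simp: prime_power_iff)
next
  fix r x assume "x \<in> prime_power P n"
  then obtain u a where 1: "u \<notin> P" "u * x = a * t ^ n" by (auto simp: prime_power_iff)
  then have "u * (r * x) = (r * a) * t ^ n" by (metis mult.assoc mult.left_commute)
  then show "r * x \<in> prime_power P n" using 1 unfolding prime_power_iff by blast
qed

lemma prime_power_cancel: "u \<notin> P \<Longrightarrow> u * r \<in> prime_power P n \<Longrightarrow> r \<in> prime_power P n"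
  unfolding prime_power_iff by (metis mult.assoc mult_notin)

lemma prime_power_1: "prime_power P (Suc 0) = P"
proof
  show "prime_power P (Suc 0) \<subseteq> P"
  proof
    fix r assume "r \<in> prime_power P (Suc 0)"
    then obtain u y where "u \<notin> P" "u * r = y * t" unfolding prime_power_iff by auto
    moreover have "y * t \<in> P" using t_in is_ideal_mult[OF ideal_P] by blast
    ultimately show "r \<in> P" using mult_notin[of u r] by auto
  qed
  show "P \<subseteq> prime_power P (Suc 0)"
    using one_notin by (force simp: prime_power.simps(2) intro: exI[of _ 1])
qed

lemma t_mult_iff: "t ^ k * r \<in> prime_power P (k + n) \<longleftrightarrow> r \<in> prime_power P n"
proof -
  have "u * (t ^ k * r) = y * t ^ (k + n) \<longleftrightarrow> u * r = y * t ^ n" for u y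
    using t_nz by (simp add: power_add algebra_simps)
  then show ?thesis by (simp add: prime_power_iff)
qed

lemma prime_power_antimono: "m \<le> n \<Longrightarrow> prime_power P n \<subseteq> prime_power P m"
proof
  fix r assume mn: "m \<le> n" and "r \<in> prime_power P n"
  then obtain u y where u: "u \<notin> P" "u * r = y * t ^ n" by (auto simp: prime_power_iff)
  have "y * t ^ n = (y * t ^ (n - m)) * t ^ m" using mn by (simp flip: power_add add: mult.assoc)
  with u show "r \<in> prime_power P m" by (auto simp: prime_power_iff)
qed

text \<open>The localization at \<open>P\<close> is a discrete valuation ring: \<open>j\<close> is
  the valuation of \<open>r\<close>, and \<open>r\<close> is a unit times \<open>t ^ j\<close>, the
  unit being written with numerator \<open>w\<close> and denominator \<open>u\<close> outside
  \<open>P\<close>.\<close>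

lemma notin_prime_power:
  assumes "r \<notin> prime_power P n"
  obtains j u w where "j < n" "u \<notin> P" "w \<notin> P" "u * r = w * t ^ j" "r \<in> prime_power P j"
  using assms
proof (induction n arbitrary: thesis)
  case 0
  then show ?case by simp
next
  case (Suc n)
  show ?case
  proof (cases "r \<in> prime_power P n")
    case True
    then obtain u y where u: "u \<notin> P" "u * r = y * t ^ n" by (auto simp: prime_power_iff)
    \<comment> \<open>Otherwise \<open>s\<close> would exchange \<open>y\<close> for another factor
      \<open>t\<close>, and \<open>r\<close> would lie in the next power.\<close>
    have "y \<notin> P"
    proof
      assume "y \<in> P"
      from s_P[OF this] obtain y' where "s * y = t * y'" by blast
      then have "(s * u) * r = y' * t ^ Suc n" by (simp add: mult.assoc u mult.left_commute)
      then have "r \<in> prime_power P (Suc n)" using mult_notin[OF s_notin u(1)] by (auto simp: prime_power_iff)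
      with Suc.prems show False by simp
    qed
    with u True show ?thesis using Suc.prems(1)[of n u y] by simp
  next
    case False
    then show ?thesis using Suc.IH Suc.prems(1) by (metis less_Suc_eq)
  qed
qed

lemma power_in_prime_power: "p \<in> P \<Longrightarrow> p ^ n \<in> prime_power P n"
proof -
  assume "p \<in> P"
  from s_P[OF this] obtain y where "s * p = t * y" by blast
  then have "s ^ n * p ^ n = y ^ n * t ^ n" by (simp flip: power_mult_distrib add: mult.commute)
  then show ?thesis using power_notin[OF s_notin] by (auto simp: prime_power_iff)
qed

text \<open>If \<open>v0\<close> inverts \<open>u\<close> modulo \<open>P\<close>, then
  \<open>(1 - v0 * u) ^ n\<close> lies in the \<open>n\<close>-th power of \<open>P\<close>, and its
  expansion is \<open>1\<close> minus a multiple of \<open>u\<close>; the cofactor is the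
  inverse.\<close>

lemma inv_mod_prime_power:
  assumes "u \<notin> P" obtains v where "v * u - 1 \<in> prime_power P n"
proof -
  obtain v0 where "v0 * u - 1 \<in> P" using inv_mod_P[OF assms] by blast
  then have "1 - v0 * u \<in> P" using is_ideal_minus[OF ideal_P] by fastforce
  then have *: "(1 - v0 * u) ^ n \<in> prime_power P n" by (rule power_in_prime_power)
  have "\<exists>v. 1 - (1 - v0 * u) ^ n = v * u"
  proof (induction n)
    case (Suc n)
    then obtain v where v: "1 - (1 - v0 * u) ^ n = v * u" by blast
    have "1 - (1 - v0 * u) ^ Suc n = (v + v0 * (1 - v0 * u) ^ n) * u"
      unfolding distrib_right v[symmetric] by (simp add: algebra_simps)
    then show ?case by blast
  qed auto
  then obtain v where "1 - (1 - v0 * u) ^ n = v * u" by blast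
  then have "v * u - 1 = - ((1 - v0 * u) ^ n)" by (metis diff_diff_eq2 minus_diff_eq diff_add_cancel add_diff_cancel_left' add.commute uminus_add_conv_diff)
  then show ?thesis using is_ideal_minus[OF is_ideal_prime_power *] that by metis
qed

text \<open>Modulo a power of \<open>P\<close> the elements outside \<open>P\<close> are invertible,
  so the denominator in \<open>prime_power_iff\<close> can be cleared inside \<open>S\<close>
  itself.\<close>

lemma t_generates:
  assumes "r \<in> prime_power P k" shows "\<exists>y. r - t ^ k * y \<in> prime_power P n"
proof -
  obtain u y where u: "u \<notin> P" "u * r = y * t ^ k" using assms by (auto simp: prime_power_iff)
  obtain v where v: "v * u - 1 \<in> prime_power P n" using inv_mod_prime_power[OF u(1)] .
  have "r - t ^ k * (v * y) = - (r * (v * u - 1))"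
    using u(2) by (simp add: algebra_simps)
  then show ?thesis using v is_ideal_minus[OF is_ideal_prime_power] is_ideal_mult[OF is_ideal_prime_power] by metis
qed

text \<open>Multiplication by \<open>t\<close> identifies \<open>S / P ^ n\<close> with
  \<open>P / P ^ (n + 1)\<close>, so each further power multiplies the index by that of
  \<open>P\<close>.\<close>

lemma residues_prime_power:
  "card (residues (prime_power P n)) = card (residues P) ^ n \<and> finite (residues (prime_power P n))"
proof (induction n)
  case 0
  show ?case by (simp add: residues_UNIV)
next
  case (Suc n)
  have surj: "\<exists>y. x - t * y \<in> prime_power P (Suc n)" if "x \<in> P" for x
    using t_generates[of x 1 "Suc n"] that by (simp add: prime_power_1)
  have iff: "t * y \<in> prime_power P (Suc n) \<longleftrightarrow> y \<in> prime_power P n" for y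
    using t_mult_iff[of 1 y n] by (simp)
  have sub: "prime_power P (Suc n) \<subseteq> P"
    using prime_power_antimono[of "Suc 0" "Suc n"] by (simp add: prime_power_1)
  note * = card_residues_mult[OF ideal_P is_ideal_prime_power is_ideal_prime_power sub
      is_ideal_mult_right[OF ideal_P t_in] iff surj]
  show ?case using Suc * finite_residues_P by simp
qed

lemma card_residues_gt_1: "card (residues P) > 1"
proof -
  have "residue_rep P 0 \<noteq> residue_rep P 1"
    using one_notin is_ideal_minus[OF ideal_P, of "-1"] by (auto simp: residue_rep_eq_iff ideal_P)
  then have "card {residue_rep P 0, residue_rep P 1} = 2" by simp
  moreover have "card {residue_rep P 0, residue_rep P 1} \<le> card (residues P)"
    by (rule card_mono[OF finite_residues_P]) auto
  ultimately show ?thesis by simp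
qed

end


section \<open>Maximal ideals of a Dedekind domain and the existence of uniformizers\<close>

lemma maximalideal_iff:
  "maximalideal P (type_ring :: 'a::idom ring) \<longleftrightarrow>
    is_ideal P \<and> 1 \<notin> P \<and> (\<forall>r. r \<notin> P \<longrightarrow> (\<exists>v. v * r - 1 \<in> P))"
proof (intro iffI conjI allI impI)
  assume "maximalideal P (type_ring :: 'a ring)"
  then interpret maximalideal P "type_ring :: 'a ring" .
  show P: "is_ideal P" using is_ideal by (simp add: ideal_type_ring_iff)
  show "1 \<notin> P" using I_notcarr is_ideal_mult[OF P, of 1] by auto
  fix r assume r: "r \<notin> P"
  \<comment> \<open>The ideal generated by \<open>P\<close> and \<open>r\<close>. Maximality makes
    it the unit ideal, and \<open>1\<close> in it yields an inverse of \<open>r\<close> modulo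
    \<open>P\<close>.\<close>
  define J where "J = {x. \<exists>v. x - v * r \<in> P}"
  have "is_ideal J"
  proof (rule is_idealI)
    show "0 \<in> J" using is_ideal_zero[OF P] by (auto simp: J_def intro!: exI[of _ 0])
  next
    fix x y assume "x \<in> J" "y \<in> J"
    then obtain v w where "x - v * r \<in> P" "y - w * r \<in> P" by (auto simp: J_def)
    from is_ideal_add[OF P this] have "(x + y) - (v + w) * r \<in> P" by (simp add: algebra_simps)
    then show "x + y \<in> J" by (auto simp: J_def)
  next
    fix c x assume "x \<in> J"
    then obtain v where "x - v * r \<in> P" by (auto simp: J_def)
    from is_ideal_mult[OF P this, of c] have "c * x - (c * v) * r \<in> P" by (simp add: algebra_simps)
    then show "c * x \<in> J" by (auto simp: J_def)
  qed
  moreover have "P \<subseteq> J" by (auto simp: J_def intro!: exI[of _ 0])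
  moreover have "r \<in> J" using is_ideal_zero[OF P] by (auto simp: J_def intro!: exI[of _ 1])
  ultimately have "J = UNIV" using I_maximal[of J] r by (auto simp: ideal_type_ring_iff)
  then obtain v where "1 - v * r \<in> P" by (auto simp: J_def)
  then show "\<exists>v. v * r - 1 \<in> P" using is_ideal_minus[OF P] by fastforce
next
  assume *: "is_ideal P \<and> 1 \<notin> P \<and> (\<forall>r. r \<notin> P \<longrightarrow> (\<exists>v. v * r - 1 \<in> P))"
  show "maximalideal P (type_ring :: 'a ring)"
  proof (rule maximalidealI)
    fix J assume J: "ideal J (type_ring :: 'a ring)" "P \<subseteq> J"
    then have "is_ideal J" by (simp add: ideal_type_ring_iff)
    show "J = P \<or> J = carrier type_ring"
    proof (rule disjCI)
      assume "J \<noteq> carrier type_ring"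
      moreover have "J = UNIV" if r: "r \<in> J" "r \<notin> P" for r
      proof -
        obtain v where "v * r - 1 \<in> P" using * r by blast
        then have "v * r - (v * r - 1) \<in> J"
          using J r is_ideal_diff[OF \<open>is_ideal J\<close>] is_ideal_mult[OF \<open>is_ideal J\<close>] by blast
        then have "1 \<in> J" by simp
        then show ?thesis using is_ideal_mult[OF \<open>is_ideal J\<close>, of 1] by auto
      qed
      ultimately show "J = P" using J by auto
    qed
  qed (use * in \<open>auto simp: ideal_type_ring_iff\<close>)
qed

text \<open>In a Noetherian ring the union of a nonempty chain of ideals is a member of the chain,
  so Zorn's lemma applies to every nonempty family of ideals.\<close>

lemma noetherian_maximal_ideal:
  assumes "noetherian_ring (type_ring :: 'a::idom ring)" and "F \<noteq> {}"
    and F: "\<And>I. I \<in> F \<Longrightarrow> is_ideal (I :: 'a set)"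
  obtains M where "M \<in> F" "\<And>I. I \<in> F \<Longrightarrow> M \<subseteq> I \<Longrightarrow> I = M"
proof -
  interpret noetherian_ring "type_ring :: 'a ring" by fact
  have "\<exists>M\<in>F. \<forall>I\<in>F. M \<subseteq> I \<longrightarrow> I = M"
  proof (rule subset_Zorn_nonempty)
    fix C assume "C \<noteq> {}" and C: "subset.chain F C"
    then have "subset.chain {I. ideal I (type_ring :: 'a ring)} C"
      using F by (auto simp: subset_chain_def ideal_type_ring_iff)
    then have "\<Union>C \<in> C" using ideal_chain_is_trivial \<open>C \<noteq> {}\<close> by blast
    then show "\<Union>C \<in> F" using C by (auto simp: subset_chain_def)
  qed fact
  then show ?thesis using that by blast
qed

text \<open>
  If \<open>a * P \<subseteq> b * P\<close> then all \<open>(a / b)^n * b\<close> lie in \<open>S\<close>, so \<open>a / b\<close> is integral by the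
  ascending chain condition.
\<close>

lemma integral_quotient:
  fixes a b :: "'a::idom"
  assumes noeth: "noetherian_ring (type_ring :: 'a ring)" and b: "b \<in> P" "b \<noteq> 0"
    and step: "\<And>p. p \<in> P \<Longrightarrow> \<exists>p'\<in>P. a * p = b * p'"
  shows "\<exists>p::'a poly. lead_coeff p = 1 \<and> poly (map_poly to_fract p) (to_fract a / to_fract b) = 0"
proof -
  let ?x = "to_fract a / to_fract b"
  obtain nxt where nxt: "\<And>p. p \<in> P \<Longrightarrow> nxt p \<in> P \<and> a * p = b * nxt p" using step by metis
  define q where "q n = (nxt ^^ n) b" for n
  have qP: "q n \<in> P" for n by (induction n) (auto simp: q_def b nxt)
  have q_Suc: "a * q n = b * q (Suc n)" for n using nxt[OF qP[of n]] by (simp add: q_def)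
  have q_frac: "to_fract (q n) = ?x ^ n * to_fract b" for n
  proof (induction n)
    case (Suc n)
    have "to_fract b * to_fract (q (Suc n)) = to_fract a * to_fract (q n)"
      by (simp only: to_fract_mult[symmetric] q_Suc)
    then show ?case using Suc b by (simp add: field_simps)
  qed (simp add: q_def)
  \<comment> \<open>The ideal generated by \<open>q 0, ..., q (n - 1)\<close>; this ascending chain
    repeats a term.\<close>
  define J where "J n = {\<Sum>i<n. c i * q i | c. True}" for n
  have ideal_J: "is_ideal (J n)" for n
  proof (rule is_idealI)
    show "0 \<in> J n" by (auto simp: J_def intro!: exI[of _ "\<lambda>_. 0"])
  next
    fix x y assume "x \<in> J n" "y \<in> J n"
    then obtain c d where "x = (\<Sum>i<n. c i * q i)" "y = (\<Sum>i<n. d i * q i)" by (auto simp: J_def)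
    then have "x + y = (\<Sum>i<n. (c i + d i) * q i)" by (simp add: sum.distrib algebra_simps)
    then show "x + y \<in> J n" by (auto simp: J_def)
  next
    fix r x assume "x \<in> J n"
    then obtain c where "x = (\<Sum>i<n. c i * q i)" by (auto simp: J_def)
    then have "r * x = (\<Sum>i<n. (r * c i) * q i)" by (simp add: sum_distrib_left mult.assoc)
    then show "r * x \<in> J n" unfolding J_def by (intro CollectI exI[of _ "\<lambda>i. r * c i"]) simp
  qed
  have "range J \<noteq> {}" by simp
  from noeth this obtain M where M: "M \<in> range J" "\<And>I. I \<in> range J \<Longrightarrow> M \<subseteq> I \<Longrightarrow> I = M"
    by (rule noetherian_maximal_ideal) (use ideal_J in auto)
  then obtain n where n: "M = J n" by auto
  have "J n \<subseteq> J (Suc n)"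
  proof
    fix x assume "x \<in> J n"
    then obtain c where "x = (\<Sum>i<n. c i * q i)" by (auto simp: J_def)
    then have "x = (\<Sum>i<Suc n. (c(n := 0)) i * q i)" by simp
    then show "x \<in> J (Suc n)" unfolding J_def by blast
  qed
  then have "J (Suc n) = J n" using M(2)[of "J (Suc n)"] n by blast
  moreover have "q n = (\<Sum>i<Suc n. (if i = n then 1 else 0) * q i)" by simp
  then have "q n \<in> J (Suc n)" unfolding J_def by (intro CollectI exI[of _ "\<lambda>i. if i = n then 1 else 0"]) simp
  ultimately obtain c where c: "q n = (\<Sum>i<n. c i * q i)" by (auto simp: J_def)
  \<comment> \<open>Division by \<open>b\<close> turns \<open>q n = (\<Sum>i<n. c i * q i)\<close>
    into \<open>x ^ n = (\<Sum>i<n. c i * x ^ i)\<close> for \<open>x = a / b\<close>;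
    \<open>p\<close> is the monic polynomial of this relation.\<close>
  define p where "p = monom 1 n - (\<Sum>i<n. monom (c i) i)"
  have coeff_p: "coeff p k = (if k = n then 1 else if k < n then - c k else 0)" for k
    by (auto simp: p_def coeff_sum)
  have "degree p = n" using coeff_p by (intro antisym degree_le le_degree) auto
  then have lead: "lead_coeff p = 1" by (simp add: coeff_p)
  have "poly (map_poly to_fract p) ?x = (\<Sum>i\<le>n. to_fract (coeff p i) * ?x ^ i)"
    using \<open>degree p = n\<close> by (simp add: poly_altdef degree_map_poly coeff_map_poly)
  also have "\<dots> = (\<Sum>i<n. - (to_fract (c i) * ?x ^ i)) + ?x ^ n"
    unfolding lessThan_Suc_atMost[symmetric] by (simp add: coeff_p)
  also have "\<dots> = ?x ^ n - (\<Sum>i<n. to_fract (c i) * ?x ^ i)"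
    by (simp only: sum_negf) simp
  finally have "poly (map_poly to_fract p) ?x * to_fract b =
      ?x ^ n * to_fract b - (\<Sum>i<n. to_fract (c i) * (?x ^ i * to_fract b))"
    by (simp only: left_diff_distrib sum_distrib_right mult.assoc)
  also have "\<dots> = to_fract (q n) - to_fract (\<Sum>i<n. c i * q i)"
    by (simp only: q_frac[symmetric] to_fract_sum to_fract_mult)
  also have "\<dots> = 0" using c by simp
  finally have "poly (map_poly to_fract p) ?x = 0" using b by simp
  with lead show ?thesis by blast
qed

text \<open>The ideal \<open>P\<close> is realised as a colon ideal \<open>(b : a)\<close> with
  \<open>b\<close> in \<open>P\<close>. Then \<open>a / b\<close> carries \<open>P\<close> into
  \<open>S\<close>, but not into \<open>P\<close>: otherwise it would be integral, hence in
  \<open>S\<close>, and \<open>(b : a)\<close> would be everything. Any \<open>t\<close> in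
  \<open>P\<close> that is sent to some \<open>s\<close> outside \<open>P\<close> is a
  uniformizer.\<close>

lemma uniformizer_exists:
  assumes ded: "dedekind_domain TYPE('a::idom)" and nf: "\<not> field (type_ring :: 'a ring)"
    and max: "maximalideal P (type_ring :: 'a ring)" and fin: "finite (residues P)"
  obtains t s where "uniformizer P t s"
proof -
  have noeth: "noetherian_ring (type_ring :: 'a ring)" and ic: "integrally_closed TYPE('a)"
    and prm: "\<And>Q. primeideal Q (type_ring :: 'a ring) \<Longrightarrow> Q \<noteq> {0} \<Longrightarrow> maximalideal Q (type_ring :: 'a ring)"
    using ded by (auto simp: dedekind_domain_def)
  interpret cring "type_ring :: 'a ring" by (rule cring_type_ring)
  have P: "is_ideal P" "1 \<notin> P" "\<And>r. r \<notin> P \<Longrightarrow> \<exists>v. v * r - 1 \<in> P"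
    using max by (auto simp: maximalideal_iff)
  have "primeideal P (type_ring :: 'a ring)" using max maximalideal_prime by blast
  then have P_prime: "x \<in> P \<or> y \<in> P" if "x * y \<in> P" for x y
    using primeideal.I_prime[of P type_ring x y] that by simp
  have "P \<noteq> {0}" using zeromaximalideal_fieldI max nf by auto
  then obtain b where b: "b \<in> P" "b \<noteq> 0" using is_ideal_zero[OF P(1)] by blast
  \<comment> \<open>\<open>C a\<close> is the colon ideal \<open>(b : a)\<close>, the annihilator of
    \<open>a\<close> in \<open>S / b S\<close>. A maximal one among those inside \<open>P\<close>
    turns out to be prime, an associated prime of \<open>S / b S\<close>.\<close>
  define C where "C a = {r. b dvd r * a}" for a
  have ideal_C: "is_ideal (C a)" for a
    by (rule is_idealI) (auto simp: C_def algebra_simps)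
  have "C 1 \<subseteq> P" using is_ideal_mult_right[OF P(1) b(1)] by (auto simp: C_def)
  then have "{C a | a. C a \<subseteq> P} \<noteq> {}" by auto
  from noeth this obtain M where M: "M \<in> {C a | a. C a \<subseteq> P}"
      "\<And>I. I \<in> {C a | a. C a \<subseteq> P} \<Longrightarrow> M \<subseteq> I \<Longrightarrow> I = M"
    by (rule noetherian_maximal_ideal) (use ideal_C in auto)
  then obtain a where a: "C a \<subseteq> P" "M = C a" by auto
  have amax: "C a' = C a" if "C a' \<subseteq> P" "C a \<subseteq> C a'" for a'
    using M(2)[of "C a'"] that a by blast
  have mono: "C a \<subseteq> C (c * a)" for c
    unfolding C_def mult.left_commute[of _ c] by (auto intro: dvd_mult)
  have "C a = P"
  proof -
    have "primeideal (C a) (type_ring :: 'a ring)"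
    proof (rule primeidealI)
      fix x y assume "x \<otimes>\<^bsub>type_ring\<^esub> y \<in> C a"
      then have xy: "y \<in> C (x * a)" by (simp add: C_def ac_simps)
      show "x \<in> C a \<or> y \<in> C a"
      proof (rule ccontr)
        assume neg: "\<not> (x \<in> C a \<or> y \<in> C a)"
        \<comment> \<open>Maximality holds only among the colon ideals inside \<open>P\<close>, so a
          strictly larger one must leave \<open>P\<close>. Using this twice gives \<open>z\<close>
          and \<open>w\<close> outside \<open>P\<close> with \<open>w * z\<close> in
          \<open>C a\<close>, against the primality of \<open>P\<close>.\<close>
        then have "C (x * a) \<noteq> C a" using xy by auto
        then obtain z where z: "z \<in> C (x * a)" "z \<notin> P" using amax mono by blast
        then have "x \<in> C (z * a)" by (simp add: C_def ac_simps)
        then have "C (z * a) \<noteq> C a" using neg by auto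
        then obtain w where w: "w \<in> C (z * a)" "w \<notin> P" using amax mono by blast
        then have "w * z \<in> C a" by (simp add: C_def ac_simps)
        then show False using a P_prime z w by blast
      qed
    qed (use P a ideal_C is_cring in \<open>auto simp: ideal_type_ring_iff\<close>)
    moreover have "b \<in> C a" by (simp add: C_def)
    ultimately have "maximalideal (C a) (type_ring :: 'a ring)" using prm b by blast
    then show ?thesis using a(1) max
        maximalideal.I_maximal[of "C a" "type_ring :: 'a ring" P] P
      by (auto simp: ideal_type_ring_iff maximalideal_iff)
  qed
  have "\<exists>t\<in>P. \<forall>p'\<in>P. a * t \<noteq> b * p'"
  proof (rule ccontr)
    assume "\<not> ?thesis"
    then have "\<exists>p'\<in>P. a * p = b * p'" if "p \<in> P" for p using that by blast
    from integral_quotient[OF noeth b this] ic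
    have "to_fract a / to_fract b \<in> range to_fract" unfolding integrally_closed_def by blast
    then obtain c where "to_fract a / to_fract b = to_fract c" by blast
    then have "to_fract a = to_fract (c * b)" using b by (simp add: field_simps)
    then have "a = c * b" by (simp only: to_fract_eq_iff)
    then have "1 \<in> C a" by (simp add: C_def)
    with \<open>C a = P\<close> P show False by simp
  qed
  then obtain t where t: "t \<in> P" "\<And>p'. p' \<in> P \<Longrightarrow> a * t \<noteq> b * p'" by blast
  have aP: "\<exists>y. a * p = b * y" if "p \<in> P" for p
    using that unfolding \<open>C a = P\<close>[symmetric] by (auto simp: C_def dvd_def mult.commute)
  obtain s where s: "a * t = b * s" using aP[OF t(1)] by blast
  have "uniformizer P t s"
  proof
    show "s \<notin> P" using s t by blast
    then show "t \<noteq> 0" using s b is_ideal_zero[OF P(1)] by auto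
    fix p assume "p \<in> P"
    then obtain y where y: "a * p = b * y" using aP by blast
    have "b * (s * p) = a * t * p" by (simp add: s)
    also have "\<dots> = b * (t * y)" using y by (metis mult.assoc mult.commute)
    finally show "\<exists>y. s * p = t * y" using b by auto
  qed (use P t fin in auto)
  then show ?thesis by (rule that)
qed


section \<open>Multisets of maximal ideals and the Chinese remainder theorem\<close>

text \<open>Peels off one point together with its whole multiplicity, because the ideals and weights
  attached to a multiset have one factor for each distinct point.\<close>

lemma multiset_replicate_induct [case_names empty replicate]:
  assumes "Pr {#}" and "\<And>Z p n. p \<notin># Z \<Longrightarrow> n > 0 \<Longrightarrow> Pr Z \<Longrightarrow> Pr (Z + replicate_mset n p)"
  shows "Pr (Y :: 'b multiset)"
proof (induction "card (set_mset Y)" arbitrary: Y)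
  case 0
  then show ?case using assms(1) by simp
next
  case (Suc k)
  then obtain p where p: "p \<in># Y" by (metis card.empty equals0I nat.simps(3))
  define Z where "Z = filter_mset (\<lambda>x. x \<noteq> p) Y"
  have eq: "Y = Z + replicate_mset (count Y p) p"
    by (rule multiset_eqI) (simp add: Z_def)
  have "set_mset Z = set_mset Y - {p}" by (auto simp: Z_def)
  then have "k = card (set_mset Z)" using Suc p by simp
  then have "Pr Z" by (rule Suc)
  moreover have "p \<notin># Z" by (simp add: Z_def)
  ultimately show ?case using assms(2)[of p Z "count Y p"] eq p by simp
qed

text \<open>The further argument rests on two facts about \<open>S\<close>: at every maximal ideal
  the localization is a discrete valuation ring with finite residue field, and only finitely many
  maximal ideals have index below a given bound.\<close>

locale zeta_domain =
  fixes dom :: "'a::idom itself"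
  assumes uniformizer_ex: "maximalideal (P :: 'a set) type_ring \<Longrightarrow> \<exists>t s. uniformizer P t s"
    and finite_small_primes:
      "finite {P :: 'a set. maximalideal P type_ring \<and> card (residues P) \<le> B}"
begin

definition primes :: "'a set set" where
  "primes = {P. maximalideal P type_ring}"

lemma uniformizerE:
  assumes "P \<in> primes" obtains t s where "uniformizer P t s"
  using assms uniformizer_ex unfolding primes_def by blast

lemma primesI:
  "is_ideal P \<Longrightarrow> 1 \<notin> P \<Longrightarrow> (\<And>r. r \<notin> P \<Longrightarrow> \<exists>v. v * r - 1 \<in> P) \<Longrightarrow> P \<in> primes"
  by (simp add: primes_def maximalideal_iff)

lemma prime_one: "P \<in> primes \<Longrightarrow> 1 \<notin> P"
  by (auto simp: primes_def maximalideal_iff)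

lemma prime_mult_notin: "P \<in> primes \<Longrightarrow> u \<notin> P \<Longrightarrow> v \<notin> P \<Longrightarrow> u * v \<notin> P"
  by (erule uniformizerE) (rule uniformizer.mult_notin)

lemma prime_power_notin: "P \<in> primes \<Longrightarrow> u \<notin> P \<Longrightarrow> u ^ n \<notin> P"
  by (erule uniformizerE) (rule uniformizer.power_notin)

lemma ideal_prime_power: "P \<in> primes \<Longrightarrow> is_ideal (prime_power P n)"
  by (erule uniformizerE) (rule uniformizer.is_ideal_prime_power)

lemma prime_power_one: "P \<in> primes \<Longrightarrow> prime_power P (Suc 0) = P"
  by (erule uniformizerE) (rule uniformizer.prime_power_1)

lemma prime_power_mono: "P \<in> primes \<Longrightarrow> m \<le> n \<Longrightarrow> prime_power P n \<subseteq> prime_power P m"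
  by (erule uniformizerE) (rule uniformizer.prime_power_antimono)

lemma residues_prime_gt_1: "P \<in> primes \<Longrightarrow> card (residues P) > 1"
  by (erule uniformizerE) (rule uniformizer.card_residues_gt_1)

lemma primes_incomparable:
  assumes P: "P \<in> primes" and Q: "Q \<in> primes" and ne: "P \<noteq> Q"
  obtains p where "p \<in> P" "p \<notin> Q"
proof -
  have "\<not> P \<subseteq> Q"
  proof
    assume "P \<subseteq> Q"
    then have "Q = P \<or> Q = UNIV"
      using maximalideal.I_maximal[of P type_ring Q] P Q
      by (auto simp: primes_def maximalideal_iff ideal_type_ring_iff)
    then show False using ne prime_one[OF Q] by auto
  qed
  then show ?thesis using that by blast
qed

lemma prime_power_not_subset:
  assumes P: "P \<in> primes" and Q: "Q \<in> primes" and ne: "P \<noteq> Q"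
  obtains r where "r \<in> prime_power P n" "r \<notin> Q"
proof -
  obtain t s where "uniformizer P t s" using uniformizerE[OF P] .
  moreover obtain p where "p \<in> P" "p \<notin> Q" using primes_incomparable[OF assms] .
  ultimately show ?thesis using that prime_power_notin[OF Q] uniformizer.power_in_prime_power by metis
qed

text \<open>In a Dedekind domain this is the product of the maximal ideals in \<open>Y\<close>. As
  an intersection of powers of distinct maximal ideals it is ready for the Chinese remainder
  theorem.\<close>

definition mset_ideal :: "'a set multiset \<Rightarrow> 'a set" where
  "mset_ideal Y = {r. \<forall>P\<in>#Y. r \<in> prime_power P (count Y P)}"

definition prime_norm :: "'a set multiset \<Rightarrow> nat" where
  "prime_norm Y = (\<Prod>P\<in>#Y. card (residues P))"

lemma is_ideal_mset_ideal: "set_mset Y \<subseteq> primes \<Longrightarrow> is_ideal (mset_ideal Y)"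
  using ideal_prime_power
  by (intro is_idealI) (auto simp: mset_ideal_def intro!: is_ideal_zero is_ideal_add is_ideal_mult)

text \<open>A product with one factor outside \<open>Q\<close> from each of the prime powers stays
  outside \<open>Q\<close>, as \<open>Q\<close> is prime.\<close>

lemma mset_ideal_not_subset:
  assumes "set_mset Y \<subseteq> primes" "Q \<in> primes" "Q \<notin># Y"
  obtains r where "r \<in> mset_ideal Y" "r \<notin> Q"
proof -
  have "\<exists>r. (\<forall>P\<in>A. r \<in> prime_power P (count Y P)) \<and> r \<notin> Q" if "finite A" "A \<subseteq> set_mset Y" for A
    using that
  proof induction
    case empty
    then show ?case using prime_one[OF assms(2)] by auto
  next
    case (insert P A)
    then obtain r where r: "\<forall>P\<in>A. r \<in> prime_power P (count Y P)" "r \<notin> Q" by auto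
    have P: "P \<in> primes" "P \<noteq> Q" using insert assms by auto
    obtain r' where r': "r' \<in> prime_power P (count Y P)" "r' \<notin> Q"
      using prime_power_not_subset[OF P(1) assms(2) P(2)] .
    have "r' * r \<in> prime_power P' (count Y P')" if "P' \<in> insert P A" for P'
    proof (cases "P' = P")
      case True
      then show ?thesis using r' P by (auto intro: is_ideal_mult_right ideal_prime_power)
    next
      case False
      moreover have "P' \<in> primes" using that insert assms by blast
      ultimately show ?thesis using r that by (auto intro: is_ideal_mult ideal_prime_power)
    qed
    then show ?case using prime_mult_notin[OF assms(2) r'(2) r(2)] by blast
  qed
  from this[of "set_mset Y"] show ?thesis using that by (auto simp: mset_ideal_def)
qed

lemma mset_ideal_replicate:
  assumes "P \<notin># Z" "n > 0"
  shows "mset_ideal (Z + replicate_mset n P) = mset_ideal Z \<inter> prime_power P n"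
proof -
  have "count (replicate_mset n P) Q = (if Q = P then n else 0)" for Q by simp
  moreover have "Q \<noteq> P" if "Q \<in># Z" for Q using that assms by auto
  moreover have "count Z P = 0" using assms by (simp add: not_in_iff)
  ultimately show ?thesis using assms by (auto simp: mset_ideal_def)
qed

text \<open>The Chinese remainder theorem in counting form: an element \<open>z\<close> of
  \<open>I = mset_ideal Z\<close> outside \<open>P\<close> is invertible modulo
  \<open>prime_power P n\<close>, so multiplication by \<open>z\<close> identifies
  \<open>S / P ^ n\<close> with \<open>I / (I \<inter> P ^ n)\<close>.\<close>

lemma residues_mset_ideal:
  assumes "set_mset Y \<subseteq> primes"
  shows "card (residues (mset_ideal Y)) = prime_norm Y \<and> finite (residues (mset_ideal Y))"
  using assms
proof (induction Y rule: multiset_replicate_induct)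
  case empty
  show ?case by (simp add: mset_ideal_def prime_norm_def residues_UNIV)
next
  case (replicate Z P n)
  then have P: "P \<in> primes" and Z: "set_mset Z \<subseteq> primes" by auto
  obtain t s where "uniformizer P t s" using uniformizerE[OF P] .
  then interpret uniformizer P t s .
  note IZ = is_ideal_mset_ideal[OF Z]
  obtain z where z: "z \<in> mset_ideal Z" "z \<notin> P"
    using mset_ideal_not_subset[OF Z P replicate(1)] .
  have "\<exists>y. x - z * y \<in> mset_ideal Z \<inter> prime_power P n" if "x \<in> mset_ideal Z" for x
  proof -
    obtain v where v: "v * z - 1 \<in> prime_power P n" using inv_mod_prime_power[OF z(2)] .
    have "x - z * (v * x) \<in> mset_ideal Z"
      by (rule is_ideal_diff[OF IZ that is_ideal_mult_right[OF IZ z(1)]])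
    moreover have "x - z * (v * x) = - (x * (v * z - 1))" by (simp add: algebra_simps)
    then have "x - z * (v * x) \<in> prime_power P n"
      using is_ideal_minus[OF is_ideal_prime_power is_ideal_mult[OF is_ideal_prime_power v]] by simp
    ultimately show ?thesis by blast
  qed
  moreover have "z * y \<in> mset_ideal Z \<inter> prime_power P n \<longleftrightarrow> y \<in> prime_power P n" for y
    using prime_power_cancel[OF z(2), of y n] is_ideal_mult[OF is_ideal_prime_power, of y n z]
      is_ideal_mult_right[OF IZ z(1), of y] by blast
  ultimately show ?case
    using card_residues_mult[OF IZ is_ideal_Int[OF IZ is_ideal_prime_power] is_ideal_prime_power
        _ is_ideal_mult_right[OF IZ z(1)]] replicate Z residues_prime_power
    by (simp add: mset_ideal_replicate prime_norm_def)
qed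

text \<open>The multiplicity of \<open>P\<close> is the valuation of \<open>mset_ideal Y\<close> at
  \<open>P\<close>, so the ideal determines the multiset.\<close>

lemma mset_ideal_subset_iff:
  assumes Y: "set_mset Y \<subseteq> primes" and P: "P \<in> primes"
  shows "mset_ideal Y \<subseteq> prime_power P n \<longleftrightarrow> n \<le> count Y P"
proof
  assume "n \<le> count Y P"
  then have "prime_power P (count Y P) \<subseteq> prime_power P n" by (rule prime_power_mono[OF P])
  moreover have "mset_ideal Y \<subseteq> prime_power P (count Y P)"
    by (cases "P \<in># Y") (auto simp: mset_ideal_def not_in_iff)
  ultimately show "mset_ideal Y \<subseteq> prime_power P n" by blast
next
  assume sub: "mset_ideal Y \<subseteq> prime_power P n"
  show "n \<le> count Y P"
  proof (rule ccontr)
    assume neg: "\<not> n \<le> count Y P"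
    obtain t s where "uniformizer P t s" using uniformizerE[OF P] .
    then interpret uniformizer P t s .
    define Z where "Z = filter_mset (\<lambda>x. x \<noteq> P) Y"
    have Z: "set_mset Z \<subseteq> primes" "P \<notin># Z" using Y by (auto simp: Z_def)
    obtain z where z: "z \<in> mset_ideal Z" "z \<notin> P" using mset_ideal_not_subset[OF Z(1) P Z(2)] .
    \<comment> \<open>This element has valuation exactly \<open>count Y P\<close> at
      \<open>P\<close>: \<open>z\<close> supplies the remaining prime powers and is a unit at
      \<open>P\<close>.\<close>
    have "z * t ^ count Y P \<in> mset_ideal Y"
      unfolding mset_ideal_def
    proof (intro CollectI ballI)
      fix Q assume Q: "Q \<in># Y"
      show "z * t ^ count Y P \<in> prime_power Q (count Y Q)"
      proof (cases "Q = P")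
        case False
        then have "z \<in> prime_power Q (count Y Q)"
          using z Q by (auto simp: mset_ideal_def Z_def)
        moreover have "Q \<in> primes" using Q Y by blast
        ultimately show ?thesis by (intro is_ideal_mult_right ideal_prime_power)
      qed (simp add: t_power_in)
    qed
    then have "z * t ^ count Y P \<in> prime_power P n" using sub by blast
    then have "z * t ^ count Y P \<in> prime_power P (count Y P + 1)"
      using prime_power_mono[OF P, of "count Y P + 1" n] neg by auto
    then have "t ^ count Y P * 1 \<in> prime_power P (count Y P + 1)" using prime_power_cancel[OF z(2)] by simp
    then have "1 \<in> prime_power P 1" unfolding t_mult_iff .
    then show False using prime_power_1 one_notin by simp
  qed
qed

lemma inj_on_mset_ideal: "inj_on mset_ideal {Y. set_mset Y \<subseteq> primes}"
proof (rule inj_onI, clarsimp)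
  fix Y Y' assume Y: "set_mset Y \<subseteq> primes" "set_mset Y' \<subseteq> primes" and eq: "mset_ideal Y = mset_ideal Y'"
  show "Y = Y'"
  proof (rule multiset_eqI)
    fix P show "count Y P = count Y' P"
    proof (cases "P \<in> primes")
      case True
      have "n \<le> count Y P \<longleftrightarrow> n \<le> count Y' P" for n
        using mset_ideal_subset_iff[OF _ True] Y eq by metis
      then show ?thesis by (metis antisym order_refl)
    next
      case False
      then show ?thesis using Y by (metis not_in_iff subsetD)
    qed
  qed
qed

end

section \<open>Modules over the ring of a type\<close>

text \<open>Scalars come from a type, so no carrier conditions on them arise. Negation is
  multiplication by \<open>-1\<close>: \<open>smult_zero\<close> with distributivity supplies the
  additive inverses.\<close>

locale type_module =
  fixes M :: "('a::idom, 'b, 'm) module_scheme" (structure)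
  assumes add_closed [simp, intro]: "x \<in> carrier M \<Longrightarrow> y \<in> carrier M \<Longrightarrow> x \<oplus> y \<in> carrier M"
    and zero_closed [simp, intro]: "\<zero> \<in> carrier M"
    and add_assoc: "x \<in> carrier M \<Longrightarrow> y \<in> carrier M \<Longrightarrow> z \<in> carrier M \<Longrightarrow> (x \<oplus> y) \<oplus> z = x \<oplus> (y \<oplus> z)"
    and add_comm: "x \<in> carrier M \<Longrightarrow> y \<in> carrier M \<Longrightarrow> x \<oplus> y = y \<oplus> x"
    and l_zero [simp]: "x \<in> carrier M \<Longrightarrow> \<zero> \<oplus> x = x"
    and smult_closed [simp, intro]: "x \<in> carrier M \<Longrightarrow> r \<odot> x \<in> carrier M"
    and smult_l_distr: "x \<in> carrier M \<Longrightarrow> (a + b) \<odot> x = a \<odot> x \<oplus> b \<odot> x"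
    and smult_r_distr: "x \<in> carrier M \<Longrightarrow> y \<in> carrier M \<Longrightarrow> a \<odot> (x \<oplus> y) = a \<odot> x \<oplus> a \<odot> y"
    and smult_assoc: "x \<in> carrier M \<Longrightarrow> (a * b) \<odot> x = a \<odot> (b \<odot> x)"
    and smult_one [simp]: "x \<in> carrier M \<Longrightarrow> 1 \<odot> x = x"
    and smult_zero [simp]: "x \<in> carrier M \<Longrightarrow> 0 \<odot> x = \<zero>"
begin

lemma r_zero [simp]: "x \<in> carrier M \<Longrightarrow> x \<oplus> \<zero> = x"
  using add_comm[of x \<zero>] by simp

lemma smult_r_zero [simp]: "a \<odot> \<zero> = \<zero>"
  using smult_assoc[of \<zero> a 0] by simp

lemma add_left_comm:
  "x \<in> carrier M \<Longrightarrow> y \<in> carrier M \<Longrightarrow> z \<in> carrier M \<Longrightarrow> x \<oplus> (y \<oplus> z) = y \<oplus> (x \<oplus> z)"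
  using add_assoc[of x y z] add_assoc[of y x z] add_comm[of x y] by simp

lemmas madd_ac = add_assoc add_comm add_left_comm

lemma r_neg: "x \<in> carrier M \<Longrightarrow> x \<oplus> (-1) \<odot> x = \<zero>"
  using smult_l_distr[of x 1 "-1"] by simp

lemma l_neg: "x \<in> carrier M \<Longrightarrow> (-1) \<odot> x \<oplus> x = \<zero>"
  using smult_l_distr[of x "-1" 1] by simp

lemma add_left_cancel [simp]:
  assumes "x \<in> carrier M" "y \<in> carrier M" "z \<in> carrier M"
  shows "x \<oplus> y = x \<oplus> z \<longleftrightarrow> y = z"
proof
  assume "x \<oplus> y = x \<oplus> z"
  then have "(-1) \<odot> x \<oplus> (x \<oplus> y) = (-1) \<odot> x \<oplus> (x \<oplus> z)" by simp
  then show "y = z" using assms by (simp add: add_assoc[symmetric] l_neg)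
qed simp

lemma smult_comm: "x \<in> carrier M \<Longrightarrow> a \<odot> (b \<odot> x) = b \<odot> (a \<odot> x)"
  by (simp add: smult_assoc[symmetric] mult.commute)

lemma smult_diff: "x \<in> carrier M \<Longrightarrow> (a - b) \<odot> x \<oplus> b \<odot> x = a \<odot> x"
  by (simp add: smult_l_distr[symmetric])

lemma smult_eq_iff:
  assumes "x \<in> carrier M" shows "a \<odot> x = b \<odot> x \<longleftrightarrow> (a - b) \<odot> x = \<zero>"
  using smult_diff[OF assms, of a b] add_left_cancel[of "b \<odot> x" "(a - b) \<odot> x" \<zero>] assms
  by (simp add: add_comm)

end

lemma module_iff_type_module: "module (type_ring :: 'a::idom ring) M \<longleftrightarrow> type_module M"
proof
  assume "module (type_ring :: 'a ring) M"
  then interpret module "type_ring :: 'a ring" M .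
  show "type_module M"
  proof
    show "0 \<odot>\<^bsub>M\<^esub> x = \<zero>\<^bsub>M\<^esub>" if "x \<in> carrier M" for x using smult_l_null[OF that] by simp
    show "1 \<odot>\<^bsub>M\<^esub> x = x" if "x \<in> carrier M" for x using smult_one[OF that] by simp
    show "(a + b) \<odot>\<^bsub>M\<^esub> x = a \<odot>\<^bsub>M\<^esub> x \<oplus>\<^bsub>M\<^esub> b \<odot>\<^bsub>M\<^esub> x" if "x \<in> carrier M" for x a b
      using smult_l_distr[OF _ _ that, of a b] by simp
    show "(a * b) \<odot>\<^bsub>M\<^esub> x = a \<odot>\<^bsub>M\<^esub> (b \<odot>\<^bsub>M\<^esub> x)" if "x \<in> carrier M" for x a b
      using smult_assoc1[OF _ _ that, of a b] by simp
  qed (auto simp: smult_r_distr intro: M.a_assoc M.a_comm)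
next
  assume "type_module M"
  then interpret type_module M .
  show "module (type_ring :: 'a ring) M"
  proof (rule moduleI)
    show "cring (type_ring :: 'a ring)" by (rule cring_type_ring)
    show "abelian_group M"
    proof (rule abelian_groupI)
      show "\<exists>y\<in>carrier M. y \<oplus>\<^bsub>M\<^esub> x = \<zero>\<^bsub>M\<^esub>" if "x \<in> carrier M" for x
        using l_neg[OF that] that by blast
    qed (auto simp: madd_ac)
  qed (auto simp: smult_l_distr smult_r_distr smult_assoc)
qed

section \<open>Homomorphisms, isomorphisms and transport along them\<close>

definition homs :: "('a::idom, 'b, 'm) module_scheme \<Rightarrow> ('a, 'c, 'n) module_scheme \<Rightarrow> ('b \<Rightarrow> 'c) set" where
  "homs M N = {f \<in> extensional (carrier M). (\<forall>x\<in>carrier M. f x \<in> carrier N) \<and>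
     (\<forall>x\<in>carrier M. \<forall>y\<in>carrier M. f (x \<oplus>\<^bsub>M\<^esub> y) = f x \<oplus>\<^bsub>N\<^esub> f y) \<and>
     (\<forall>r. \<forall>x\<in>carrier M. f (r \<odot>\<^bsub>M\<^esub> x) = r \<odot>\<^bsub>N\<^esub> f x)}"

definition isos :: "('a::idom, 'b, 'm) module_scheme \<Rightarrow> ('a, 'c, 'n) module_scheme \<Rightarrow> ('b \<Rightarrow> 'c) set" where
  "isos M N = {f \<in> homs M N. bij_betw f (carrier M) (carrier N)}"

lemma module_isos_type_ring: "module_isos (type_ring :: 'a::idom ring) M N = isos M N"
  by (auto simp: module_isos_def isos_def homs_def iso_def hom_def)

lemma homsI:
  assumes "f \<in> extensional (carrier M)" "\<And>x. x \<in> carrier M \<Longrightarrow> f x \<in> carrier N"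
    "\<And>x y. x \<in> carrier M \<Longrightarrow> y \<in> carrier M \<Longrightarrow> f (x \<oplus>\<^bsub>M\<^esub> y) = f x \<oplus>\<^bsub>N\<^esub> f y"
    "\<And>r x. x \<in> carrier M \<Longrightarrow> f (r \<odot>\<^bsub>M\<^esub> x) = r \<odot>\<^bsub>N\<^esub> f x"
  shows "f \<in> homs M N"
  using assms by (simp add: homs_def)

lemma
  assumes "f \<in> homs M N"
  shows homs_ext: "f \<in> extensional (carrier M)"
    and homs_closed: "x \<in> carrier M \<Longrightarrow> f x \<in> carrier N"
    and homs_add: "x \<in> carrier M \<Longrightarrow> y \<in> carrier M \<Longrightarrow> f (x \<oplus>\<^bsub>M\<^esub> y) = f x \<oplus>\<^bsub>N\<^esub> f y"
    and homs_smult: "x \<in> carrier M \<Longrightarrow> f (r \<odot>\<^bsub>M\<^esub> x) = r \<odot>\<^bsub>N\<^esub> f x"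
  using assms by (simp_all add: homs_def)

lemma homs_zero:
  assumes "type_module M" "type_module N" "f \<in> homs M N" shows "f \<zero>\<^bsub>M\<^esub> = \<zero>\<^bsub>N\<^esub>"
proof -
  interpret M: type_module M by fact
  interpret N: type_module N by fact
  have "f \<zero>\<^bsub>M\<^esub> = f (0 \<odot>\<^bsub>M\<^esub> \<zero>\<^bsub>M\<^esub>)" by simp
  also have "\<dots> = \<zero>\<^bsub>N\<^esub>" using assms homs_closed[OF assms(3) M.zero_closed] by (simp only: homs_smult M.zero_closed N.smult_zero)
  finally show ?thesis .
qed

lemma homs_compose:
  assumes "type_module L" "f \<in> homs L M" "g \<in> homs M N" shows "compose (carrier L) g f \<in> homs L N"
proof -
  interpret type_module L by fact
  show ?thesis using assms(2,3)
    by (intro homsI) (auto simp: compose_def homs_closed homs_add homs_smult)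
qed

lemma isos_homs: "f \<in> isos M N \<Longrightarrow> f \<in> homs M N"
  and isos_bij: "f \<in> isos M N \<Longrightarrow> bij_betw f (carrier M) (carrier N)"
  by (simp_all add: isos_def)

lemma isos_compose:
  assumes "type_module L" "f \<in> isos L M" "g \<in> isos M N" shows "compose (carrier L) g f \<in> isos L N"
  using assms homs_compose[of L f M g N]
    bij_betw_compose[of f "carrier L" "carrier M" g "carrier N"]
  by (simp add: isos_def)

lemma isos_inv:
  fixes M (structure)
  assumes "type_module M" "f \<in> isos M N"
  shows "restrict (inv_into (carrier M) f) (carrier N) \<in> isos N M"
proof -
  interpret type_module M by fact
  let ?g = "inv_into (carrier M) f"
  note hom = isos_homs[OF assms(2)] and bij = isos_bij[OF assms(2)]
  have img: "f ` carrier M = carrier N" using bij by (simp add: bij_betw_def)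
  have g: "?g y \<in> carrier M" "f (?g y) = y" if "y \<in> carrier N" for y
    using that img by (auto intro: inv_into_into f_inv_into_f)
  have gI: "?g y = x" if "x \<in> carrier M" "f x = y" for x y
    using that bij by (auto simp: bij_betw_def)
  have cl: "y \<oplus>\<^bsub>N\<^esub> z \<in> carrier N" "r \<odot>\<^bsub>N\<^esub> y \<in> carrier N" if "y \<in> carrier N" "z \<in> carrier N" for y z r
    using that g[of y] g[of z] homs_closed[OF hom, of "?g y \<oplus> ?g z"] homs_closed[OF hom, of "r \<odot> ?g y"]
    by (simp_all add: homs_add[OF hom] homs_smult[OF hom])
  show ?thesis unfolding isos_def
  proof (intro CollectI conjI homsI)
    fix y z assume yz: "y \<in> carrier N" "z \<in> carrier N"
    have "?g (y \<oplus>\<^bsub>N\<^esub> z) = ?g y \<oplus> ?g z"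
      using yz g[of y] g[of z] by (intro gI) (auto simp: homs_add[OF hom])
    then show "restrict ?g (carrier N) (y \<oplus>\<^bsub>N\<^esub> z) = restrict ?g (carrier N) y \<oplus> restrict ?g (carrier N) z"
      using yz cl by simp
  next
    fix r y assume y: "y \<in> carrier N"
    have "?g (r \<odot>\<^bsub>N\<^esub> y) = r \<odot> ?g y"
      using y g[of y] by (intro gI) (auto simp: homs_smult[OF hom])
    then show "restrict ?g (carrier N) (r \<odot>\<^bsub>N\<^esub> y) = r \<odot> restrict ?g (carrier N) y"
      using y cl by simp
  next
    show "bij_betw (restrict ?g (carrier N)) (carrier N) (carrier M)"
      using bij_betw_inv_into[OF bij] by (simp cong: bij_betw_cong)
  qed (use g in auto)
qed

definition isomorphic :: "('a::idom, 'b, 'm) module_scheme \<Rightarrow> ('a, 'c, 'n) module_scheme \<Rightarrow> bool" where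
  "isomorphic M N \<longleftrightarrow> isos M N \<noteq> {}"

lemma isos_id: "restrict id (carrier M) \<in> isos M M" if "type_module M"
proof -
  interpret type_module M by fact
  show ?thesis by (auto simp: isos_def intro!: homsI)
qed

lemma isomorphic_refl: "type_module M \<Longrightarrow> isomorphic M M"
  using isos_id by (auto simp: isomorphic_def)

lemma isomorphic_sym: "type_module M \<Longrightarrow> isomorphic M N \<Longrightarrow> isomorphic N M"
  using isos_inv unfolding isomorphic_def by blast

lemma isomorphic_trans: "type_module L \<Longrightarrow> isomorphic L M \<Longrightarrow> isomorphic M N \<Longrightarrow> isomorphic L N"
  using isos_compose unfolding isomorphic_def by blast

lemma isomorphic_card: "isomorphic M N \<Longrightarrow> card (carrier M) = card (carrier N)"
  unfolding isomorphic_def using isos_bij bij_betw_same_card by blast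

lemma isomorphic_finite: "isomorphic M N \<Longrightarrow> finite (carrier M) = finite (carrier N)"
  unfolding isomorphic_def using isos_bij bij_betw_finite by blast

lemma finite_homs:
  assumes "finite (carrier M)" "finite (carrier N)" shows "finite (homs M N)"
  by (rule finite_subset[OF _ finite_PiE[of "carrier M" "\<lambda>_. carrier N"]])
    (use assms in \<open>auto simp: homs_def PiE_def\<close>)

lemma finite_isos: "finite (carrier M) \<Longrightarrow> finite (carrier N) \<Longrightarrow> finite (isos M N)"
  using finite_homs[of M N] by (simp add: isos_def)

lemma card_homs_precompose:
  assumes L: "type_module L" and M: "type_module M" and f: "f \<in> isos L M"
  shows "bij_betw (\<lambda>g. compose (carrier L) g f) (homs M N) (homs L N)"
    and "bij_betw (\<lambda>g. compose (carrier L) g f) (isos M N) (isos L N)"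
proof -
  let ?h = "restrict (inv_into (carrier L) f) (carrier M)"
  have h: "?h \<in> isos M L" by (rule isos_inv[OF L f])
  have fimg: "f ` carrier L = carrier M" "inj_on f (carrier L)" using isos_bij[OF f] by (auto simp: bij_betw_def)
  have fx: "f x \<in> carrier M" "inv_into (carrier L) f (f x) = x" if "x \<in> carrier L" for x
    using that fimg by auto
  have hx: "f (inv_into (carrier L) f y) = y" "inv_into (carrier L) f y \<in> carrier L" if "y \<in> carrier M" for y
    using that fimg by (auto intro: f_inv_into_f inv_into_into)
  have 1: "compose (carrier M) (compose (carrier L) g f) ?h = g" if "g \<in> homs M N" for g
    by (rule extensionalityI[of _ "carrier M"])
      (use that hx in \<open>auto simp: compose_def dest: homs_ext\<close>)
  have 2: "compose (carrier L) (compose (carrier M) g ?h) f = g" if "g \<in> homs L N" for g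
    by (rule extensionalityI[of _ "carrier L"])
      (use that fx in \<open>auto simp: compose_def dest: homs_ext\<close>)
  show "bij_betw (\<lambda>g. compose (carrier L) g f) (homs M N) (homs L N)"
    by (rule bij_betw_byWitness[where f' = "\<lambda>g. compose (carrier M) g ?h"])
      (use 1 2 homs_compose[OF L isos_homs[OF f]] homs_compose[OF M isos_homs[OF h]] in auto)
  show "bij_betw (\<lambda>g. compose (carrier L) g f) (isos M N) (isos L N)"
    by (rule bij_betw_byWitness[where f' = "\<lambda>g. compose (carrier M) g ?h"])
      (use 1[OF isos_homs] 2[OF isos_homs] isos_compose[OF L f] isos_compose[OF M h] in auto)
qed

lemma card_homs_postcompose:
  assumes L: "type_module L" and M: "type_module M" and f: "f \<in> isos M N"
  shows "bij_betw (\<lambda>g. compose (carrier L) f g) (homs L M) (homs L N)"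
    and "bij_betw (\<lambda>g. compose (carrier L) f g) (isos L M) (isos L N)"
proof -
  let ?h = "restrict (inv_into (carrier M) f) (carrier N)"
  have h: "?h \<in> isos N M" by (rule isos_inv[OF M f])
  have fimg: "f ` carrier M = carrier N" "inj_on f (carrier M)" using isos_bij[OF f] by (auto simp: bij_betw_def)
  have fx: "f x \<in> carrier N" "inv_into (carrier M) f (f x) = x" if "x \<in> carrier M" for x
    using that fimg by auto
  have hx: "f (inv_into (carrier M) f y) = y" "inv_into (carrier M) f y \<in> carrier M" if "y \<in> carrier N" for y
    using that fimg by (auto intro: f_inv_into_f inv_into_into)
  have 1: "compose (carrier L) ?h (compose (carrier L) f g) = g" if "g \<in> homs L M" for g
    by (rule extensionalityI[of _ "carrier L"])
      (use that fx homs_closed[OF that] in \<open>auto simp: compose_def dest: homs_ext\<close>)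
  have 2: "compose (carrier L) f (compose (carrier L) ?h g) = g" if "g \<in> homs L N" for g
    by (rule extensionalityI[of _ "carrier L"])
      (use that hx homs_closed[OF that] in \<open>auto simp: compose_def dest: homs_ext\<close>)
  show "bij_betw (\<lambda>g. compose (carrier L) f g) (homs L M) (homs L N)"
    by (rule bij_betw_byWitness[where f' = "\<lambda>g. compose (carrier L) ?h g"])
      (use 1 2 homs_compose[OF L _ isos_homs[OF f]] homs_compose[OF L _ isos_homs[OF h]] in auto)
  show "bij_betw (\<lambda>g. compose (carrier L) f g) (isos L M) (isos L N)"
    by (rule bij_betw_byWitness[where f' = "\<lambda>g. compose (carrier L) ?h g"])
      (use 1[OF isos_homs] 2[OF isos_homs] isos_compose[OF L _ f] isos_compose[OF L _ h] in auto)
qed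

lemma card_homs_isomorphic:
  assumes "type_module L" "type_module L'" "type_module M" "isomorphic L L'" "isomorphic M M'"
  shows "card (homs L M) = card (homs L' M')" "card (isos L M) = card (isos L' M')"
proof -
  obtain f g where f: "f \<in> isos L L'" and g: "g \<in> isos M M'"
    using assms by (auto simp: isomorphic_def)
  show "card (homs L M) = card (homs L' M')"
    using bij_betw_same_card[OF card_homs_precompose(1)[OF assms(1,2) f, of M']]
      bij_betw_same_card[OF card_homs_postcompose(1)[OF assms(1,3) g]] by simp
  show "card (isos L M) = card (isos L' M')"
    using bij_betw_same_card[OF card_homs_precompose(2)[OF assms(1,2) f, of M']]
      bij_betw_same_card[OF card_homs_postcompose(2)[OF assms(1,3) g]] by simp
qed

section \<open>Direct sums, cyclic modules, submodules and torsion\<close>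

definition prod_mod :: "('a::idom, 'b, 'm) module_scheme \<Rightarrow> ('a, 'c, 'n) module_scheme \<Rightarrow> ('a, 'b \<times> 'c) module" where
  "prod_mod M N = \<lparr>carrier = carrier M \<times> carrier N, monoid.mult = undefined, one = undefined,
     ring.zero = (\<zero>\<^bsub>M\<^esub>, \<zero>\<^bsub>N\<^esub>), add = (\<lambda>(x, y) (x', y'). (x \<oplus>\<^bsub>M\<^esub> x', y \<oplus>\<^bsub>N\<^esub> y')),
     module.smult = (\<lambda>r (x, y). (r \<odot>\<^bsub>M\<^esub> x, r \<odot>\<^bsub>N\<^esub> y))\<rparr>"

definition cyclic_mod :: "'a::idom set \<Rightarrow> ('a, 'a) module" where
  "cyclic_mod I = \<lparr>carrier = residues I, monoid.mult = undefined, one = undefined,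
     ring.zero = residue_rep I 0, add = (\<lambda>x y. residue_rep I (x + y)),
     module.smult = (\<lambda>r x. residue_rep I (r * x))\<rparr>"

lemma prod_mod_simps [simp]:
  "carrier (prod_mod M N) = carrier M \<times> carrier N" "\<zero>\<^bsub>prod_mod M N\<^esub> = (\<zero>\<^bsub>M\<^esub>, \<zero>\<^bsub>N\<^esub>)"
  "(x, y) \<oplus>\<^bsub>prod_mod M N\<^esub> (x', y') = (x \<oplus>\<^bsub>M\<^esub> x', y \<oplus>\<^bsub>N\<^esub> y')"
  "r \<odot>\<^bsub>prod_mod M N\<^esub> (x, y) = (r \<odot>\<^bsub>M\<^esub> x, r \<odot>\<^bsub>N\<^esub> y)"
  by (simp_all add: prod_mod_def)

lemma cyclic_mod_simps [simp]:
  "carrier (cyclic_mod I) = residues I" "\<zero>\<^bsub>cyclic_mod I\<^esub> = residue_rep I 0"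
  "x \<oplus>\<^bsub>cyclic_mod I\<^esub> y = residue_rep I (x + y)" "r \<odot>\<^bsub>cyclic_mod I\<^esub> x = residue_rep I (r * x)"
  by (simp_all add: cyclic_mod_def)

lemma type_module_prod_mod:
  assumes "type_module M" "type_module N" shows "type_module (prod_mod M N)"
proof -
  interpret M: type_module M by fact
  interpret N: type_module N by fact
  show ?thesis
    by unfold_locales (auto simp: M.add_assoc N.add_assoc M.smult_l_distr N.smult_l_distr
      M.smult_r_distr N.smult_r_distr M.smult_assoc N.smult_assoc intro: M.add_comm N.add_comm)
qed

lemma type_module_cyclic_mod:
  assumes I: "is_ideal I" shows "type_module (cyclic_mod I)"
proof -
  note d = residue_rep_diff[OF I] and eq = residue_rep_eq_iff[OF I]
  have add1: "residue_rep I (residue_rep I x + y) = residue_rep I (x + y)" for x y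
    using d[of x] by (simp add: eq)
  have add2: "residue_rep I (x + residue_rep I y) = residue_rep I (x + y)" for x y
    using d[of y] by (simp add: eq)
  have mul: "residue_rep I (r * residue_rep I x) = residue_rep I (r * x)" for r x
    using is_ideal_mult[OF I d[of x], of r] by (simp add: eq right_diff_distrib)
  show ?thesis
    by unfold_locales (auto simp: add1 add2 mul I algebra_simps)
qed

lemma isomorphic_prod_mod:
  assumes "type_module M" "type_module N" "isomorphic M M'" "isomorphic N N'"
  shows "isomorphic (prod_mod M N) (prod_mod M' N')"
proof -
  interpret M: type_module M by fact
  interpret N: type_module N by fact
  obtain f g where f: "f \<in> isos M M'" and g: "g \<in> isos N N'" using assms by (auto simp: isomorphic_def)
  have "restrict (map_prod f g) (carrier M \<times> carrier N) \<in> isos (prod_mod M N) (prod_mod M' N')"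
    unfolding isos_def
  proof (intro CollectI conjI homsI)
    have "bij_betw (map_prod f g) (carrier M \<times> carrier N) (carrier M' \<times> carrier N')"
      using isos_bij[OF f] isos_bij[OF g] by (rule bij_betw_map_prod)
    then show "bij_betw (restrict (map_prod f g) (carrier M \<times> carrier N))
        (carrier (prod_mod M N)) (carrier (prod_mod M' N'))" by (simp add: bij_betw_def)
  qed (use isos_homs[OF f] isos_homs[OF g] in \<open>auto simp: homs_closed homs_add homs_smult\<close>)
  then show ?thesis by (auto simp: isomorphic_def)
qed

text \<open>The zeta function of finite modules ranges over modules whose elements are natural
  numbers; every finite module is moved there along an injection of its carrier.\<close>

lemma transport_nat:
  fixes M :: "('a::idom, 'b, 'm) module_scheme" (structure)
  assumes M: "type_module M" and fin: "finite (carrier M)"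
  obtains N :: "('a, nat) module" where "type_module N" "isomorphic M N"
proof -
  interpret type_module M by fact
  obtain f :: "'b \<Rightarrow> nat" where inj: "inj_on f (carrier M)"
    using finite_imp_inj_to_nat_seg[OF fin] by blast
  define g where "g = inv_into (carrier M) f"
  have g: "g (f x) = x" if "x \<in> carrier M" for x using inj that by (simp add: g_def)
  define N :: "('a, nat) module" where
    "N = \<lparr>carrier = f ` carrier M, monoid.mult = undefined, one = undefined,
     ring.zero = f \<zero>, add = (\<lambda>x y. f (g x \<oplus> g y)), module.smult = (\<lambda>r x. f (r \<odot> g x))\<rparr>"
  have "type_module N"
    by unfold_locales (auto simp: N_def g smult_l_distr smult_r_distr smult_assoc madd_ac)
  moreover have "restrict f (carrier M) \<in> isos M N"
    using inj by (auto simp: isos_def N_def g bij_betw_def inj_on_def intro!: homsI)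
  ultimately show ?thesis using that by (auto simp: isomorphic_def)
qed

definition submod :: "'b set \<Rightarrow> ('a::idom, 'b, 'm) module_scheme \<Rightarrow> bool" where
  "submod N M \<longleftrightarrow> N \<subseteq> carrier M \<and> \<zero>\<^bsub>M\<^esub> \<in> N \<and> (\<forall>x\<in>N. \<forall>y\<in>N. x \<oplus>\<^bsub>M\<^esub> y \<in> N) \<and> (\<forall>r. \<forall>x\<in>N. r \<odot>\<^bsub>M\<^esub> x \<in> N)"

context type_module
begin

lemma submodD:
  assumes "submod N M"
  shows "x \<in> N \<Longrightarrow> x \<in> carrier M" "\<zero> \<in> N" "x \<in> N \<Longrightarrow> y \<in> N \<Longrightarrow> x \<oplus> y \<in> N" "x \<in> N \<Longrightarrow> r \<odot> x \<in> N"
  using assms by (auto simp: submod_def)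

lemma submod_add_iff:
  assumes N: "submod N M" and y: "y \<in> N" and x: "x \<in> carrier M" shows "x \<oplus> y \<in> N \<longleftrightarrow> x \<in> N"
proof
  assume "x \<oplus> y \<in> N"
  then have "(x \<oplus> y) \<oplus> (-1) \<odot> y \<in> N" using submodD[OF N] y by blast
  then show "x \<in> N" using submodD(1)[OF N y] x by (simp add: add_assoc r_neg)
qed (use submodD[OF N] y in blast)

lemma submod_add_iff':
  assumes N: "submod N M" and y: "y \<in> N" and x: "x \<in> carrier M" shows "y \<oplus> x \<in> N \<longleftrightarrow> x \<in> N"
  using submod_add_iff[OF assms] add_comm[of x y] submodD(1)[OF N y] x by simp

lemma type_module_submod:
  assumes "submod N M" shows "type_module (M\<lparr>carrier := N\<rparr>)"
  using submodD[OF assms]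
  by unfold_locales (auto simp: smult_l_distr smult_r_distr smult_assoc madd_ac)

lemma submod_trivial: "submod {\<zero>} M"
  by (auto simp: submod_def)

definition adjoin :: "'b \<Rightarrow> 'b set \<Rightarrow> 'b set" where
  "adjoin x N = {r \<odot> x \<oplus> n | r n. n \<in> N}"

lemma submod_adjoin:
  assumes N: "submod N M" and x: "x \<in> carrier M" shows "submod (adjoin x N) M"
  unfolding submod_def
proof (intro conjI ballI allI)
  note N' = submodD[OF N]
  show "adjoin x N \<subseteq> carrier M" using x N' by (auto simp: adjoin_def)
  show "\<zero> \<in> adjoin x N" unfolding adjoin_def using x N'(2) by (auto intro!: exI[of _ 0] exI[of _ \<zero>])
next
  note N' = submodD[OF N]
  fix y z assume "y \<in> adjoin x N" "z \<in> adjoin x N"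
  then obtain r n r' n' where "n \<in> N" "n' \<in> N" "y = r \<odot> x \<oplus> n" "z = r' \<odot> x \<oplus> n'" by (auto simp: adjoin_def)
  then have "y \<oplus> z = (r + r') \<odot> x \<oplus> (n \<oplus> n')" "n \<oplus> n' \<in> N"
    using x N' by (auto simp: smult_l_distr madd_ac)
  then show "y \<oplus> z \<in> adjoin x N" by (auto simp: adjoin_def)
next
  note N' = submodD[OF N]
  fix c y assume "y \<in> adjoin x N"
  then obtain r n where "n \<in> N" "y = r \<odot> x \<oplus> n" by (auto simp: adjoin_def)
  then have "c \<odot> y = (c * r) \<odot> x \<oplus> c \<odot> n" "c \<odot> n \<in> N"
    using x N' by (auto simp: smult_r_distr smult_assoc)
  then show "c \<odot> y \<in> adjoin x N" by (auto simp: adjoin_def)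
qed

lemma in_adjoin:
  assumes "submod N M" "x \<in> carrier M"
  shows "x \<in> adjoin x N" "n \<in> N \<Longrightarrow> n \<in> adjoin x N"
proof -
  note N' = submodD[OF assms(1)]
  have "x = 1 \<odot> x \<oplus> \<zero>" using assms by simp
  then show "x \<in> adjoin x N" unfolding adjoin_def using N'(2) by blast
  assume n: "n \<in> N"
  then have "n = 0 \<odot> x \<oplus> n" using assms N' by simp
  then show "n \<in> adjoin x N" unfolding adjoin_def using n by blast
qed

lemma adjoin_least: "submod K M \<Longrightarrow> x \<in> K \<Longrightarrow> N \<subseteq> K \<Longrightarrow> adjoin x N \<subseteq> K"
  unfolding adjoin_def using submodD by blast

text \<open>The hypotheses make \<open>M\<close> the internal direct sum of \<open>N\<close> and the
  cyclic submodule generated by \<open>x\<close>, which is \<open>S / I\<close> because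
  \<open>I\<close> is the annihilator of \<open>x\<close>.\<close>

lemma decomposition_iso:
  assumes I: "is_ideal I" and N: "submod N M" and x: "x \<in> carrier M"
    and ann: "\<And>r. r \<odot> x = \<zero> \<longleftrightarrow> r \<in> I" and int: "\<And>r. r \<odot> x \<in> N \<Longrightarrow> r \<odot> x = \<zero>"
    and span: "adjoin x N = carrier M"
  shows "(\<lambda>(r, n)\<in>residues I \<times> N. r \<odot> x \<oplus> n) \<in> isos (prod_mod (cyclic_mod I) (M\<lparr>carrier := N\<rparr>)) M"
proof -
  note N' = submodD[OF N]
  have rep: "residue_rep I r \<odot> x = r \<odot> x" for r
    using residue_rep_diff[OF I, of r] by (simp add: smult_eq_iff x ann)
  have eq: "r \<odot> x = r' \<odot> x \<longleftrightarrow> residue_rep I r = residue_rep I r'" for r r'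
    by (simp add: smult_eq_iff x ann residue_rep_eq_iff[OF I])
  show ?thesis unfolding isos_def
  proof (intro CollectI conjI homsI)
    let ?f = "\<lambda>(r, n). r \<odot> x \<oplus> n"
    have "inj_on ?f (residues I \<times> N)"
    proof (rule inj_onI, clarsimp)
      fix r n r' n' assume h: "r \<in> residues I" "n \<in> N" "r' \<in> residues I" "n' \<in> N"
        "r \<odot> x \<oplus> n = r' \<odot> x \<oplus> n'"
      have "(r - r') \<odot> x \<oplus> n = n'"
      proof -
        have "r' \<odot> x \<oplus> ((r - r') \<odot> x \<oplus> n) = ((r - r') \<odot> x \<oplus> r' \<odot> x) \<oplus> n"
          using x h N' by (simp add: madd_ac)
        then have "r' \<odot> x \<oplus> ((r - r') \<odot> x \<oplus> n) = r' \<odot> x \<oplus> n'" using h x by (simp add: smult_diff)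
        then show ?thesis using x h N' by simp
      qed
      then have "(r - r') \<odot> x \<in> N" using submod_add_iff[OF N, of n "(r - r') \<odot> x"] h x by simp
      from int[OF this] have "r \<odot> x = r' \<odot> x" by (simp add: smult_eq_iff x)
      moreover from this have "n = n'" using h x N' by simp
      ultimately show "r = r' \<and> n = n'" using h I by (simp add: eq)
    qed
    moreover have "?f ` (residues I \<times> N) = carrier M"
    proof
      show "?f ` (residues I \<times> N) \<subseteq> carrier M" using x N' by auto
      show "carrier M \<subseteq> ?f ` (residues I \<times> N)"
      proof
        fix y assume "y \<in> carrier M"
        then have "y \<in> adjoin x N" using span by simp
        then obtain r n where "n \<in> N" "y = r \<odot> x \<oplus> n" by (auto simp: adjoin_def)
        then have "y = ?f (residue_rep I r, n)" by (simp add: rep)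
        then show "y \<in> ?f ` (residues I \<times> N)" using \<open>n \<in> N\<close> by (intro image_eqI[of _ _ "(residue_rep I r, n)"]) auto
      qed
    qed
    ultimately have "bij_betw ?f (residues I \<times> N) (carrier M)" by (simp add: bij_betw_def)
    then show "bij_betw (\<lambda>(r, n)\<in>residues I \<times> N. r \<odot> x \<oplus> n)
        (carrier (prod_mod (cyclic_mod I) (M\<lparr>carrier := N\<rparr>))) (carrier M)"
      by (simp add: bij_betw_def)
  qed (use x N' in \<open>auto simp: rep smult_l_distr smult_r_distr smult_assoc madd_ac\<close>)
qed

end


text \<open>The submodule \<open>M[P ^ i]\<close>, whose elements correspond to the homomorphisms
  from \<open>S / P ^ i\<close> to \<open>M\<close>. The sizes of these submodules serve as the
  isomorphism invariants of \<open>M\<close>.\<close>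

definition torsion :: "('a::idom, 'b, 'm) module_scheme \<Rightarrow> 'a set \<Rightarrow> nat \<Rightarrow> 'b set" where
  "torsion M P i = {x \<in> carrier M. \<forall>r\<in>prime_power P i. r \<odot>\<^bsub>M\<^esub> x = \<zero>\<^bsub>M\<^esub>}"

lemma torsion_isomorphic:
  assumes "type_module M" "type_module N" "isomorphic M N"
  shows "card (torsion M P i) = card (torsion N P i)"
proof -
  interpret M: type_module M by fact
  interpret N: type_module N by fact
  obtain f where f: "f \<in> isos M N" using assms by (auto simp: isomorphic_def)
  note hom = isos_homs[OF f] and bij = isos_bij[OF f]
  have inj: "inj_on f (carrier M)" and img: "f ` carrier M = carrier N" using bij by (auto simp: bij_betw_def)
  have z: "f x = \<zero>\<^bsub>N\<^esub> \<longleftrightarrow> x = \<zero>\<^bsub>M\<^esub>" if "x \<in> carrier M" for x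
    using inj_on_eq_iff[OF inj that M.zero_closed] homs_zero[OF assms(1,2) hom] by simp
  have iff: "f x \<in> torsion N P i \<longleftrightarrow> x \<in> torsion M P i" if "x \<in> carrier M" for x
    using that z[of "_ \<odot>\<^bsub>M\<^esub> x"] homs_closed[OF hom] by (simp add: torsion_def homs_smult[OF hom, symmetric])
  have "f ` torsion M P i = torsion N P i"
  proof
    show "f ` torsion M P i \<subseteq> torsion N P i" using iff by (auto simp: torsion_def)
    show "torsion N P i \<subseteq> f ` torsion M P i"
    proof
      fix y assume y: "y \<in> torsion N P i"
      then have "y \<in> f ` carrier M" unfolding img by (simp add: torsion_def)
      then show "y \<in> f ` torsion M P i" using iff y by auto
    qed
  qed
  moreover have "inj_on f (torsion M P i)" using inj by (rule inj_on_subset) (auto simp: torsion_def)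
  ultimately have "bij_betw f (torsion M P i) (torsion N P i)" by (simp add: bij_betw_def)
  then show ?thesis by (rule bij_betw_same_card)
qed

lemma torsion_prod_mod: "torsion (prod_mod M N) P i = torsion M P i \<times> torsion N P i"
  by (auto simp: torsion_def)

lemma card_torsion_prod_mod:
  "card (torsion (prod_mod M N) P i) = card (torsion M P i) * card (torsion N P i)"
  by (simp add: torsion_prod_mod card_cartesian_product)

lemma torsion_0: "type_module M \<Longrightarrow> torsion M P 0 = {\<zero>\<^bsub>M\<^esub>}"
proof -
  assume "type_module M"
  then interpret type_module M .
  have "x = \<zero>\<^bsub>M\<^esub>" if "x \<in> torsion M P 0" for x
    using that smult_one[of x] by (auto simp: torsion_def simp del: smult_one)
  then show ?thesis by (auto simp: torsion_def)
qed

section \<open>Exponents and complements of cyclic submodules\<close>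

lemma finite_surj_periodic:
  fixes f :: "'b \<Rightarrow> 'b"
  assumes "finite A" "f ` A = A" "y \<in> A"
  obtains d where "d > 0" "(f ^^ d) y = y"
proof -
  have bij: "bij_betw f A A" using assms by (simp add: bij_betw_def endo_inj_surj finite_surj_inj eq_card_imp_inj_on)
  have mem: "(f ^^ n) y \<in> A" for n by (induction n) (use assms in auto)
  then have "\<not> inj (\<lambda>n. (f ^^ n) y)"
    using finite_imageD[of "\<lambda>n. (f ^^ n) y" UNIV] finite_subset[OF _ assms(1), of "range (\<lambda>n. (f ^^ n) y)"] by auto
  then obtain i j where "i < j" "(f ^^ i) y = (f ^^ j) y"
    unfolding inj_def by (metis linorder_neqE_nat)
  moreover have "bij_betw (f ^^ i) A A" for i
    by (rule bij_betw_funpow[OF bij])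
  moreover have "(f ^^ j) y = (f ^^ i) ((f ^^ (j - i)) y)"
    using \<open>i < j\<close> funpow_add[of i "j - i" f] by simp
  ultimately have "(f ^^ (j - i)) y = y"
    using mem mem[of 0] by (metis bij_betw_inv_into_left funpow_0)
  then show ?thesis using that[of "j - i"] \<open>i < j\<close> by simp
qed

context zeta_domain
begin

text \<open>Take \<open>y\<close> outside \<open>L\<close> such that the submodule generated by
  \<open>L\<close> and \<open>y\<close> is as small as possible. Its quotient by \<open>L\<close> is
  simple, hence of the form \<open>S / Q\<close> with \<open>Q\<close> maximal.\<close>

lemma simple_quotient:
  fixes M :: "('a, 'b, 'm) module_scheme" (structure)
  assumes M: "type_module M" and fin: "finite (carrier M)"
    and L: "submod L M" and ne: "L \<noteq> carrier M"
  obtains Q y where "Q \<in> primes" "y \<in> carrier M" "y \<notin> L" "\<And>q. q \<in> Q \<Longrightarrow> q \<odot> y \<in> L"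
proof -
  interpret type_module M by fact
  note L' = submodD[OF L]
  have "\<exists>y. y \<in> carrier M - L" using ne L'(1) by auto
  then obtain y where y: "y \<in> carrier M" "y \<notin> L"
    and min: "\<And>z. z \<in> carrier M - L \<Longrightarrow> card (adjoin y L) \<le> card (adjoin z L)"
    using ex_has_least_nat[of "\<lambda>y. y \<in> carrier M - L" _ "\<lambda>y. card (adjoin y L)"] by auto
  define Q where "Q = {r. r \<odot> y \<in> L}"
  have "Q \<in> primes"
  proof (rule primesI)
    show "is_ideal Q"
      by (rule is_idealI) (use y L' in \<open>auto simp: Q_def smult_l_distr smult_assoc\<close>)
    show "1 \<notin> Q" using y by (simp add: Q_def)
    fix r assume "r \<notin> Q"
    then have r: "r \<odot> y \<in> carrier M - L" using y by (auto simp: Q_def)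
    have Ly: "submod (adjoin y L) M" by (rule submod_adjoin[OF L y(1)])
    have "adjoin (r \<odot> y) L \<subseteq> adjoin y L"
      using in_adjoin[OF L y(1)] submodD(4)[OF Ly] by (intro adjoin_least[OF Ly]) auto
    moreover have "finite (adjoin y L)"
      using submodD(1)[OF Ly] fin by (meson finite_subset subsetI)
    \<comment> \<open>Minimality leaves no room between \<open>L\<close> and
      \<open>adjoin y L\<close>: as \<open>r \<odot> y\<close> is outside \<open>L\<close>, it
      generates the same submodule with \<open>L\<close>, and writing \<open>y\<close> in it inverts
      \<open>r\<close> modulo \<open>Q\<close>.\<close>
    ultimately have "adjoin (r \<odot> y) L = adjoin y L" using min[OF r] by (simp add: card_seteq)
    then have "y \<in> adjoin (r \<odot> y) L" using in_adjoin[OF L y(1)] by simp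
    then obtain a l where al: "l \<in> L" "y = a \<odot> (r \<odot> y) \<oplus> l" by (auto simp: adjoin_def)
    have "((a * r - 1) \<odot> y \<oplus> l) \<oplus> y = ((a * r - 1) \<odot> y \<oplus> 1 \<odot> y) \<oplus> l"
      using y al L' by (simp add: madd_ac)
    also have "\<dots> = y" using al(2) y unfolding smult_diff[OF y(1)] by (simp add: smult_assoc)
    also have "\<dots> = \<zero> \<oplus> y" using y by simp
    finally have "y \<oplus> ((a * r - 1) \<odot> y \<oplus> l) = y \<oplus> \<zero>"
      using y al L' by (simp add: add_comm)
    then have "(a * r - 1) \<odot> y \<oplus> l = \<zero>"
      using y(1) L'(1)[OF al(1)] by (subst (asm) add_left_cancel) auto
    then have "(a * r - 1) \<odot> y \<in> L" using submod_add_iff[OF L al(1), of "(a * r - 1) \<odot> y"] L' y by simp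
    then show "\<exists>v. v * r - 1 \<in> Q" by (auto simp: Q_def)
  qed
  then show ?thesis using that y by (auto simp: Q_def)
qed

text \<open>
  Choosing \<open>u\<close> outside \<open>P\<close> with \<open>u * M\<close> as small as possible makes \<open>u * M\<close> the localization of
  \<open>M\<close> at \<open>P\<close>: elements outside \<open>P\<close> act bijectively on it, and then \<open>t\<close> acts nilpotently.
\<close>

lemma local_exponent:
  fixes M :: "('a, 'b, 'm) module_scheme" (structure)
  assumes M: "type_module M" and fin: "finite (carrier M)"
    and unif: "uniformizer P t s"
  obtains e u where "u \<notin> P" "\<And>x. x \<in> carrier M \<Longrightarrow> (u * t ^ e) \<odot> x = \<zero>"
    "e > 0 \<Longrightarrow> \<exists>x\<in>carrier M. \<forall>r. r \<odot> x = \<zero> \<longleftrightarrow> r \<in> prime_power P e"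
proof -
  interpret type_module M by fact
  interpret uniformizer P t s by fact
  define B where "B v = (\<lambda>x. v \<odot> x) ` carrier M" for v
  obtain u where u: "u \<notin> P" and min: "\<And>v. v \<notin> P \<Longrightarrow> card (B u) \<le> card (B v)"
    using ex_has_least_nat[of "\<lambda>v. v \<notin> P" 1 "\<lambda>v. card (B v)"] one_notin by auto
  have finB: "finite (B u)" using fin by (simp add: B_def)
  have BM: "y \<in> carrier M" if "y \<in> B u" for y using that by (auto simp: B_def)
  have smB: "r \<odot> y \<in> B u" if "y \<in> B u" for r y
    using that by (auto simp: B_def smult_comm[of _ r])

  \<comment> \<open>Multiplication by \<open>v\<close> maps \<open>B u\<close> onto
    \<open>B (v * u)\<close>, which lies in \<open>B u\<close> and by the choice of \<open>u\<close>
    is no smaller; a surjection of a finite set onto itself is injective.\<close>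
  have cancel: "y = \<zero>" if v: "v \<notin> P" and y: "y \<in> B u" "v \<odot> y = \<zero>" for v y
  proof -
    have img: "(\<lambda>x. v \<odot> x) ` B u = B (v * u)" by (auto simp: B_def smult_assoc)
    have "B (v * u) \<subseteq> B u" unfolding img[symmetric] using smB by auto
    then have "B (v * u) = B u" using min[OF mult_notin[OF v u]] finB by (simp add: card_seteq)
    then have "inj_on (\<lambda>x. v \<odot> x) (B u)" using img finB by (intro eq_card_imp_inj_on) auto
    moreover have "\<zero> \<in> B u" by (auto simp: B_def intro!: image_eqI[of _ _ "\<zero>"])
    ultimately show ?thesis using y by (auto simp: inj_on_def)
  qed
  define D where "D k = (\<lambda>y. t ^ k \<odot> y) ` B u" for k
  obtain k where kmin: "\<And>j. card (D k) \<le> card (D j)"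
    using ex_has_least_nat[of "\<lambda>_. True" 0 "\<lambda>k. card (D k)"] by auto
  have DB: "D k \<subseteq> B u" using smB by (auto simp: D_def)
  then have finD: "finite (D k)" using finB finite_subset by blast
  have img: "(\<lambda>y. t \<odot> y) ` D k = D (Suc k)" by (auto simp: D_def smult_assoc BM)
  have "D (Suc k) \<subseteq> D k"
    using smB by (auto simp: D_def smult_assoc BM smult_comm[of _ t])
  then have "D (Suc k) = D k" using kmin[of "Suc k"] finD by (simp add: card_seteq)
  then have "(\<lambda>y. t \<odot> y) ` D k = D k" using img by simp
  \<comment> \<open>On \<open>D k\<close> multiplication by \<open>t\<close> is a permutation, so
    some \<open>t ^ d\<close> fixes \<open>y\<close>. Since \<open>t ^ d - 1\<close> is outside
    \<open>P\<close> and kills \<open>y\<close>, \<open>cancel\<close> applies.\<close>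
  have "y = \<zero>" if y: "y \<in> D k" for y
  proof -
    obtain d where d: "d > 0" "((\<lambda>y. t \<odot> y) ^^ d) y = y"
      using finite_surj_periodic[OF finD \<open>_ ` D k = D k\<close> y] .
    have yB: "y \<in> B u" using y DB by auto
    have "((\<lambda>y. t \<odot> y) ^^ d) y = t ^ d \<odot> y"
      by (induction d) (auto simp: BM[OF yB] smult_assoc)
    then have "t ^ d \<odot> y = 1 \<odot> y" using d BM[OF yB] by simp
    then have "(t ^ d - 1) \<odot> y = \<zero>" using smult_eq_iff[OF BM[OF yB]] by simp
    moreover have "t ^ d \<in> P" using d(1) t_in is_ideal_mult_right[OF ideal_P t_in] by (cases d) auto
    then have "t ^ d - 1 \<notin> P" using is_ideal_diff[OF ideal_P, of "t ^ d" "t ^ d - 1"] one_notin by auto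
    ultimately show ?thesis using cancel yB by blast
  qed
  then have ex: "\<exists>k. \<forall>y\<in>B u. t ^ k \<odot> y = \<zero>" by (auto simp: D_def intro!: exI[of _ k])
  define e where "e = (LEAST k. \<forall>y\<in>B u. t ^ k \<odot> y = \<zero>)"
  have e: "\<forall>y\<in>B u. t ^ e \<odot> y = \<zero>" unfolding e_def by (rule LeastI_ex[OF ex])
  show ?thesis
  proof (rule that[OF u])
    fix x assume "x \<in> carrier M"
    then show "(u * t ^ e) \<odot> x = \<zero>"
      using e by (auto simp: B_def smult_assoc smult_comm[of _ "t ^ e"])
  next
    assume "e > 0"
    then have "\<not> (\<forall>y\<in>B u. t ^ (e - 1) \<odot> y = \<zero>)"
      unfolding e_def by (intro not_less_Least) simp
    then obtain y where y: "y \<in> B u" "t ^ (e - 1) \<odot> y \<noteq> \<zero>" by blast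
    \<comment> \<open>Because \<open>t ^ (e - 1)\<close> does not kill \<open>y\<close> and elements
      outside \<open>P\<close> cancel, an annihilating \<open>r\<close> has valuation at least
      \<open>e\<close>.\<close>
    have "r \<odot> y = \<zero> \<longleftrightarrow> r \<in> prime_power P e" for r
    proof
      assume "r \<in> prime_power P e"
      then obtain w z where w: "w \<notin> P" "w * r = z * t ^ e" by (auto simp: prime_power_iff)
      have "w \<odot> (r \<odot> y) = (z * t ^ e) \<odot> y"
        using BM[OF y(1)] by (simp add: smult_assoc[symmetric] w)
      also have "\<dots> = \<zero>" using BM[OF y(1)] e y(1) by (simp add: smult_assoc)
      finally show "r \<odot> y = \<zero>" using cancel[OF w(1) smB[OF y(1)]] by simp
    next
      assume r: "r \<odot> y = \<zero>"
      show "r \<in> prime_power P e"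
      proof (rule ccontr)
        assume "r \<notin> prime_power P e"
        then obtain j a w where j: "j < e" "a \<notin> P" "w \<notin> P" "a * r = w * t ^ j"
          by (rule notin_prime_power)
        have "w \<odot> (t ^ j \<odot> y) = a \<odot> (r \<odot> y)"
          using BM[OF y(1)] by (simp add: smult_assoc[symmetric] j)
        then have "t ^ j \<odot> y = \<zero>" using cancel[OF j(3) smB[OF y(1)]] r by simp
        moreover have "t ^ (e - 1) = t ^ (e - 1 - j) * t ^ j" using j by (simp flip: power_add)
        ultimately have "t ^ (e - 1) \<odot> y = \<zero>" using BM[OF y(1)] by (simp add: smult_assoc)
        with y show False by simp
      qed
    qed
    then show "\<exists>x\<in>carrier M. \<forall>r. r \<odot> x = \<zero> \<longleftrightarrow> r \<in> prime_power P e" using BM[OF y(1)] by blast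
  qed
qed

text \<open>A cyclic submodule of the largest exponent at \<open>P\<close> splits off. A complement
  is any \<open>N\<close> maximal among the submodules that meet the span of \<open>x\<close> in
  zero: if the two did not span \<open>M\<close>, some \<open>y\<close> would generate a simple
  module above their sum \<open>L\<close>, and correcting \<open>y\<close> so that \<open>Q\<close>
  sends it into \<open>N\<close> would allow \<open>N\<close> to be enlarged. The bound
  \<open>kill\<close> on the exponent enters in the correction for \<open>Q = P\<close>.\<close>

lemma complement_exists:
  fixes M :: "('a, 'b, 'm) module_scheme" (structure)
  assumes M: "type_module M" and fin: "finite (carrier M)"
    and unif: "uniformizer P t s" and P: "P \<in> primes" and u: "u \<notin> P"
    and kill: "\<And>x. x \<in> carrier M \<Longrightarrow> (u * t ^ e) \<odot> x = \<zero>"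
    and x: "x \<in> carrier M" and ann: "\<And>r. r \<odot> x = \<zero> \<longleftrightarrow> r \<in> prime_power P e"
  obtains N where "submod N M" "\<And>r. r \<odot> x \<in> N \<Longrightarrow> r \<odot> x = \<zero>" "type_module.adjoin M x N = carrier M"
proof -
  interpret type_module M by fact
  interpret uniformizer P t s by fact
  define F where "F = {N. submod N M \<and> (\<forall>r. r \<odot> x \<in> N \<longrightarrow> r \<odot> x = \<zero>)}"
  have "finite F" by (rule finite_subset[of _ "Pow (carrier M)"]) (use fin in \<open>auto simp: F_def submod_def\<close>)
  moreover have "{\<zero>} \<in> F" by (simp add: F_def submod_trivial)
  ultimately obtain N where NF: "N \<in> F" and max: "\<And>N'. N' \<in> F \<Longrightarrow> N \<subseteq> N' \<Longrightarrow> N = N'"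
    using finite_has_maximal[of F] by auto
  have N: "submod N M" and int: "\<And>r. r \<odot> x \<in> N \<Longrightarrow> r \<odot> x = \<zero>" using NF by (auto simp: F_def)
  note N' = submodD[OF N]
  define L where "L = adjoin x N"
  have L: "submod L M" unfolding L_def by (rule submod_adjoin[OF N x])
  note L' = submodD[OF L]
  have xL: "x \<in> L" and NL: "\<And>n. n \<in> N \<Longrightarrow> n \<in> L" unfolding L_def using in_adjoin[OF N x] by auto
  \<comment> \<open>If \<open>Q\<close> sends \<open>y\<close> into \<open>L\<close>, scalars
    invertible modulo \<open>Q\<close> can be cancelled modulo \<open>L\<close>.\<close>
  have L_inv: "y \<in> L" if "y \<in> carrier M" "r \<odot> y \<in> L" "v * r - 1 \<in> Q" "\<And>q. q \<in> Q \<Longrightarrow> q \<odot> y \<in> L" for r v y Q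
  proof -
    have "(v * r - 1) \<odot> y \<oplus> y = v \<odot> (r \<odot> y)"
      using smult_diff[OF that(1), of "v * r" 1] that by (simp add: smult_assoc)
    then have "(v * r - 1) \<odot> y \<oplus> y \<in> L" using L' that by simp
    then show ?thesis using submod_add_iff'[OF L that(4)[OF that(3)] that(1)] by simp
  qed
  have "L = carrier M"
  proof (rule ccontr)
    assume "L \<noteq> carrier M"
    then obtain Q y where Q: "Q \<in> primes" and y: "y \<in> carrier M" "y \<notin> L" "\<And>q. q \<in> Q \<Longrightarrow> q \<odot> y \<in> L"
      using simple_quotient[OF M fin L] by blast
    have Qinv: "\<exists>v. v * r - 1 \<in> Q" if "r \<notin> Q" for r using Q that by (auto simp: primes_def maximalideal_iff)
    have "\<exists>y'\<in>carrier M. y' \<notin> L \<and> (\<forall>q\<in>Q. q \<odot> y' \<in> N)"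
    proof (cases "Q = P")
      case False
      \<comment> \<open>Since \<open>a\<close> annihilates \<open>x\<close>, multiplying by
        \<open>a\<close> removes the components along \<open>x\<close>; and \<open>a\<close> is
        invertible modulo \<open>Q\<close>, so \<open>a \<odot> y\<close> stays outside
        \<open>L\<close>.\<close>
      obtain a where a: "a \<in> prime_power P e" "a \<notin> Q"
        using prime_power_not_subset[OF P Q] False by blast
      obtain v where v: "v * a - 1 \<in> Q" using Qinv[OF a(2)] by blast
      have "a \<odot> y \<notin> L" using L_inv[OF y(1) _ v y(3)] y(2) by blast
      moreover have "q \<odot> (a \<odot> y) \<in> N" if "q \<in> Q" for q
      proof -
        obtain c n where cn: "n \<in> N" "q \<odot> y = c \<odot> x \<oplus> n"
          using y(3)[OF \<open>q \<in> Q\<close>] by (auto simp: L_def adjoin_def)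
        have "q \<odot> (a \<odot> y) = a \<odot> (q \<odot> y)" using y by (rule_tac smult_comm)
        also have "\<dots> = (a * c) \<odot> x \<oplus> a \<odot> n" using cn N' x by (simp add: smult_r_distr smult_assoc)
        also have "(a * c) \<odot> x = \<zero>" using ann is_ideal_mult_right[OF is_ideal_prime_power a(1)] by simp
        finally show ?thesis using cn N' by simp
      qed
      ultimately show ?thesis using y by blast
    next
      case True
      obtain r n where rn: "n \<in> N" "t \<odot> y = r \<odot> x \<oplus> n"
        using y(3)[of t] t_in True by (auto simp: L_def adjoin_def)
      \<comment> \<open>Up to the unit \<open>s\<close>, the component of \<open>t \<odot> y\<close>
        along \<open>x\<close> is divisible by \<open>t\<close>. If \<open>r\<close> were outside
        \<open>P\<close> and \<open>e = Suc k\<close>, then \<open>u * t ^ k\<close>, which kills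
        \<open>t \<odot> y\<close>, would force \<open>u * t ^ k * r\<close> to annihilate
        \<open>x\<close>, although its valuation is only \<open>k\<close>.\<close>
      have "\<exists>r'. (s * r) \<odot> x = (t * r') \<odot> x"
      proof (cases "r \<in> P")
        case True
        then show ?thesis using s_P by metis
      next
        case rP: False
        show ?thesis
        proof (cases e)
          case 0
          then have "c \<odot> x = \<zero>" for c using ann by simp
          then show ?thesis by simp
        next
          case (Suc k)
          have "\<zero> = (u * t ^ k) \<odot> (t \<odot> y)"
            using kill[OF y(1)] Suc by (simp add: smult_assoc[OF y(1), symmetric] ac_simps)
          also have "\<dots> = (u * t ^ k * r) \<odot> x \<oplus> (u * t ^ k) \<odot> n"
            using rn N' x by (simp add: smult_r_distr smult_assoc)
          finally have "(u * t ^ k * r) \<odot> x \<in> N"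
            using submod_add_iff[OF N, of "(u * t ^ k) \<odot> n" "(u * t ^ k * r) \<odot> x"] N' rn x by simp
          then have "(u * t ^ k * r) \<in> prime_power P e" using int ann by blast
          then have "(u * r) * (t ^ k * 1) \<in> prime_power P (k + 1)" using Suc by (simp add: ac_simps)
          then have "t ^ k * 1 \<in> prime_power P (k + 1)" using prime_power_cancel mult_notin u rP by blast
          then have "1 \<in> P" unfolding t_mult_iff by (simp add: prime_power_1)
          then show ?thesis using one_notin by simp
        qed
      qed
      then obtain r' where r': "(s * r) \<odot> x = (t * r') \<odot> x" by blast
      \<comment> \<open>Subtracting \<open>r' \<odot> x\<close> cancels that component, so that
        \<open>t\<close> sends \<open>y'\<close> into \<open>N\<close>.\<close>
      define y' where "y' = s \<odot> y \<oplus> (- r') \<odot> x"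
      have y'M: "y' \<in> carrier M" using x y by (simp add: y'_def)
      have xM: "c \<odot> x \<in> L" for c using xL L' by blast
      have "s \<odot> y \<notin> L"
        using inv_mod_P[OF s_notin] L_inv[OF y(1) _ _ y(3)] y(2) True by blast
      then have "y' \<notin> L" unfolding y'_def using submod_add_iff[OF L xM] y by simp
      have "t \<odot> y' = s \<odot> (t \<odot> y) \<oplus> (- (t * r')) \<odot> x"
        unfolding y'_def using x y by (simp add: smult_r_distr smult_assoc[symmetric] mult.commute)
      also have "\<dots> = ((s * r) \<odot> x \<oplus> (- (t * r')) \<odot> x) \<oplus> s \<odot> n"
        using rn x N' by (simp add: smult_r_distr smult_assoc madd_ac)
      also have "\<dots> = s \<odot> n"
        unfolding r' using x N' rn by (simp add: smult_l_distr[symmetric])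
      finally have ty': "t \<odot> y' \<in> N" using rn N' by simp
      have "p \<odot> y' \<in> N" if p: "p \<in> P" for p
      proof -
        have "p \<odot> y \<in> L" using y(3) p True by blast
        then have "s \<odot> (p \<odot> y) \<oplus> (- (p * r')) \<odot> x \<in> L" using L' xM by blast
        also have "s \<odot> (p \<odot> y) \<oplus> (- (p * r')) \<odot> x = p \<odot> y'"
          unfolding y'_def using x y by (simp add: smult_r_distr smult_assoc[symmetric] mult.commute)
        finally obtain c n' where cn: "n' \<in> N" "p \<odot> y' = c \<odot> x \<oplus> n'"
          by (auto simp: L_def adjoin_def)
        \<comment> \<open>Every \<open>p\<close> in \<open>P\<close> is a multiple of
          \<open>t\<close> up to the unit \<open>s\<close>, so the claim for \<open>t\<close> gives
          it for \<open>p\<close>.\<close>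
        obtain z where z: "s * p = t * z" using s_P[OF p] by blast
        have "s \<odot> (p \<odot> y') = z \<odot> (t \<odot> y')"
          unfolding smult_assoc[OF y'M, symmetric] z mult.commute[of t z] ..
        then have "(s * c) \<odot> x \<oplus> s \<odot> n' = z \<odot> (t \<odot> y')"
          unfolding cn(2) using x cn N' by (simp add: smult_r_distr smult_assoc)
        then have "(s * c) \<odot> x \<oplus> s \<odot> n' \<in> N" using ty' N' by simp
        then have "(s * c) \<odot> x \<in> N" using submod_add_iff[OF N] cn N' x by simp
        then have "s * c \<in> prime_power P e" using int ann by blast
        then have "c \<odot> x = \<zero>" using ann prime_power_cancel[OF s_notin] by blast
        then show ?thesis using cn N' by simp
      qed
      then show ?thesis using y'M \<open>y' \<notin> L\<close> True by blast
    qed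
    then obtain y' where y': "y' \<in> carrier M" "y' \<notin> L" "\<And>q. q \<in> Q \<Longrightarrow> q \<odot> y' \<in> N" by blast
    have "adjoin y' N \<in> F" unfolding F_def
    proof (intro CollectI conjI allI impI submod_adjoin[OF N y'(1)])
      fix c assume "c \<odot> x \<in> adjoin y' N"
      then obtain r n where rn: "n \<in> N" "c \<odot> x = r \<odot> y' \<oplus> n" by (auto simp: adjoin_def)
      \<comment> \<open>A scalar outside \<open>Q\<close> could be cancelled and would bring
        \<open>y'\<close> back into \<open>L\<close>.\<close>
      have "r \<in> Q"
      proof (rule ccontr)
        assume "r \<notin> Q"
        then obtain v where v: "v * r - 1 \<in> Q" using Qinv by blast
        have "r \<odot> y' \<oplus> n \<in> L" using rn(2)[symmetric] xL L' by simp
        then have "r \<odot> y' \<in> L" using submod_add_iff[OF L NL[OF rn(1)]] y' by simp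
        then show False using L_inv[OF y'(1) _ v] y' NL by blast
      qed
      then have "c \<odot> x \<in> N" using y'(3) rn N' by simp
      then show "c \<odot> x = \<zero>" by (rule int)
    qed
    moreover have "N \<subseteq> adjoin y' N" using in_adjoin[OF N y'(1)] by blast
    ultimately have "N = adjoin y' N" by (rule max)
    then show False using in_adjoin(1)[OF N y'(1)] y' NL by blast
  qed
  then show ?thesis using that N int by (simp add: L_def)
qed

end

section \<open>The classification of finite modules\<close>

definition kills :: "'a::idom \<Rightarrow> ('a, 'b, 'm) module_scheme \<Rightarrow> bool" where
  "kills r M \<longleftrightarrow> (\<forall>x\<in>carrier M. r \<odot>\<^bsub>M\<^esub> x = \<zero>\<^bsub>M\<^esub>)"

lemma kills_isomorphic_imp:
  assumes "type_module M" "type_module N" "isomorphic M N" "kills r M"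
  shows "kills r N"
proof -
  interpret M: type_module M by fact
  interpret N: type_module N by fact
  obtain f where f: "f \<in> isos M N" using assms by (auto simp: isomorphic_def)
  note hom = isos_homs[OF f]
  show ?thesis unfolding kills_def
  proof
    fix y assume "y \<in> carrier N"
    then have "y \<in> f ` carrier M" using isos_bij[OF f] by (simp add: bij_betw_def)
    then obtain x where x: "x \<in> carrier M" "y = f x" by blast
    then have "r \<odot>\<^bsub>N\<^esub> y = f (r \<odot>\<^bsub>M\<^esub> x)" by (simp add: homs_smult[OF hom])
    also have "\<dots> = \<zero>\<^bsub>N\<^esub>" using assms x homs_zero[OF assms(1,2) hom] by (simp add: kills_def)
    finally show "r \<odot>\<^bsub>N\<^esub> y = \<zero>\<^bsub>N\<^esub>" .
  qed
qed

lemma kills_isomorphic: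
  assumes "type_module M" "type_module N" "isomorphic M N" shows "kills r M \<longleftrightarrow> kills r N"
  using kills_isomorphic_imp[OF assms] kills_isomorphic_imp[OF assms(2,1) isomorphic_sym[OF assms(1,3)]]
  by metis

lemma kills_prod_mod:
  assumes "type_module M" "type_module N" shows "kills r (prod_mod M N) \<longleftrightarrow> kills r M \<and> kills r N"
  using type_module.zero_closed[OF assms(1)] type_module.zero_closed[OF assms(2)] by (auto simp: kills_def)

lemma kills_cyclic_mod:
  assumes I: "is_ideal I" shows "kills r (cyclic_mod I) \<longleftrightarrow> r \<in> I"
proof
  assume "kills r (cyclic_mod I)"
  then have "residue_rep I (r * residue_rep I 1) = residue_rep I 0" by (simp add: kills_def)
  then have "r * residue_rep I 1 \<in> I" by (simp add: residue_rep_eq_iff I)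
  moreover have "r * (residue_rep I 1 - 1) \<in> I" by (rule is_ideal_mult[OF I residue_rep_diff[OF I]])
  ultimately have "r * residue_rep I 1 - r * (residue_rep I 1 - 1) \<in> I" by (rule is_ideal_diff[OF I])
  then show "r \<in> I" by (simp add: algebra_simps)
next
  assume "r \<in> I"
  then show "kills r (cyclic_mod I)" by (auto simp: kills_def residue_rep_eq_iff I is_ideal_mult_right)
qed

context zeta_domain
begin

lemma torsion_mono: "P \<in> primes \<Longrightarrow> i \<le> j \<Longrightarrow> torsion M P i \<subseteq> torsion M P j"
  using prime_power_mono[of P i j] by (auto simp: torsion_def)

text \<open>On torsion killed by \<open>prime_power P n\<close> an element \<open>w\<close> outside
  \<open>P\<close> acts invertibly, through its inverse modulo that ideal.\<close>

lemma torsion_unit_cancel: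
  fixes M (structure)
  assumes M: "type_module M" and unif: "uniformizer P t s" and x: "x \<in> torsion M P n"
    and w: "w \<notin> P" and wa: "(w * a) \<odot> x = \<zero>"
  shows "a \<odot> x = \<zero>"
proof -
  interpret type_module M by fact
  interpret uniformizer P t s by fact
  have xM: "x \<in> carrier M" using x by (simp add: torsion_def)
  obtain v where v: "v * w - 1 \<in> prime_power P n" using inv_mod_prime_power[OF w] .
  have "(v * w * a - a) \<odot> x = \<zero>"
  proof -
    have "v * w * a - a = (v * w - 1) * a" by (simp add: algebra_simps)
    then have "v * w * a - a \<in> prime_power P n" using is_ideal_mult_right[OF is_ideal_prime_power v] by simp
    then show ?thesis using x by (simp add: torsion_def)
  qed
  then have "(v * w * a) \<odot> x = a \<odot> x" by (simp only: smult_eq_iff[OF xM])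
  then have "a \<odot> x = (v * (w * a)) \<odot> x" by (simp only: mult.assoc)
  also have "\<dots> = \<zero>" unfolding smult_assoc[OF xM, of v] wa by simp
  finally show ?thesis .
qed

text \<open>On \<open>P\<close>-power torsion the unit \<open>u\<close> can be cancelled, so
  \<open>kill\<close> says that \<open>t ^ e\<close> already annihilates it: the exponent of
  \<open>M\<close> at \<open>P\<close> is at most \<open>e\<close>.\<close>

lemma torsion_stable:
  fixes M (structure)
  assumes M: "type_module M" and unif: "uniformizer P t s" and P: "P \<in> primes" and u: "u \<notin> P"
    and kill: "kills (u * t ^ e) M" and ei: "e \<le> i"
  shows "torsion M P i = torsion M P e"
proof
  interpret type_module M by fact
  interpret uniformizer P t s by fact
  show "torsion M P e \<subseteq> torsion M P i" by (rule torsion_mono[OF P ei])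
  show "torsion M P i \<subseteq> torsion M P e"
  proof
    fix x assume x: "x \<in> torsion M P i"
    then have xM: "x \<in> carrier M" by (simp add: torsion_def)
    have "a \<odot> x = \<zero>" if a: "a \<in> prime_power P e" for a
    proof -
      obtain c z where c: "c \<notin> P" "c * a = z * t ^ e" using a by (auto simp: prime_power_iff)
      have "u * c * a = z * (u * t ^ e)" unfolding mult.assoc c(2) by (rule mult.left_commute)
      then have "(u * c * a) \<odot> x = z \<odot> ((u * t ^ e) \<odot> x)" by (simp only: smult_assoc[OF xM, of z])
      then have "(u * c * a) \<odot> x = \<zero>" using kill xM by (simp add: kills_def)
      then show ?thesis by (rule torsion_unit_cancel[OF M unif x mult_notin[OF u c(1)]])
    qed
    then show "x \<in> torsion M P e" using xM by (simp add: torsion_def)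
  qed
qed

text \<open>An annihilator \<open>r\<close> of valuation \<open>j \<le> k\<close> would make
  \<open>t ^ j\<close>, up to units, annihilate \<open>x\<close>, and with it the whole
  \<open>k\<close>-th power of \<open>P\<close>.\<close>

lemma torsion_annihilator:
  fixes M (structure)
  assumes M: "type_module M" and unif: "uniformizer P t s"
    and x: "x \<in> torsion M P (Suc k)" "x \<notin> torsion M P k"
  shows "r \<odot> x = \<zero> \<longleftrightarrow> r \<in> prime_power P (Suc k)"
proof
  interpret type_module M by fact
  interpret uniformizer P t s by fact
  have xM: "x \<in> carrier M" using x by (simp add: torsion_def)
  assume r: "r \<odot> x = \<zero>"
  show "r \<in> prime_power P (Suc k)"
  proof (rule ccontr)
    assume "r \<notin> prime_power P (Suc k)"
    then obtain j a w where j: "j < Suc k" "a \<notin> P" "w \<notin> P" "a * r = w * t ^ j" by (rule notin_prime_power)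
    have "b \<odot> x = \<zero>" if b: "b \<in> prime_power P k" for b
    proof -
      obtain c z where c: "c \<notin> P" "c * b = z * t ^ k" using b by (auto simp: prime_power_iff)
      have "t ^ k = t ^ (k - j) * t ^ j" using j by (simp flip: power_add)
      then have "w * c * b = (z * t ^ (k - j)) * (w * t ^ j)" by (simp add: mult.assoc c(2) mult.left_commute)
      also have "\<dots> = (z * t ^ (k - j) * a) * r" by (simp add: j(4)[symmetric] ac_simps)
      finally have "(w * c * b) \<odot> x = \<zero>" by (simp add: smult_assoc[OF xM, of "z * t ^ (k - j) * a"] r)
      then show ?thesis by (rule torsion_unit_cancel[OF M unif x(1) mult_notin[OF j(3) c(1)]])
    qed
    then show False using x(2) xM by (simp add: torsion_def)
  qed
qed (use x in \<open>auto simp: torsion_def\<close>)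

text \<open>The last equation keeps track of the generator: counting automorphisms requires a
  decomposition whose cyclic summand is spanned by a prescribed \<open>x\<close>.\<close>

lemma split_off:
  fixes M :: "('a, 'b, 'm) module_scheme" (structure)
  assumes M: "type_module M" and fin: "finite (carrier M)"
    and unif: "uniformizer P t s" and P: "P \<in> primes" and u: "u \<notin> P" and kill: "kills (u * t ^ Suc k) M"
    and x: "x \<in> torsion M P (Suc k)" "x \<notin> torsion M P k"
  obtains N f where "submod N M"
    "f \<in> isos (prod_mod (cyclic_mod (prime_power P (Suc k))) (M\<lparr>carrier := N\<rparr>)) M"
    "f (residue_rep (prime_power P (Suc k)) 1, \<zero>) = x"
proof -
  interpret type_module M by fact
  interpret uniformizer P t s by fact
  let ?I = "prime_power P (Suc k)"
  have xM: "x \<in> carrier M" using x by (simp add: torsion_def)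
  note ann = torsion_annihilator[OF M unif x]
  obtain N where N: "submod N M" "\<And>r. r \<odot> x \<in> N \<Longrightarrow> r \<odot> x = \<zero>" "adjoin x N = carrier M"
    using complement_exists[OF M fin unif P u _ xM ann] kill unfolding kills_def by blast
  have "residue_rep ?I 1 \<odot> x = 1 \<odot> x"
    unfolding smult_eq_iff[OF xM] ann by (rule residue_rep_diff[OF is_ideal_prime_power])
  then show ?thesis
    using that[OF N(1) decomposition_iso[OF is_ideal_prime_power N(1) xM ann N(2,3)]] submodD(2)[OF N(1)] xM
    by simp
qed

text \<open>With exponent 0 at \<open>P\<close> there would be no nonzero \<open>P\<close>-torsion.
  So the exponent is some \<open>Suc k\<close>, and an element with annihilator exactly
  \<open>prime_power P (Suc k)\<close> is an \<open>x\<close> as \<open>split_off\<close> asks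
  for.\<close>

lemma local_exponent_torsion:
  fixes M :: "('a, 'b, 'm) module_scheme" (structure)
  assumes M: "type_module M" and fin: "finite (carrier M)"
    and P: "P \<in> primes" and tor: "card (torsion M P (Suc 0)) \<noteq> 1"
  obtains k u t s x where "uniformizer P t s" "u \<notin> P" "kills (u * t ^ Suc k) M"
    "x \<in> torsion M P (Suc k)" "x \<notin> torsion M P k"
proof -
  interpret type_module M by fact
  obtain t s where unif: "uniformizer P t s" using uniformizerE[OF P] .
  interpret uniformizer P t s by fact
  obtain e u where u: "u \<notin> P" and kill: "\<And>x. x \<in> carrier M \<Longrightarrow> (u * t ^ e) \<odot> x = \<zero>"
    and ex: "e > 0 \<Longrightarrow> \<exists>x\<in>carrier M. \<forall>r. r \<odot> x = \<zero> \<longleftrightarrow> r \<in> prime_power P e"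
    using local_exponent[OF M fin unif] by metis
  have kill': "kills (u * t ^ e) M" using kill by (simp add: kills_def)
  have "e \<noteq> 0"
  proof
    assume "e = 0"
    then have "torsion M P (Suc 0) = torsion M P 0" using torsion_stable[OF M unif P u kill', of "Suc 0"] by simp
    then show False using tor torsion_0[OF M] by simp
  qed
  then obtain k where k: "e = Suc k" by (cases e) auto
  then obtain x where x: "x \<in> carrier M" "\<And>r. r \<odot> x = \<zero> \<longleftrightarrow> r \<in> prime_power P (Suc k)"
    using ex by auto
  have "t ^ k * 1 \<notin> prime_power P (k + 1)" unfolding t_mult_iff using one_notin by (simp add: prime_power_1)
  then have "t ^ k \<odot> x \<noteq> \<zero>" unfolding x(2) by simp
  moreover have "t ^ k \<in> prime_power P k" using t_power_in[of 1 k] by simp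
  ultimately have "x \<notin> torsion M P k" by (auto simp: torsion_def)
  moreover have "x \<in> torsion M P (Suc k)" using x by (simp add: torsion_def)
  ultimately show ?thesis using that[OF unif u] kill' k by blast
qed

lemma nonzero_torsion:
  fixes M :: "('a, 'b, 'm) module_scheme" (structure)
  assumes M: "type_module M" and fin: "finite (carrier M)"
    and ne: "carrier M \<noteq> {\<zero>}"
  obtains P where "P \<in> primes" "card (torsion M P (Suc 0)) \<noteq> 1"
proof -
  interpret type_module M by fact
  obtain Q y where Q: "Q \<in> primes" "y \<in> carrier M" "y \<notin> {\<zero>}" "\<And>q. q \<in> Q \<Longrightarrow> q \<odot> y \<in> {\<zero>}"
    using simple_quotient[OF M fin submod_trivial] ne by metis
  then have "y \<in> torsion M Q (Suc 0)" by (auto simp: torsion_def prime_power_one)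
  moreover have "\<zero> \<in> torsion M Q (Suc 0)" by (simp add: torsion_def)
  ultimately have "card (torsion M Q (Suc 0)) \<noteq> 1" using Q(3) by (auto simp: card_1_singleton_iff)
  then show ?thesis using that Q(1) by blast
qed

text \<open>Every step splits off a summand whose exponent is the largest at its prime; the premise
  \<open>kills (u * t ^ Suc k) M\<close> of \<open>split\<close> records this maximality, on which
  the count of automorphisms depends.\<close>

lemma finite_module_induct [consumes 2, case_names zero split]:
  fixes M :: "('a, 'b, 'm) module_scheme"
  assumes "type_module M" "finite (carrier M)"
    and zero: "\<And>M :: ('a, 'b, 'm) module_scheme. type_module M \<Longrightarrow> carrier M = {\<zero>\<^bsub>M\<^esub>} \<Longrightarrow> Pr M"
    and split: "\<And>(M :: ('a, 'b, 'm) module_scheme) N P k u t s. type_module M \<Longrightarrow> finite (carrier M) \<Longrightarrow> P \<in> primes \<Longrightarrow>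
       uniformizer P t s \<Longrightarrow> u \<notin> P \<Longrightarrow> kills (u * t ^ Suc k) M \<Longrightarrow> type_module (M\<lparr>carrier := N\<rparr>) \<Longrightarrow> finite N \<Longrightarrow>
       isomorphic (prod_mod (cyclic_mod (prime_power P (Suc k))) (M\<lparr>carrier := N\<rparr>)) M \<Longrightarrow>
       Pr (M\<lparr>carrier := N\<rparr>) \<Longrightarrow> Pr M"
  shows "Pr M"
  using assms(1,2)
proof (induction "card (carrier M)" arbitrary: M rule: less_induct)
  case (less M)
  note M = less.prems(1) and fin = less.prems(2)
  interpret type_module M by fact
  show ?case
  proof (cases "carrier M = {\<zero>\<^bsub>M\<^esub>}")
    case True
    then show ?thesis by (rule zero[OF M])
  next
    case False
    obtain P where P: "P \<in> primes" "card (torsion M P (Suc 0)) \<noteq> 1" using nonzero_torsion[OF M fin False] .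
    obtain k u t s x where *: "uniformizer P t s" "u \<notin> P" "kills (u * t ^ Suc k) M"
      "x \<in> torsion M P (Suc k)" "x \<notin> torsion M P k"
      using local_exponent_torsion[OF M fin P] .
    obtain N f where N: "submod N M"
      and f: "f \<in> isos (prod_mod (cyclic_mod (prime_power P (Suc k))) (M\<lparr>carrier := N\<rparr>)) M"
      using split_off[OF M fin *(1) P(1) *(2,3,4,5)] .
    interpret uniformizer P t s by fact
    have aN: "type_module (M\<lparr>carrier := N\<rparr>)" by (rule type_module_submod[OF N])
    have finN: "finite N" using N fin by (auto simp: submod_def intro: finite_subset)
    have iso: "isomorphic (prod_mod (cyclic_mod (prime_power P (Suc k))) (M\<lparr>carrier := N\<rparr>)) M"
      using f by (auto simp: isomorphic_def)
    have "card (carrier M) = card (residues P) ^ Suc k * card N"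
      using isomorphic_card[OF iso] residues_prime_power by (simp add: card_cartesian_product)
    moreover have "card N > 0" using finN submodD(2)[OF N] by (auto simp: card_gt_0_iff)
    moreover have "card (residues P) ^ Suc k > 1" using card_residues_gt_1 by (intro one_less_power) auto
    ultimately have "card N < card (carrier M)" by simp
    then have "Pr (M\<lparr>carrier := N\<rparr>)" using less.hyps[of "M\<lparr>carrier := N\<rparr>"] aN finN by simp
    then show ?thesis by (rule split[OF M fin P(1) *(1,2,3) aN finN iso])
  qed
qed

text \<open>The annihilator of a direct sum is the intersection of the annihilators. For powers of
  the same \<open>P\<close> this keeps the larger exponent, as the multiset union
  \<open>\<union>#\<close> does.\<close>

lemma finite_module_annihilator:
  assumes "type_module (M :: ('a, 'b, 'm) module_scheme)" "finite (carrier M)"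
  obtains Y where "set_mset Y \<subseteq> primes" "{r. kills r M} = mset_ideal Y"
proof -
  have "\<exists>Y. set_mset Y \<subseteq> primes \<and> {r. kills r M} = mset_ideal Y"
    using assms
  proof (induction rule: finite_module_induct)
    case (zero M)
    then have "kills r M" for r by (simp add: kills_def type_module.smult_r_zero)
    then show ?case by (auto simp: mset_ideal_def intro!: exI[of _ "{#}"])
  next
    case (split M N P k u t s)
    then obtain Y where Y: "set_mset Y \<subseteq> primes" "{r. kills r (M\<lparr>carrier := N\<rparr>)} = mset_ideal Y" by blast
    interpret uniformizer P t s by fact
    have "{r. kills r M} = prime_power P (Suc k) \<inter> mset_ideal Y"
      using kills_isomorphic[OF type_module_prod_mod[OF type_module_cyclic_mod[OF is_ideal_prime_power[of "Suc k"]] split(7)] split(1) split(9)]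
        Y(2) by (auto simp: kills_prod_mod type_module_cyclic_mod is_ideal_prime_power split(7) kills_cyclic_mod)
    also have "\<dots> = mset_ideal (Y \<union># replicate_mset (Suc k) P)"
    proof -
      have *: "r \<in> mset_ideal Z \<longleftrightarrow> (\<forall>Q\<in>primes. r \<in> prime_power Q (count Z Q))"
        if "set_mset Z \<subseteq> primes" for r Z
        using that by (auto simp: mset_ideal_def) (metis UNIV_I not_in_iff prime_power.simps(1))
      have max: "prime_power Q (max m n) = prime_power Q m \<inter> prime_power Q n" if "Q \<in> primes" for Q m n
        using prime_power_mono[OF that, of m n] prime_power_mono[OF that, of n m] by (auto simp: max_def)
      have "set_mset (Y \<union># replicate_mset (Suc k) P) \<subseteq> primes" using Y split(3) by auto
      from *[OF this] *[OF Y(1)] show ?thesis using split(3) max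
        by (auto simp: split: if_splits)
    qed
    finally show ?case using Y split(3) by (intro exI[of _ "Y \<union># replicate_mset (Suc k) P"]) auto
  qed
  then show ?thesis using that by blast
qed

text \<open>An ideal \<open>I\<close> is the annihilator of \<open>S / I\<close>, so the
  factorization of finite index ideals comes out of the structure of finite modules.\<close>

lemma finite_index_ideal:
  assumes "is_ideal (I :: 'a set)" "finite (residues I)"
  obtains Y where "set_mset Y \<subseteq> primes" "I = mset_ideal Y"
  using finite_module_annihilator[OF type_module_cyclic_mod[OF assms(1)]] assms
  by (auto simp: kills_cyclic_mod)

section \<open>Types of finite modules as complete invariants\<close>

text \<open>Exponent 0 is excluded: \<open>S / P ^ 0\<close> is zero and would spoil the uniqueness
  of the type.\<close>

definition prime_exps :: "('a set \<times> nat) set" where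
  "prime_exps = primes \<times> {1..}"

text \<open>For a module of type \<open>Y\<close> this is the logarithm of the size of
  \<open>torsion M P i\<close> to the base \<open>|S / P|\<close>, because the
  \<open>P ^ i\<close>-torsion of \<open>S / P ^ e\<close> has \<open>|S / P| ^ min i e\<close>
  elements.\<close>

definition tcount :: "('a set \<times> nat) multiset \<Rightarrow> 'a set \<Rightarrow> nat \<Rightarrow> nat" where
  "tcount Y P i = (\<Sum>(Q, e)\<in>#Y. if Q = P then min i e else 0)"

definition module_norm :: "('a set \<times> nat) multiset \<Rightarrow> nat" where
  "module_norm Y = (\<Prod>(P, e)\<in>#Y. card (residues P) ^ e)"

text \<open>
  \<open>M\<close> has type \<open>Y\<close> if it is isomorphic to the direct sum of the \<open>S / P ^ e\<close> with \<open>(P, e)\<close> in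
  \<open>Y\<close>; this is expressed by the cardinalities of the torsion submodules.
\<close>

definition has_type :: "('a, 'b, 'm) module_scheme \<Rightarrow> ('a set \<times> nat) multiset \<Rightarrow> bool" where
  "has_type M Y \<longleftrightarrow> set_mset Y \<subseteq> prime_exps \<and>
     (\<forall>P\<in>primes. \<forall>i. card (torsion M P i) = card (residues P) ^ tcount Y P i)"

text \<open>As a function of \<open>i\<close>, \<open>min i e\<close> is linear except for a kink at
  \<open>i = e\<close>, so second differences of \<open>tcount\<close> count the pairs with exponent
  exactly \<open>Suc i\<close>. The negative terms are moved across to avoid subtraction of natural
  numbers.\<close>

lemma tcount_second_difference:
  "2 * tcount Y P (Suc i) = tcount Y P i + tcount Y P (Suc (Suc i)) + count Y (P, Suc i)"
proof (induction Y)
  case (add p Y)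
  then show ?case by (cases p, cases "fst p = P") (auto simp: tcount_def min_def)
qed (simp add: tcount_def)

lemma has_type_unique:
  assumes "has_type M Y" "has_type M Z" shows "Y = Z"
proof (rule multiset_eqI)
  fix p show "count Y p = count Z p"
  proof (cases "p \<in> prime_exps")
    case True
    then obtain P i where p: "p = (P, Suc i)" "P \<in> primes"
      by (auto simp: prime_exps_def) (metis Suc_le_D)
    have "card (residues P) ^ tcount Y P i = card (residues P) ^ tcount Z P i" for i
      using assms p by (simp add: has_type_def)
    then have "tcount Y P i = tcount Z P i" for i
      using residues_prime_gt_1[OF p(2)] by simp
    then show ?thesis using tcount_second_difference[of Y P i] tcount_second_difference[of Z P i] p by simp
  next
    case False
    then show ?thesis using assms by (metis has_type_def not_in_iff subsetD)
  qed
qed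

lemma has_type_isomorphic:
  "type_module M \<Longrightarrow> type_module N \<Longrightarrow> isomorphic M N \<Longrightarrow> has_type M Y \<Longrightarrow> has_type N Y"
  using torsion_isomorphic[of M N] by (simp add: has_type_def)

lemma has_type_prod_mod:
  "has_type M Y \<Longrightarrow> has_type N Z \<Longrightarrow> has_type (prod_mod M N) (Y + Z)"
  by (auto simp: has_type_def card_torsion_prod_mod tcount_def power_add)

text \<open>At a prime other than \<open>P\<close> the torsion vanishes, since a power of that prime
  contains elements outside \<open>P\<close>. At \<open>P\<close> the torsion is the quotient of
  \<open>prime_power P (e - j)\<close> by \<open>prime_power P e\<close> with
  \<open>j = min i e\<close>, and multiplication by \<open>t ^ (e - j)\<close> identifies it with
  \<open>S / P ^ j\<close>.\<close>

lemma has_type_cyclic_mod: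
  assumes P: "P \<in> primes"
  shows "has_type (cyclic_mod (prime_power P (Suc k))) {#(P, Suc k)#}"
proof -
  obtain t s where unif: "uniformizer P t s" using uniformizerE[OF P] .
  interpret uniformizer P t s by fact
  define e where "e = Suc k"
  let ?I = "prime_power P e"
  note I = is_ideal_prime_power[of e]
  have tor: "torsion (cyclic_mod ?I) Q i = {r \<in> residues ?I. \<forall>a\<in>prime_power Q i. a * r \<in> ?I}" for Q i
    by (auto simp: torsion_def residue_rep_eq_iff[OF I])
  have "card (torsion (cyclic_mod ?I) Q i) = card (residues Q) ^ tcount {#(P, e)#} Q i" if Q: "Q \<in> primes" for Q i
  proof (cases "Q = P")
    case False
    obtain a where a: "a \<in> prime_power Q i" "a \<notin> P" using prime_power_not_subset[OF Q P] False by blast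
    have "torsion (cyclic_mod ?I) Q i = {residue_rep ?I 0}"
    proof safe
      fix r assume "r \<in> torsion (cyclic_mod ?I) Q i"
      then have r: "r \<in> residues ?I" "a * r \<in> ?I" using a by (auto simp: tor)
      then have "r \<in> ?I" using prime_power_cancel[OF a(2)] by blast
      then show "r = residue_rep ?I 0" using residue_rep_residue[OF I r(1)] residue_rep_eq_zero_iff[OF I] by metis
    next
      have "residue_rep ?I 0 \<in> ?I" using residue_rep_diff[OF I, of 0] by simp
      then show "residue_rep ?I 0 \<in> torsion (cyclic_mod ?I) Q i" by (auto simp: tor is_ideal_mult[OF I])
    qed
    then show ?thesis using False by (simp add: tcount_def)
  next
    case True
    define j where "j = min i e"
    have je: "e = (e - j) + j" by (simp add: j_def)
    have mul: "a * r \<in> prime_power P (m + n)" if ar: "a \<in> prime_power P m" "r \<in> prime_power P n" for a r m n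
    proof -
      obtain v y where v: "v \<notin> P" "v * a = y * t ^ m" using ar by (auto simp: prime_power_iff)
      obtain w z where w: "w \<notin> P" "w * r = z * t ^ n" using ar by (auto simp: prime_power_iff)
      have "(v * w) * (a * r) = (v * a) * (w * r)" by (simp add: ac_simps)
      also have "\<dots> = (y * z) * t ^ (m + n)" unfolding v(2) w(2) by (simp add: power_add ac_simps)
      finally show ?thesis using mult_notin[OF v(1) w(1)] by (auto simp: prime_power_iff)
    qed
    have "torsion (cyclic_mod ?I) P i = {r \<in> residues ?I. r \<in> prime_power P (e - j)}"
      unfolding tor
    proof (intro Collect_cong conj_cong refl iffI)
      fix r assume "\<forall>a\<in>prime_power P i. a * r \<in> ?I"
      then have "t ^ i * r \<in> ?I" using t_power_in[of 1 i] by simp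
      then show "r \<in> prime_power P (e - j)"
        using t_mult_iff[of i r "e - i"] by (cases "i \<le> e") (auto simp: j_def)
    next
      fix r assume r: "r \<in> prime_power P (e - j)"
      show "\<forall>a\<in>prime_power P i. a * r \<in> ?I"
      proof
        fix a assume "a \<in> prime_power P i"
        from mul[OF this r] have "a * r \<in> prime_power P (i + (e - j))" .
        moreover have "e \<le> i + (e - j)" by (simp add: j_def min_def)
        ultimately show "a * r \<in> ?I" using prime_power_mono[OF P] by blast
      qed
    qed
    moreover have "bij_betw (\<lambda>y. residue_rep ?I (t ^ (e - j) * y)) (residues (prime_power P j))
        {r \<in> residues ?I. r \<in> prime_power P (e - j)}"
      unfolding bij_betw_def
    proof
      have iff: "t ^ (e - j) * y \<in> ?I \<longleftrightarrow> y \<in> prime_power P j" for y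
        using t_mult_iff[of "e - j" y j] je by simp
      show "inj_on (\<lambda>y. residue_rep ?I (t ^ (e - j) * y)) (residues (prime_power P j))"
      proof (rule inj_onI)
        fix y z assume yz: "y \<in> residues (prime_power P j)" "z \<in> residues (prime_power P j)"
          "residue_rep ?I (t ^ (e - j) * y) = residue_rep ?I (t ^ (e - j) * z)"
        then have "y - z \<in> prime_power P j"
          by (simp add: residue_rep_eq_iff[OF I] right_diff_distrib[symmetric] iff)
        then show "y = z" using yz is_ideal_prime_power by (metis residue_rep_eq_iff residue_rep_residue)
      qed
      have mem: "residue_rep ?I r \<in> prime_power P (e - j) \<longleftrightarrow> r \<in> prime_power P (e - j)" for r
      proof -
        have d: "residue_rep ?I r - r \<in> prime_power P (e - j)"
          using residue_rep_diff[OF I, of r] prime_power_mono[OF P, of "e - j" e] by auto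
        show ?thesis using is_ideal_diff[OF is_ideal_prime_power _ d, of "residue_rep ?I r"]
            is_ideal_add[OF is_ideal_prime_power _ d, of r] by auto
      qed
      show "(\<lambda>y. residue_rep ?I (t ^ (e - j) * y)) ` residues (prime_power P j)
          = {r \<in> residues ?I. r \<in> prime_power P (e - j)}"
      proof safe
        fix y show "residue_rep ?I (t ^ (e - j) * y) \<in> prime_power P (e - j)"
          unfolding mem using t_power_in[of y "e - j"] by (simp add: mult.commute)
      next
        fix r assume r: "r \<in> residues ?I" "r \<in> prime_power P (e - j)"
        obtain y where y: "r - t ^ (e - j) * y \<in> ?I" using t_generates[OF r(2)] by blast
        let ?y = "residue_rep (prime_power P j) y"
        have "t ^ (e - j) * (?y - y) \<in> ?I" unfolding iff by (rule residue_rep_diff[OF is_ideal_prime_power])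
        then have "(r - t ^ (e - j) * y) - t ^ (e - j) * (?y - y) \<in> ?I" by (rule is_ideal_diff[OF I y])
        then have "r - t ^ (e - j) * ?y \<in> ?I" by (simp add: algebra_simps)
        then have "r = residue_rep ?I (t ^ (e - j) * ?y)"
          using residue_rep_residue[OF I r(1)] by (simp add: residue_rep_eq_iff[OF I, symmetric])
        then show "r \<in> (\<lambda>y. residue_rep ?I (t ^ (e - j) * y)) ` residues (prime_power P j)" by auto
      qed simp
    qed
    ultimately have "card (torsion (cyclic_mod ?I) P i) = card (residues (prime_power P j))"
      using bij_betw_same_card by metis
    then show ?thesis using True residues_prime_power by (simp add: tcount_def j_def)
  qed
  then show ?thesis using P by (simp add: has_type_def e_def prime_exps_def)
qed

lemma has_type_split:
  assumes "type_module M" "P \<in> primes" "type_module N" "has_type N Z"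
    "isomorphic (prod_mod (cyclic_mod (prime_power P (Suc k))) N) M"
  shows "has_type M ({#(P, Suc k)#} + Z)"
  using has_type_isomorphic[OF type_module_prod_mod[OF type_module_cyclic_mod[OF ideal_prime_power[OF assms(2)]] assms(3)] assms(1,5)]
    has_type_prod_mod[OF has_type_cyclic_mod[OF assms(2)] assms(4)] by blast

lemma has_type_exists:
  assumes "type_module (M :: ('a, 'b, 'm) module_scheme)" "finite (carrier M)"
  obtains Y where "has_type M Y" "card (carrier M) = module_norm Y"
proof -
  have "\<exists>Y. has_type M Y \<and> card (carrier M) = module_norm Y"
    using assms
  proof (induction rule: finite_module_induct)
    case (zero M)
    interpret type_module M by fact
    have "torsion M P i = {\<zero>\<^bsub>M\<^esub>}" for P i using zero by (auto simp: torsion_def)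
    then have "has_type M {#}" by (simp add: has_type_def tcount_def)
    then show ?case using zero by (auto simp: module_norm_def intro!: exI[of _ "{#}"])
  next
    case (split M N P k u t s)
    then obtain Z where Z: "has_type (M\<lparr>carrier := N\<rparr>) Z" "card N = module_norm Z" by auto
    have "has_type M ({#(P, Suc k)#} + Z)"
      by (rule has_type_split[OF split(1,3,7) Z(1) split(9)])
    moreover have "card (carrier M) = module_norm ({#(P, Suc k)#} + Z)"
      using isomorphic_card[OF split(9)] Z uniformizer.residues_prime_power[OF split(4), of "Suc k"]
      by (simp add: card_cartesian_product module_norm_def)
    ultimately show ?case by blast
  qed
  then show ?thesis using that by blast
qed

lemma has_type_card:
  "type_module M \<Longrightarrow> finite (carrier M) \<Longrightarrow> has_type M Y \<Longrightarrow> card (carrier M) = module_norm Y"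
  by (metis has_type_exists has_type_unique)

lemma has_type_nat:
  assumes "set_mset Y \<subseteq> prime_exps"
  obtains D :: "('a, nat) module" where "type_module D" "finite (carrier D)" "has_type D Y"
proof -
  have "\<exists>D :: ('a, nat) module. type_module D \<and> finite (carrier D) \<and> has_type D Y"
    using assms
  proof (induction Y)
    case empty
    have cUN: "carrier (cyclic_mod (UNIV :: 'a set)) = {\<zero>\<^bsub>cyclic_mod (UNIV :: 'a set)\<^esub>}"
      by (simp add: residues_UNIV)
    then have "has_type (cyclic_mod (UNIV :: 'a set)) {#}"
      by (auto simp: has_type_def tcount_def torsion_def residue_rep_eq_iff is_ideal_UNIV
        intro!: card_1_singleton_iff[THEN iffD2, of "{_}"])
    moreover obtain D :: "('a, nat) module" where "type_module D" "isomorphic (cyclic_mod (UNIV :: 'a set)) D"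
      using transport_nat[OF type_module_cyclic_mod[OF is_ideal_UNIV]] cUN by (metis finite.emptyI finite.insertI)
    ultimately show ?case using has_type_isomorphic[OF type_module_cyclic_mod[OF is_ideal_UNIV]] isomorphic_finite cUN
      by (metis finite.emptyI finite.insertI)
  next
    case (add p Y)
    then obtain D :: "('a, nat) module" where D: "type_module D" "finite (carrier D)" "has_type D Y" by auto
    from add obtain P k where p: "p = (P, Suc k)" "P \<in> primes"
      by (auto simp: prime_exps_def) (metis Suc_le_D)
    obtain t s where unif: "uniformizer P t s" using uniformizerE[OF p(2)] .
    let ?A = "prod_mod (cyclic_mod (prime_power P (Suc k))) D"
    have A: "type_module ?A" by (intro type_module_prod_mod type_module_cyclic_mod ideal_prime_power p D)
    have fin: "finite (carrier ?A)" using D uniformizer.residues_prime_power[OF unif] by simp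
    obtain E :: "('a, nat) module" where E: "type_module E" "isomorphic ?A E" using transport_nat[OF A fin] .
    have "has_type E ({#(P, Suc k)#} + Y)" by (rule has_type_split[OF E(1) p(2) D(1,3) E(2)])
    then show ?case using E isomorphic_finite[OF E(2)] fin p by auto
  qed
  then show ?thesis using that by blast
qed

text \<open>The largest exponent at \<open>P\<close> can be read off the torsion sizes, so both
  modules split off the same \<open>S / P ^ (k + 1)\<close>. By uniqueness of types the complements
  again have a common type, and they are smaller.\<close>

lemma has_type_imp_isomorphic:
  assumes "type_module (M :: ('a, 'b, 'm) module_scheme)" "finite (carrier M)"
    and "type_module (N :: ('a, 'c, 'n) module_scheme)" "finite (carrier N)"
    and "has_type M Y" "has_type N Y"
  shows "isomorphic M N"
  using assms
proof (induction "card (carrier M)" arbitrary: M N Y rule: less_induct)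
  case (less M N Y)
  note M = less.prems(1) and finM = less.prems(2) and N = less.prems(3) and finN = less.prems(4)
  note tM = less.prems(5) and tN = less.prems(6)
  interpret M: type_module M by fact
  interpret N: type_module N by fact
  have cards: "card (carrier M) = card (carrier N)" using has_type_card less.prems by metis
  have tor: "card (torsion M P i) = card (torsion N P i)" if "P \<in> primes" for P i
    using tM tN that by (simp add: has_type_def)
  show ?case
  proof (cases "carrier M = {\<zero>\<^bsub>M\<^esub>}")
    case True
    then have "card (carrier N) = 1" using cards by simp
    then have "carrier N = {\<zero>\<^bsub>N\<^esub>}" using N.zero_closed by (metis card_1_singletonE singletonD)
    then have "(\<lambda>x\<in>carrier M. \<zero>\<^bsub>N\<^esub>) \<in> isos M N" using True
      by (auto simp: isos_def bij_betw_def intro!: homsI)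
    then show ?thesis by (auto simp: isomorphic_def)
  next
    case False
    obtain P where P: "P \<in> primes" "card (torsion M P (Suc 0)) \<noteq> 1" using nonzero_torsion[OF M finM False] .
    obtain k u t s x where 1: "uniformizer P t s" "u \<notin> P" "kills (u * t ^ Suc k) M"
      "x \<in> torsion M P (Suc k)" "x \<notin> torsion M P k"
      using local_exponent_torsion[OF M finM P] .
    obtain k' u' t' s' x' where 2: "uniformizer P t' s'" "u' \<notin> P" "kills (u' * t' ^ Suc k') N"
      "x' \<in> torsion N P (Suc k')" "x' \<notin> torsion N P k'"
      using local_exponent_torsion[OF N finN P(1)] P(2) tor[OF P(1)] by metis
    have finT: "finite (torsion M P i)" "finite (torsion N P i)" for i
      using finM finN by (auto simp: torsion_def)
    have "card (torsion M P k) < card (torsion M P (Suc k))"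
      using 1 torsion_mono[OF P(1), of k "Suc k" M] finT by (intro psubset_card_mono) auto
    moreover have "card (torsion N P k') < card (torsion N P (Suc k'))"
      using 2 torsion_mono[OF P(1), of k' "Suc k'" N] finT by (intro psubset_card_mono) auto
    moreover have "torsion M P i = torsion M P (Suc k)" if "i \<ge> Suc k" for i
      by (rule torsion_stable[OF M 1(1) P(1) 1(2,3) that])
    moreover have "torsion N P i = torsion N P (Suc k')" if "i \<ge> Suc k'" for i
      by (rule torsion_stable[OF N 2(1) P(1) 2(2,3) that])
    \<comment> \<open>In \<open>M\<close> the torsion grows strictly from \<open>k\<close> to
      \<open>Suc k\<close> and is constant afterwards, in \<open>N\<close> likewise at
      \<open>k'\<close>; equal sizes force the thresholds to agree.\<close>
    ultimately have k: "k' = k" using tor[OF P(1)]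
      by (metis Suc_leI le_SucI less_irrefl linorder_neqE_nat)
    obtain M' f where M': "submod M' M"
      and f: "f \<in> isos (prod_mod (cyclic_mod (prime_power P (Suc k))) (M\<lparr>carrier := M'\<rparr>)) M"
      using split_off[OF M finM 1(1) P(1) 1(2,3,4,5)] .
    obtain N' g where N': "submod N' N"
      and g: "g \<in> isos (prod_mod (cyclic_mod (prime_power P (Suc k))) (N\<lparr>carrier := N'\<rparr>)) N"
      using split_off[OF N finN 2(1) P(1) 2(2,3,4,5)] k by metis
    interpret uniformizer P t s by fact
    have isoM: "isomorphic (prod_mod (cyclic_mod (prime_power P (Suc k))) (M\<lparr>carrier := M'\<rparr>)) M"
      and isoN: "isomorphic (prod_mod (cyclic_mod (prime_power P (Suc k))) (N\<lparr>carrier := N'\<rparr>)) N"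
      using f g by (auto simp: isomorphic_def)
    have aM': "type_module (M\<lparr>carrier := M'\<rparr>)" and aN': "type_module (N\<lparr>carrier := N'\<rparr>)"
      using M.type_module_submod[OF M'] N.type_module_submod[OF N'] by auto
    have finM': "finite M'" and finN': "finite N'"
      using M' N' finM finN by (auto simp: submod_def intro: finite_subset)
    obtain Z where Z: "has_type (M\<lparr>carrier := M'\<rparr>) Z" using has_type_exists[OF aM'] finM' by auto
    obtain Z' where Z': "has_type (N\<lparr>carrier := N'\<rparr>) Z'" using has_type_exists[OF aN'] finN' by auto
    have "{#(P, Suc k)#} + Z = Y" "{#(P, Suc k)#} + Z' = Y"
      using has_type_unique has_type_split[OF M P(1) aM' Z isoM] has_type_split[OF N P(1) aN' Z' isoN] tM tN by blast+
    then have "Z = Z'" by auto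
    have "card (carrier M) = card (residues P) ^ Suc k * card M'"
      using isomorphic_card[OF isoM] residues_prime_power by (simp add: card_cartesian_product)
    moreover have "card M' > 0" using finM' M.submodD(2)[OF M'] by (auto simp: card_gt_0_iff)
    moreover have "card (residues P) ^ Suc k > 1" using card_residues_gt_1 by (intro one_less_power) auto
    ultimately have "card M' < card (carrier M)" by simp
    then have "isomorphic (M\<lparr>carrier := M'\<rparr>) (N\<lparr>carrier := N'\<rparr>)"
      using less.hyps[of "M\<lparr>carrier := M'\<rparr>" "N\<lparr>carrier := N'\<rparr>" Z] aM' aN' finM' finN' Z Z' \<open>Z = Z'\<close> by simp
    then have AB: "isomorphic (prod_mod (cyclic_mod (prime_power P (Suc k))) (M\<lparr>carrier := M'\<rparr>))
        (prod_mod (cyclic_mod (prime_power P (Suc k))) (N\<lparr>carrier := N'\<rparr>))"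
      by (rule isomorphic_prod_mod[OF type_module_cyclic_mod[OF is_ideal_prime_power] aM'
          isomorphic_refl[OF type_module_cyclic_mod[OF is_ideal_prime_power]]])
    note A = type_module_prod_mod[OF type_module_cyclic_mod[OF is_ideal_prime_power[of "Suc k"]] aM']
    show ?thesis
      by (rule isomorphic_trans[OF M isomorphic_sym[OF A isoM] isomorphic_trans[OF A AB isoN]])
  qed
qed

end

section \<open>Endomorphisms and automorphisms\<close>

lemma card_homs_prod_mod_left:
  assumes "type_module A" "type_module B" "type_module C"
  shows "card (homs (prod_mod A B) C) = card (homs A C) * card (homs B C)"
proof -
  interpret A: type_module A by fact
  interpret B: type_module B by fact
  interpret C: type_module C by fact
  let ?F = "\<lambda>f. (\<lambda>x\<in>carrier A. f (x, \<zero>\<^bsub>B\<^esub>), \<lambda>y\<in>carrier B. f (\<zero>\<^bsub>A\<^esub>, y))"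
  let ?G = "\<lambda>(g, h). \<lambda>(x, y)\<in>carrier A \<times> carrier B. g x \<oplus>\<^bsub>C\<^esub> h y"
  have "bij_betw ?F (homs (prod_mod A B) C) (homs A C \<times> homs B C)"
  proof (rule bij_betw_byWitness[where f' = ?G])
    show "\<forall>f\<in>homs (prod_mod A B) C. ?G (?F f) = f"
    proof (intro ballI ext)
      fix f p assume f: "f \<in> homs (prod_mod A B) C"
      show "?G (?F f) p = f p"
      proof (cases "p \<in> carrier A \<times> carrier B")
        case True
        then show ?thesis using homs_add[OF f, of "(fst p, \<zero>\<^bsub>B\<^esub>)" "(\<zero>\<^bsub>A\<^esub>, snd p)"] by auto
      next
        case False
        then show ?thesis using homs_ext[OF f] by (cases p) (auto simp: extensional_def)
      qed
    qed
    show "\<forall>p\<in>homs A C \<times> homs B C. ?F (?G p) = p"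
    proof
      fix p assume "p \<in> homs A C \<times> homs B C"
      then obtain g h where p: "p = (g, h)" and g: "g \<in> homs A C" and h: "h \<in> homs B C" by auto
      have "(\<lambda>x\<in>carrier A. g x \<oplus>\<^bsub>C\<^esub> h \<zero>\<^bsub>B\<^esub>) = g"
        by (rule extensionalityI[of _ "carrier A"])
          (use g homs_closed[OF g] homs_zero[OF assms(2,3) h] in \<open>auto dest: homs_ext\<close>)
      moreover have "(\<lambda>y\<in>carrier B. g \<zero>\<^bsub>A\<^esub> \<oplus>\<^bsub>C\<^esub> h y) = h"
        by (rule extensionalityI[of _ "carrier B"])
          (use h homs_closed[OF h] homs_zero[OF assms(1,3) g] in \<open>auto dest: homs_ext\<close>)
      ultimately show "?F (?G p) = p" unfolding p by (simp cong: restrict_cong)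
    qed
    show "?F ` homs (prod_mod A B) C \<subseteq> homs A C \<times> homs B C"
    proof (rule image_subsetI)
      fix f assume f: "f \<in> homs (prod_mod A B) C"
      have "(\<lambda>x\<in>carrier A. f (x, \<zero>\<^bsub>B\<^esub>)) \<in> homs A C"
        by (rule homsI) (use homs_closed[OF f] homs_add[OF f, of "(_, \<zero>\<^bsub>B\<^esub>)" "(_, \<zero>\<^bsub>B\<^esub>)"]
          homs_smult[OF f, of "(_, \<zero>\<^bsub>B\<^esub>)"] in auto)
      moreover have "(\<lambda>y\<in>carrier B. f (\<zero>\<^bsub>A\<^esub>, y)) \<in> homs B C"
        by (rule homsI) (use homs_closed[OF f] homs_add[OF f, of "(\<zero>\<^bsub>A\<^esub>, _)" "(\<zero>\<^bsub>A\<^esub>, _)"]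
          homs_smult[OF f, of "(\<zero>\<^bsub>A\<^esub>, _)"] in auto)
      ultimately show "?F f \<in> homs A C \<times> homs B C" by simp
    qed
    show "?G ` (homs A C \<times> homs B C) \<subseteq> homs (prod_mod A B) C"
    proof clarify
      fix g h assume g: "g \<in> homs A C" and h: "h \<in> homs B C"
      show "(\<lambda>(x, y)\<in>carrier A \<times> carrier B. g x \<oplus>\<^bsub>C\<^esub> h y) \<in> homs (prod_mod A B) C"
        by (rule homsI) (use homs_closed[OF g] homs_closed[OF h] homs_add[OF g] homs_add[OF h]
          homs_smult[OF g] homs_smult[OF h] in \<open>auto simp: C.madd_ac C.smult_r_distr\<close>)
    qed
  qed
  from bij_betw_same_card[OF this] show ?thesis by (simp only: card_cartesian_product)
qed

lemma card_homs_prod_mod_right: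
  assumes "type_module A" "type_module B" "type_module C"
  shows "card (homs C (prod_mod A B)) = card (homs C A) * card (homs C B)"
proof -
  interpret C: type_module C by fact
  let ?F = "\<lambda>f. (\<lambda>x\<in>carrier C. fst (f x), \<lambda>x\<in>carrier C. snd (f x))"
  let ?G = "\<lambda>(g, h). \<lambda>x\<in>carrier C. (g x, h x)"
  have "bij_betw ?F (homs C (prod_mod A B)) (homs C A \<times> homs C B)"
  proof (rule bij_betw_byWitness[where f' = ?G])
    show "\<forall>f\<in>homs C (prod_mod A B). ?G (?F f) = f"
    proof (intro ballI)
      fix f assume f: "f \<in> homs C (prod_mod A B)"
      show "?G (?F f) = f"
        by (rule extensionalityI[of _ "carrier C"]) (use homs_ext[OF f] in auto)
    qed
    show "\<forall>p\<in>homs C A \<times> homs C B. ?F (?G p) = p"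
    proof
      fix p assume "p \<in> homs C A \<times> homs C B"
      then obtain g h where p: "p = (g, h)" and g: "g \<in> homs C A" and h: "h \<in> homs C B" by auto
      show "?F (?G p) = p"
        unfolding p using homs_ext[OF g] homs_ext[OF h] by (auto simp: extensional_restrict cong: restrict_cong)
    qed
    show "?F ` homs C (prod_mod A B) \<subseteq> homs C A \<times> homs C B"
    proof (rule image_subsetI)
      fix f assume f: "f \<in> homs C (prod_mod A B)"
      have cl: "fst (f x) \<in> carrier A \<and> snd (f x) \<in> carrier B" if "x \<in> carrier C" for x
        using homs_closed[OF f that] by auto
      have add: "f (x \<oplus>\<^bsub>C\<^esub> y) = (fst (f x) \<oplus>\<^bsub>A\<^esub> fst (f y), snd (f x) \<oplus>\<^bsub>B\<^esub> snd (f y))"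
        if "x \<in> carrier C" "y \<in> carrier C" for x y
        using homs_add[OF f that] by (cases "f x", cases "f y") simp
      have sm: "f (r \<odot>\<^bsub>C\<^esub> x) = (r \<odot>\<^bsub>A\<^esub> fst (f x), r \<odot>\<^bsub>B\<^esub> snd (f x))" if "x \<in> carrier C" for r x
        using homs_smult[OF f that] by (cases "f x") simp
      have "(\<lambda>x\<in>carrier C. fst (f x)) \<in> homs C A" "(\<lambda>x\<in>carrier C. snd (f x)) \<in> homs C B"
        by (rule homsI; use cl add sm in auto)+
      then show "?F f \<in> homs C A \<times> homs C B" by simp
    qed
    show "?G ` (homs C A \<times> homs C B) \<subseteq> homs C (prod_mod A B)"
    proof clarify
      fix g h assume g: "g \<in> homs C A" and h: "h \<in> homs C B"
      show "(\<lambda>x\<in>carrier C. (g x, h x)) \<in> homs C (prod_mod A B)"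
        by (rule homsI) (use homs_closed[OF g] homs_closed[OF h] homs_add[OF g] homs_add[OF h]
          homs_smult[OF g] homs_smult[OF h] in auto)
    qed
  qed
  from bij_betw_same_card[OF this] show ?thesis by (simp only: card_cartesian_product)
qed

text \<open>A homomorphism from \<open>S / I\<close> is determined by the image of \<open>1\<close>,
  which may be any element annihilated by \<open>I\<close>.\<close>

lemma card_homs_cyclic_mod:
  assumes I: "is_ideal I" and C: "type_module C"
  shows "card (homs (cyclic_mod I) C) = card {y \<in> carrier C. \<forall>r\<in>I. r \<odot>\<^bsub>C\<^esub> y = \<zero>\<^bsub>C\<^esub>}"
proof -
  interpret C: type_module C by fact
  interpret A: type_module "cyclic_mod I" by (rule type_module_cyclic_mod[OF I])
  let ?one = "residue_rep I 1"
  let ?G = "\<lambda>y. \<lambda>r\<in>residues I. r \<odot>\<^bsub>C\<^esub> y"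
  have gen: "r = r \<odot>\<^bsub>cyclic_mod I\<^esub> ?one" if "r \<in> residues I" for r
  proof -
    have "r * ?one - r \<in> I" using is_ideal_mult[OF I residue_rep_diff[OF I, of 1], of r] by (simp add: algebra_simps)
    then have "residue_rep I (r * ?one) = residue_rep I r" by (simp add: residue_rep_eq_iff[OF I])
    then show ?thesis using residue_rep_residue[OF I that] by simp
  qed
  have "bij_betw (\<lambda>f. f ?one) (homs (cyclic_mod I) C) {y \<in> carrier C. \<forall>r\<in>I. r \<odot>\<^bsub>C\<^esub> y = \<zero>\<^bsub>C\<^esub>}"
  proof (rule bij_betw_byWitness[where f' = ?G])
    show "\<forall>f\<in>homs (cyclic_mod I) C. ?G (f ?one) = f"
    proof
      fix f assume f: "f \<in> homs (cyclic_mod I) C"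
      show "?G (f ?one) = f"
      proof (rule extensionalityI[of _ "residues I"])
        fix r assume r: "r \<in> residues I"
        have "f r = f (r \<odot>\<^bsub>cyclic_mod I\<^esub> ?one)" using gen[OF r] by simp
        also have "\<dots> = r \<odot>\<^bsub>C\<^esub> f ?one" by (rule homs_smult[OF f]) simp
        finally show "?G (f ?one) r = f r" using r by simp
      qed (use homs_ext[OF f] in auto)
    qed
    have eq: "residue_rep I r \<odot>\<^bsub>C\<^esub> y = r \<odot>\<^bsub>C\<^esub> y" if "y \<in> carrier C" "\<forall>r\<in>I. r \<odot>\<^bsub>C\<^esub> y = \<zero>\<^bsub>C\<^esub>" for r y
      using that residue_rep_diff[OF I, of r] by (simp add: C.smult_eq_iff)
    show "\<forall>y\<in>{y \<in> carrier C. \<forall>r\<in>I. r \<odot>\<^bsub>C\<^esub> y = \<zero>\<^bsub>C\<^esub>}. ?G y ?one = y"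
      using eq[of _ 1] by simp
    show "(\<lambda>f. f ?one) ` homs (cyclic_mod I) C \<subseteq> {y \<in> carrier C. \<forall>r\<in>I. r \<odot>\<^bsub>C\<^esub> y = \<zero>\<^bsub>C\<^esub>}"
    proof clarify
      fix f assume f: "f \<in> homs (cyclic_mod I) C"
      have "r \<odot>\<^bsub>C\<^esub> f ?one = \<zero>\<^bsub>C\<^esub>" if "r \<in> I" for r
      proof -
        have "r \<odot>\<^bsub>C\<^esub> f ?one = f (r \<odot>\<^bsub>cyclic_mod I\<^esub> ?one)" by (rule homs_smult[OF f, symmetric]) simp
        also have "r \<odot>\<^bsub>cyclic_mod I\<^esub> ?one = \<zero>\<^bsub>cyclic_mod I\<^esub>"
          using that by (simp add: residue_rep_eq_iff[OF I] is_ideal_mult_right[OF I])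
        also have "f \<zero>\<^bsub>cyclic_mod I\<^esub> = \<zero>\<^bsub>C\<^esub>" by (rule homs_zero[OF A.type_module_axioms C f])
        finally show ?thesis .
      qed
      then show "f ?one \<in> carrier C \<and> (\<forall>r\<in>I. r \<odot>\<^bsub>C\<^esub> f ?one = \<zero>\<^bsub>C\<^esub>)" using homs_closed[OF f] by simp
    qed
    show "?G ` {y \<in> carrier C. \<forall>r\<in>I. r \<odot>\<^bsub>C\<^esub> y = \<zero>\<^bsub>C\<^esub>} \<subseteq> homs (cyclic_mod I) C"
    proof clarify
      fix y assume y: "y \<in> carrier C" "\<forall>r\<in>I. r \<odot>\<^bsub>C\<^esub> y = \<zero>\<^bsub>C\<^esub>"
      show "?G y \<in> homs (cyclic_mod I) C"
        by (rule homsI) (use y eq[OF y] in \<open>auto simp: C.smult_l_distr C.smult_assoc\<close>)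
    qed
  qed
  then show ?thesis by (rule bij_betw_same_card)
qed

text \<open>
  An automorphism of \<open>A \<oplus> B\<close> that fixes \<open>A\<close> pointwise is of the form \<open>(a, b) \<mapsto> (a + g b, h b)\<close>.
\<close>

lemma card_isos_stabilizer:
  assumes "type_module A" "type_module B" and fin: "finite (carrier A)" "finite (carrier B)"
    and a0: "a0 \<in> carrier A" and gen: "\<And>a. a \<in> carrier A \<Longrightarrow> \<exists>r. a = r \<odot>\<^bsub>A\<^esub> a0"
  shows "card {f \<in> isos (prod_mod A B) (prod_mod A B). f (a0, \<zero>\<^bsub>B\<^esub>) = (a0, \<zero>\<^bsub>B\<^esub>)}
    = card (homs B A) * card (isos B B)"
proof -
  interpret A: type_module A by fact
  interpret B: type_module B by fact
  let ?M = "prod_mod A B"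
  let ?S = "{f \<in> isos ?M ?M. f (a0, \<zero>\<^bsub>B\<^esub>) = (a0, \<zero>\<^bsub>B\<^esub>)}"
  let ?F = "\<lambda>f. (\<lambda>y\<in>carrier B. fst (f (\<zero>\<^bsub>A\<^esub>, y)), \<lambda>y\<in>carrier B. snd (f (\<zero>\<^bsub>A\<^esub>, y)))"
  let ?G = "\<lambda>(g, h). \<lambda>(x, y)\<in>carrier A \<times> carrier B. (x \<oplus>\<^bsub>A\<^esub> g y, h y)"
  have f_eq: "f (x, y) = (x \<oplus>\<^bsub>A\<^esub> fst (f (\<zero>\<^bsub>A\<^esub>, y)), snd (f (\<zero>\<^bsub>A\<^esub>, y)))"
    and f_cl: "fst (f (\<zero>\<^bsub>A\<^esub>, y)) \<in> carrier A" "snd (f (\<zero>\<^bsub>A\<^esub>, y)) \<in> carrier B"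
    if f: "f \<in> ?S" and xy: "x \<in> carrier A" "y \<in> carrier B" for f x y
  proof -
    have hom: "f \<in> homs ?M ?M" using f isos_homs by blast
    obtain r where r: "x = r \<odot>\<^bsub>A\<^esub> a0" using gen xy by blast
    have "f (x, \<zero>\<^bsub>B\<^esub>) = (x, \<zero>\<^bsub>B\<^esub>)"
      using homs_smult[OF hom, of "(a0, \<zero>\<^bsub>B\<^esub>)" r] f a0 by (simp add: r)
    moreover obtain c d where cd: "f (\<zero>\<^bsub>A\<^esub>, y) = (c, d)" by fastforce
    ultimately show "f (x, y) = (x \<oplus>\<^bsub>A\<^esub> fst (f (\<zero>\<^bsub>A\<^esub>, y)), snd (f (\<zero>\<^bsub>A\<^esub>, y)))"
      "fst (f (\<zero>\<^bsub>A\<^esub>, y)) \<in> carrier A" "snd (f (\<zero>\<^bsub>A\<^esub>, y)) \<in> carrier B"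
      using homs_add[OF hom, of "(x, \<zero>\<^bsub>B\<^esub>)" "(\<zero>\<^bsub>A\<^esub>, y)"] xy homs_closed[OF hom, of "(\<zero>\<^bsub>A\<^esub>, y)"] by auto
  qed
  have "bij_betw ?F ?S (homs B A \<times> isos B B)"
  proof (rule bij_betw_byWitness[where f' = ?G])
    show "\<forall>f\<in>?S. ?G (?F f) = f"
    proof (intro ballI ext)
      fix f p assume f: "f \<in> ?S"
      show "?G (?F f) p = f p"
      proof (cases "p \<in> carrier A \<times> carrier B")
        case True
        then show ?thesis using f_eq[OF f, of "fst p" "snd p"] by auto
      next
        case False
        then show ?thesis using f homs_ext[of f ?M ?M] isos_homs[of f ?M ?M]
          by (cases p) (auto simp: extensional_def)
      qed
    qed
    show "\<forall>p\<in>homs B A \<times> isos B B. ?F (?G p) = p"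
    proof
      fix p assume "p \<in> homs B A \<times> isos B B"
      then obtain g h where p: "p = (g, h)" and g: "g \<in> homs B A" and h: "h \<in> isos B B" by auto
      show "?F (?G p) = p"
        unfolding p using homs_ext[OF g] homs_ext[OF isos_homs[OF h]] homs_closed[OF g]
        by (auto simp: extensional_restrict cong: restrict_cong)
    qed
    show "?F ` ?S \<subseteq> homs B A \<times> isos B B"
    proof (rule image_subsetI)
      fix f assume f: "f \<in> ?S"
      then have fi: "f \<in> isos ?M ?M" by simp
      note hom = isos_homs[OF fi]
      note cl = f_cl[OF f A.zero_closed] and eq = f_eq[OF f]
      have add: "f (\<zero>\<^bsub>A\<^esub>, x \<oplus>\<^bsub>B\<^esub> y) = (fst (f (\<zero>\<^bsub>A\<^esub>, x)) \<oplus>\<^bsub>A\<^esub> fst (f (\<zero>\<^bsub>A\<^esub>, y)),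
          snd (f (\<zero>\<^bsub>A\<^esub>, x)) \<oplus>\<^bsub>B\<^esub> snd (f (\<zero>\<^bsub>A\<^esub>, y)))"
        if "x \<in> carrier B" "y \<in> carrier B" for x y
        using homs_add[OF hom, of "(\<zero>\<^bsub>A\<^esub>, x)" "(\<zero>\<^bsub>A\<^esub>, y)"] that
        by (cases "f (\<zero>\<^bsub>A\<^esub>, x)", cases "f (\<zero>\<^bsub>A\<^esub>, y)") simp
      have sm: "f (\<zero>\<^bsub>A\<^esub>, r \<odot>\<^bsub>B\<^esub> x) = (r \<odot>\<^bsub>A\<^esub> fst (f (\<zero>\<^bsub>A\<^esub>, x)), r \<odot>\<^bsub>B\<^esub> snd (f (\<zero>\<^bsub>A\<^esub>, x)))"
        if "x \<in> carrier B" for r x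
        using homs_smult[OF hom, of "(\<zero>\<^bsub>A\<^esub>, x)" r] that by (cases "f (\<zero>\<^bsub>A\<^esub>, x)") simp
      have g: "(\<lambda>y\<in>carrier B. fst (f (\<zero>\<^bsub>A\<^esub>, y))) \<in> homs B A"
        by (rule homsI) (use cl add sm in auto)
      have h: "(\<lambda>y\<in>carrier B. snd (f (\<zero>\<^bsub>A\<^esub>, y))) \<in> homs B B" (is "?h \<in> _")
        by (rule homsI) (use cl add sm in auto)
      \<comment> \<open>A preimage of \<open>(0, b)\<close> under \<open>f\<close> has a second
        coordinate that \<open>?h\<close> sends to \<open>b\<close>; finiteness turns surjectivity
        into bijectivity.\<close>
      have "carrier B \<subseteq> ?h ` carrier B"
      proof
        fix b assume "b \<in> carrier B"
        then have "(\<zero>\<^bsub>A\<^esub>, b) \<in> f ` (carrier A \<times> carrier B)"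
          using isos_bij[OF fi] by (simp add: bij_betw_def)
        then obtain x y where xy: "x \<in> carrier A" "y \<in> carrier B" "f (x, y) = (\<zero>\<^bsub>A\<^esub>, b)" by force
        then have "?h y = b" using eq[of x y] by simp
        then show "b \<in> ?h ` carrier B" using xy by blast
      qed
      moreover have "?h ` carrier B \<subseteq> carrier B" using cl by auto
      ultimately have "?h ` carrier B = carrier B" by blast
      then have "bij_betw ?h (carrier B) (carrier B)"
        using fin by (simp add: bij_betw_def eq_card_imp_inj_on)
      with h have "?h \<in> isos B B" by (simp add: isos_def)
      with g show "?F f \<in> homs B A \<times> isos B B" by simp
    qed
    show "?G ` (homs B A \<times> isos B B) \<subseteq> ?S"
    proof clarify
      fix g h assume g: "g \<in> homs B A" and h: "h \<in> isos B B"
      note hh = isos_homs[OF h]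
      let ?f = "\<lambda>(x, y)\<in>carrier A \<times> carrier B. (x \<oplus>\<^bsub>A\<^esub> g y, h y)"
      have f: "?f \<in> homs ?M ?M"
        by (rule homsI) (use homs_closed[OF g] homs_closed[OF hh] homs_add[OF g] homs_add[OF hh]
          homs_smult[OF g] homs_smult[OF hh] in \<open>auto simp: A.madd_ac A.smult_r_distr\<close>)
      have "carrier A \<times> carrier B \<subseteq> ?f ` (carrier A \<times> carrier B)"
      proof clarify
        fix a b assume ab: "a \<in> carrier A" "b \<in> carrier B"
        then have "b \<in> h ` carrier B" using isos_bij[OF h] by (simp add: bij_betw_def)
        then obtain y where y: "y \<in> carrier B" "h y = b" by blast
        have "(a \<oplus>\<^bsub>A\<^esub> (-1) \<odot>\<^bsub>A\<^esub> g y) \<oplus>\<^bsub>A\<^esub> g y = a"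
          using ab homs_closed[OF g y(1)] by (simp add: A.add_assoc A.l_neg)
        then have "?f (a \<oplus>\<^bsub>A\<^esub> (-1) \<odot>\<^bsub>A\<^esub> g y, y) = (a, b)" using y ab homs_closed[OF g y(1)] by simp
        then show "(a, b) \<in> ?f ` (carrier A \<times> carrier B)"
          using y ab homs_closed[OF g y(1)] by (intro image_eqI[of _ _ "(a \<oplus>\<^bsub>A\<^esub> (-1) \<odot>\<^bsub>A\<^esub> g y, y)"]) auto
      qed
      moreover have "?f ` (carrier A \<times> carrier B) \<subseteq> carrier A \<times> carrier B"
        using homs_closed[OF g] homs_closed[OF hh] by auto
      ultimately have "?f ` (carrier A \<times> carrier B) = carrier A \<times> carrier B" by (rule subset_antisym[rotated])
      then have "bij_betw ?f (carrier ?M) (carrier ?M)"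
        using fin by (simp add: bij_betw_def eq_card_imp_inj_on del: inj_on_restrict_eq image_restrict_eq)
      moreover have "?f (a0, \<zero>\<^bsub>B\<^esub>) = (a0, \<zero>\<^bsub>B\<^esub>)"
        using a0 homs_zero[OF assms(2,1) g] homs_zero[OF assms(2,2) hh] by simp
      ultimately show "?f \<in> isos ?M ?M \<and> ?f (a0, \<zero>\<^bsub>B\<^esub>) = (a0, \<zero>\<^bsub>B\<^esub>)" using f by (simp add: isos_def)
    qed
  qed
  from bij_betw_same_card[OF this] show ?thesis by (simp only: card_cartesian_product)
qed

section \<open>Local weights and the ratio of endomorphisms to automorphisms\<close>

text \<open>A product of local factors. When \<open>g p 0 = 1\<close> it may be extended over any
  finite set that contains the support.\<close>

definition mset_prod :: "('b \<Rightarrow> nat \<Rightarrow> 'c::comm_monoid_mult) \<Rightarrow> 'b multiset \<Rightarrow> 'c" where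
  "mset_prod g Y = (\<Prod>p\<in>set_mset Y. g p (count Y p))"

lemma mset_prod_superset:
  assumes "finite A" "set_mset Y \<subseteq> A" "\<And>p. g p 0 = 1"
  shows "mset_prod g Y = (\<Prod>p\<in>A. g p (count Y p))"
  unfolding mset_prod_def by (rule prod.mono_neutral_left) (use assms in \<open>auto simp: not_in_iff\<close>)

text \<open>Only the factor at \<open>p\<close> changes; the identity is cross multiplied because
  the codomain need not have division.\<close>

lemma mset_prod_add_mset:
  assumes "\<And>p. g p 0 = 1"
  shows "mset_prod g (add_mset p Z) * g p (count Z p) = mset_prod g Z * g p (Suc (count Z p))"
proof -
  let ?A = "insert p (set_mset Z)"
  have 1: "mset_prod g (add_mset p Z) = (\<Prod>x\<in>?A. g x (count (add_mset p Z) x))"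
    by (rule mset_prod_superset) (use assms in auto)
  have 2: "mset_prod g Z = (\<Prod>x\<in>?A. g x (count Z x))"
    by (rule mset_prod_superset) (use assms in auto)
  have 3: "(\<Prod>x\<in>?A - {p}. g x (count (add_mset p Z) x)) = (\<Prod>x\<in>?A - {p}. g x (count Z x))"
    by (rule prod.cong) auto
  show ?thesis unfolding 1 2 prod.remove[of ?A p, simplified] by (simp add: 3[simplified] ac_simps)
qed

text \<open>The number of \<open>m\<close> by \<open>m\<close> matrices over the field with
  \<open>q\<close> elements divided by the order of \<open>GL_m\<close>. It is also the ratio of
  endomorphisms to automorphisms of \<open>m\<close> copies of \<open>S / P ^ e\<close>, for every
  \<open>e \<ge> 1\<close>, if \<open>q = |S / P|\<close>.\<close>

definition q_weight :: "nat \<Rightarrow> nat \<Rightarrow> real" where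
  "q_weight q m = (\<Prod>k=1..m. 1 / (1 - 1 / real q ^ k))"

lemma q_weight_0 [simp]: "q_weight q 0 = 1"
  by (simp add: q_weight_def)

lemma q_weight_Suc: "q_weight q (Suc m) = q_weight q m / (1 - 1 / real q ^ Suc m)"
  by (simp add: q_weight_def)

lemma q_weight_pos: "q > 1 \<Longrightarrow> q_weight q m > 0"
  unfolding q_weight_def by (intro prod_pos) auto

context zeta_domain
begin

text \<open>Orbit and stabilizer of the generator \<open>(1, 0)\<close> of \<open>A\<close> under
  the automorphism group: the orbit consists of the elements with annihilator
  \<open>prime_power P (Suc k)\<close>, and \<open>card_isos_stabilizer\<close> gives the size of
  the stabilizer.\<close>

lemma card_auts_split:
  fixes k :: nat
  assumes unif: "uniformizer P t s" and P: "P \<in> primes" and u: "u \<notin> P"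
    and B: "type_module (B :: ('a, 'b, 'm) module_scheme)" "finite (carrier B)"
  defines "A \<equiv> cyclic_mod (prime_power P (Suc k))"
  defines "M \<equiv> prod_mod A B"
  assumes kill: "kills (u * t ^ Suc k) M"
  shows "card (isos M M) = (card (torsion M P (Suc k)) - card (torsion M P k)) * (card (homs B A) * card (isos B B))"
proof -
  interpret uniformizer P t s by fact
  interpret B: type_module B by fact
  let ?I = "prime_power P (Suc k)"
  note I = is_ideal_prime_power[of "Suc k"]
  have A: "type_module A" unfolding A_def by (rule type_module_cyclic_mod[OF I])
  interpret A: type_module A by (rule A)
  have M: "type_module M" unfolding M_def by (rule type_module_prod_mod[OF A B(1)])
  interpret M: type_module M by (rule M)
  have finA: "finite (carrier A)" using residues_prime_power by (simp add: A_def)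
  then have finM: "finite (carrier M)" using B by (simp add: M_def)
  define a0 where "a0 = residue_rep ?I 1"
  define e where "e = (a0, \<zero>\<^bsub>B\<^esub>)"
  have a0: "a0 \<in> carrier A" by (simp add: a0_def A_def)
  have eM: "e \<in> carrier M" using a0 by (simp add: e_def M_def)
  have a0_mult: "r \<odot>\<^bsub>A\<^esub> a0 = residue_rep ?I r" for r
  proof -
    have "r * a0 - r \<in> ?I" using is_ideal_mult[OF I residue_rep_diff[OF I, of 1], of r] by (simp add: a0_def algebra_simps)
    then show ?thesis by (simp add: A_def residue_rep_eq_iff[OF I])
  qed
  have e_ann: "r \<odot>\<^bsub>M\<^esub> e = \<zero>\<^bsub>M\<^esub> \<longleftrightarrow> r \<in> ?I" for r
    by (simp add: M_def e_def a0_mult) (simp add: A_def residue_rep_eq_iff[OF I])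
  let ?T = "torsion M P (Suc k) - torsion M P k"
  have f_e: "f e \<in> ?T" if "f \<in> isos M M" for f
  proof -
    note hom = isos_homs[OF that]
    have inj: "inj_on f (carrier M)" using isos_bij[OF that] by (simp add: bij_betw_def)
    have ann: "r \<odot>\<^bsub>M\<^esub> f e = \<zero>\<^bsub>M\<^esub> \<longleftrightarrow> r \<in> ?I" for r
      using homs_smult[OF hom eM, of r] homs_zero[OF M M hom] e_ann[of r]
        inj_on_eq_iff[OF inj, of "r \<odot>\<^bsub>M\<^esub> e" "\<zero>\<^bsub>M\<^esub>"] eM by auto
    have "t ^ k * 1 \<notin> prime_power P (k + 1)" unfolding t_mult_iff using one_notin by (simp add: prime_power_1)
    then have "t ^ k \<odot>\<^bsub>M\<^esub> f e \<noteq> \<zero>\<^bsub>M\<^esub>" unfolding ann by simp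
    moreover have "t ^ k \<in> prime_power P k" using t_power_in[of 1 k] by simp
    ultimately have "f e \<notin> torsion M P k" by (auto simp: torsion_def)
    then show ?thesis using ann homs_closed[OF hom eM] by (simp add: torsion_def)
  qed
  \<comment> \<open>Transitivity: \<open>y\<close> also generates a direct summand isomorphic to
    \<open>A\<close>. Its complement \<open>N\<close> has the type of \<open>B\<close>, since types
    cancel, and combining the isomorphisms of both summands gives an automorphism
    \<open>?\<psi>\<close> that takes \<open>e\<close> to \<open>y\<close>.\<close>
  have stab: "card {f \<in> isos M M. f e = y} = card (homs B A) * card (isos B B)" if y: "y \<in> ?T" for y
  proof -
    obtain N f where N: "submod N M" and f: "f \<in> isos (prod_mod A (M\<lparr>carrier := N\<rparr>)) M"
      and fe: "f (a0, \<zero>\<^bsub>M\<^esub>) = y"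
      using split_off[OF M finM unif P u kill, of y] y unfolding A_def a0_def by blast
    have aN: "type_module (M\<lparr>carrier := N\<rparr>)" by (rule M.type_module_submod[OF N])
    have finN: "finite N" using N finM by (auto simp: submod_def intro: finite_subset)
    obtain Z where Z: "has_type (M\<lparr>carrier := N\<rparr>) Z" using has_type_exists[OF aN] finN by auto
    obtain Z' where Z': "has_type B Z'" using has_type_exists[OF B] .
    have "has_type M ({#(P, Suc k)#} + Z)"
      by (rule has_type_split[OF M P aN Z]) (use f in \<open>auto simp: isomorphic_def A_def\<close>)
    moreover have "has_type M ({#(P, Suc k)#} + Z')"
      by (rule has_type_split[OF M P B(1) Z'])
        (use isomorphic_refl[OF M] in \<open>simp add: M_def A_def\<close>)
    ultimately have "{#(P, Suc k)#} + Z = {#(P, Suc k)#} + Z'" by (rule has_type_unique)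
    then have "Z = Z'" by simp
    then have "isomorphic B (M\<lparr>carrier := N\<rparr>)"
      using has_type_imp_isomorphic[OF B aN _ Z'] Z finN by simp
    then obtain h where h: "h \<in> isos B (M\<lparr>carrier := N\<rparr>)" by (auto simp: isomorphic_def)
    note hh = isos_homs[OF h]
    let ?g = "restrict (map_prod id h) (carrier A \<times> carrier B)"
    have g: "?g \<in> isos M (prod_mod A (M\<lparr>carrier := N\<rparr>))"
      unfolding isos_def
    proof (intro CollectI conjI homsI)
      have "bij_betw (map_prod id h) (carrier A \<times> carrier B) (carrier A \<times> carrier (M\<lparr>carrier := N\<rparr>))"
        using isos_bij[OF h] by (intro bij_betw_map_prod) auto
      then show "bij_betw ?g (carrier M) (carrier (prod_mod A (M\<lparr>carrier := N\<rparr>)))"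
        by (simp add: bij_betw_def M_def)
    qed (use homs_closed[OF hh] homs_add[OF hh] homs_smult[OF hh] in \<open>auto simp: M_def\<close>)
    let ?\<psi> = "compose (carrier M) f ?g"
    have \<psi>: "?\<psi> \<in> isos M M" by (rule isos_compose[OF M g f])
    have \<psi>e: "?\<psi> e = y"
      using eM a0 fe homs_zero[OF B(1) aN hh] by (simp add: compose_def e_def M_def)
    have inj: "inj_on ?\<psi> (carrier M)" using isos_bij[OF \<psi>] by (simp add: bij_betw_def)
    \<comment> \<open>The automorphisms that send \<open>e\<close> to \<open>y\<close> form a coset
      of the stabilizer of \<open>e\<close>.\<close>
    have "bij_betw (\<lambda>g. compose (carrier M) ?\<psi> g) {g \<in> isos M M. g e = e} {f \<in> isos M M. f e = y}"
    proof -
      note b = card_homs_postcompose(2)[OF M M \<psi>]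
      have iff: "compose (carrier M) ?\<psi> g e = y \<longleftrightarrow> g e = e" if "g \<in> isos M M" for g
        using inj_on_eq_iff[OF inj homs_closed[OF isos_homs[OF that] eM] eM] \<psi>e eM
        by (simp add: compose_eq)
      have "compose (carrier M) ?\<psi> ` {g \<in> isos M M. g e = e} = {f \<in> isos M M. f e = y}"
      proof safe
        fix g assume g: "g \<in> isos M M" "g e = e"
        show "compose (carrier M) ?\<psi> g \<in> isos M M" using b g by (auto simp: bij_betw_def)
        show "compose (carrier M) ?\<psi> g e = y" using iff g by blast
      next
        fix f assume f: "f \<in> isos M M" "y = f e"
        then have "f \<in> compose (carrier M) ?\<psi> ` isos M M" using b by (simp add: bij_betw_def)
        then obtain g where "g \<in> isos M M" "f = compose (carrier M) ?\<psi> g" by blast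
        then show "f \<in> compose (carrier M) ?\<psi> ` {g \<in> isos M M. g e = e}" using iff f by auto
      qed
      then show ?thesis using b by (auto simp: bij_betw_def intro: inj_on_subset)
    qed
    from bij_betw_same_card[OF this, symmetric]
    have "card {f \<in> isos M M. f e = y} = card {g \<in> isos M M. g e = e}" .
    also have "\<dots> = card (homs B A) * card (isos B B)"
      unfolding M_def e_def
    proof (rule card_isos_stabilizer[OF A B(1) finA B(2) a0])
      fix a assume "a \<in> carrier A"
      then have "a = residue_rep ?I a" using residue_rep_residue[OF I, of a] by (simp add: A_def)
      then show "\<exists>r. a = r \<odot>\<^bsub>A\<^esub> a0" unfolding a0_mult by blast
    qed
    finally show ?thesis .
  qed
  have finT: "finite (torsion M P i)" for i using finM by (auto simp: torsion_def)
  have "card (isos M M) = (\<Sum>y\<in>?T. card {f \<in> isos M M. f e = y})"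
    using sum.group[of "isos M M" ?T "\<lambda>f. f e" "\<lambda>_. 1::nat"] f_e finT finite_isos[OF finM finM]
    by (simp add: image_subset_iff)
  also have "\<dots> = card ?T * (card (homs B A) * card (isos B B))" by (simp add: stab)
  also have "card ?T = card (torsion M P (Suc k)) - card (torsion M P k)"
    using torsion_mono[OF P, of k "Suc k" M] finT by (simp add: card_Diff_subset)
  finally show ?thesis .
qed

definition type_weight :: "('a set \<times> nat) multiset \<Rightarrow> real" where
  "type_weight Y = mset_prod (\<lambda>p. q_weight (card (residues (fst p)))) Y"

text \<open>Splitting off \<open>A\<close> multiplies the number of endomorphisms by
  \<open>|M[P ^ (k + 1)]| * |Hom(B, A)|\<close> and that of automorphisms by
  \<open>(|M[P ^ (k + 1)]| - |M[P ^ k]|) * |Hom(B, A)|\<close>. The quotient of the two torsion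
  sizes is \<open>q ^ m\<close>, where \<open>m\<close> is the multiplicity of
  \<open>(P, k + 1)\<close>, so the ratio gains the factor
  \<open>1 / (1 - q ^ (-m))\<close>.\<close>

lemma card_homs_isos:
  assumes "type_module (M :: ('a, 'b, 'm) module_scheme)" "finite (carrier M)" "has_type M Y"
  shows "real (card (homs M M)) = real (card (isos M M)) * type_weight Y"
  using assms
proof (induction arbitrary: Y rule: finite_module_induct)
  case (zero M)
  interpret type_module M by fact
  have "torsion M P i = {\<zero>\<^bsub>M\<^esub>}" for P i using zero by (auto simp: torsion_def)
  then have "has_type M {#}" by (simp add: has_type_def tcount_def)
  then have "Y = {#}" using has_type_unique zero by blast
  have "(\<lambda>x\<in>carrier M. \<zero>\<^bsub>M\<^esub>) \<in> homs M M"
    by (rule homsI) auto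
  then have "(\<lambda>x\<in>carrier M. \<zero>\<^bsub>M\<^esub>) \<in> isos M M"
    unfolding isos_def zero(2) bij_betw_def by simp
  moreover have "f = (\<lambda>x\<in>carrier M. \<zero>\<^bsub>M\<^esub>)" if "f \<in> homs M M" for f
    by (rule extensionalityI[of _ "carrier M"])
      (use zero(2) homs_ext[OF that] homs_closed[OF that] in auto)
  ultimately have "homs M M = {\<lambda>x\<in>carrier M. \<zero>\<^bsub>M\<^esub>}" "isos M M = {\<lambda>x\<in>carrier M. \<zero>\<^bsub>M\<^esub>}"
    using isos_homs by blast+
  then show ?case using \<open>Y = {#}\<close> by (simp add: type_weight_def mset_prod_def)
next
  case (split M N P k u t s)
  interpret uniformizer P t s by fact
  define B where "B = M\<lparr>carrier := N\<rparr>"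
  define A where "A = cyclic_mod (prime_power P (Suc k))"
  define L where "L = prod_mod A B"
  define q where "q = card (residues P)"
  have q: "q > 1" using card_residues_gt_1 by (simp add: q_def)
  note M = split(1)
  have B: "type_module B" "finite (carrier B)" using split by (auto simp: B_def)
  have A: "type_module A" unfolding A_def by (rule type_module_cyclic_mod[OF is_ideal_prime_power])
  have L: "type_module L" unfolding L_def by (rule type_module_prod_mod[OF A B(1)])
  have finL: "finite (carrier L)" using residues_prime_power B by (simp add: L_def A_def)
  have iso: "isomorphic L M" using split by (simp add: L_def A_def B_def)
  have kill: "kills (u * t ^ Suc k) L" using kills_isomorphic[OF L M iso] split by blast
  obtain Z where Z: "has_type B Z" using has_type_exists[OF B] .
  have "has_type M ({#(P, Suc k)#} + Z)"
    using has_type_split[OF M split(3) B(1) Z] iso by (simp add: L_def A_def)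
  then have Y: "Y = {#(P, Suc k)#} + Z" using has_type_unique split by blast
  have tL: "has_type L Y" using has_type_isomorphic[OF M L isomorphic_sym[OF L iso]] split by blast
  have tor: "card (torsion L P i) = q ^ tcount Y P i" for i
    using tL split(3) by (simp add: has_type_def q_def)
  \<comment> \<open>No summand at \<open>P\<close> has exponent above \<open>Suc k\<close>, so
    \<open>tcount\<close> is constant from there on and its second difference reduces to a first
    difference.\<close>
  have "card (torsion L P (Suc (Suc k))) = card (torsion L P (Suc k))"
    using torsion_stable[OF L split(4,3,5) kill, of "Suc (Suc k)"] by simp
  then have "tcount Y P (Suc (Suc k)) = tcount Y P (Suc k)" unfolding tor using q by simp
  then have m: "tcount Y P (Suc k) = tcount Y P k + count Y (P, Suc k)"
    using tcount_second_difference[of Y P k] by simp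
  define m where "m = Suc (count Z (P, Suc k))"
  have m': "tcount Y P (Suc k) = tcount Y P k + m" using m by (simp add: Y m_def)
  define c where "c = real (q ^ tcount Y P k)"
  define h where "h = real (card (homs B A))"
  have qm: "real q ^ m > 1" using q by (intro one_less_power) (auto simp: m_def)
  have "card (homs L L) = (card (homs A L)) * (card (homs B A) * card (homs B B))"
    unfolding L_def using card_homs_prod_mod_left[OF A B(1) type_module_prod_mod[OF A B(1)]]
      card_homs_prod_mod_right[OF A B(1) B(1)] by simp
  also have "card (homs A L) = card (torsion L P (Suc k))"
    unfolding A_def using card_homs_cyclic_mod[OF is_ideal_prime_power L] by (simp add: torsion_def)
  finally have 1: "real (card (homs L L)) = c * real q ^ m * (h * real (card (homs B B)))"
    by (simp add: tor m' c_def h_def power_add)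
  have "card (isos L L) = (card (torsion L P (Suc k)) - card (torsion L P k)) * (card (homs B A) * card (isos B B))"
    unfolding L_def A_def by (rule card_auts_split[OF split(4,3,5) B kill[unfolded L_def A_def]])
  then have "card (isos L L) = (q ^ tcount Y P (Suc k) - q ^ tcount Y P k) * (card (homs B A) * card (isos B B))"
    by (simp only: tor)
  moreover have "q ^ tcount Y P k \<le> q ^ tcount Y P (Suc k)" using q m' by (intro power_increasing) auto
  ultimately have 2: "real (card (isos L L)) = c * (real q ^ m - 1) * (h * real (card (isos B B)))"
    by (simp add: m' c_def h_def power_add of_nat_diff algebra_simps)
  have "type_weight Y * q_weight q (m - 1) = type_weight Z * q_weight q m"
    using mset_prod_add_mset[of "\<lambda>p. q_weight (card (residues (fst p)))" "(P, Suc k)" Z]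
    by (simp add: type_weight_def Y q_def m_def)
  also have "q_weight q m = q_weight q (m - 1) / (1 - 1 / real q ^ m)"
    using q_weight_Suc[of q "m - 1"] by (simp add: m_def)
  finally have 3: "type_weight Y = type_weight Z / (1 - 1 / real q ^ m)"
    using q_weight_pos[OF q, of "m - 1"] by (metis less_irrefl mult_right_cancel times_divide_eq_left times_divide_eq_right)
  have IH: "real (card (homs B B)) = real (card (isos B B)) * type_weight Z"
    using split Z by (simp add: B_def)
  have "real (card (homs L L)) = real (card (isos L L)) * type_weight Y"
    unfolding 1 2 3 IH using qm q by (simp add: field_simps)
  then show ?case using card_homs_isomorphic[OF L M L iso iso] by simp
qed

end

section \<open>Modules over the polynomial ring\<close>

definition restrict_scalars :: "('a::idom poly, 'b, 'm) module_scheme \<Rightarrow> ('a, 'b) module" where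
  "restrict_scalars M = \<lparr>carrier = carrier M, monoid.mult = undefined, one = undefined,
     ring.zero = \<zero>\<^bsub>M\<^esub>, add = add M, module.smult = (\<lambda>r x. [:r:] \<odot>\<^bsub>M\<^esub> x)\<rparr>"

text \<open>Horner evaluation of \<open>p\<close> at \<open>\<phi>\<close>, applied to
  \<open>x\<close>; its recursion matches induction on \<open>pCons\<close>.\<close>

definition poly_act :: "('a::idom, 'b, 'm) module_scheme \<Rightarrow> ('b \<Rightarrow> 'b) \<Rightarrow> 'a poly \<Rightarrow> 'b \<Rightarrow> 'b" where
  "poly_act D \<phi> p x = fold_coeffs (\<lambda>a y. a \<odot>\<^bsub>D\<^esub> x \<oplus>\<^bsub>D\<^esub> \<phi> y) p \<zero>\<^bsub>D\<^esub>"

definition with_endo :: "('a::idom, 'b, 'm) module_scheme \<Rightarrow> ('b \<Rightarrow> 'b) \<Rightarrow> ('a poly, 'b) module" where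
  "with_endo D \<phi> = \<lparr>carrier = carrier D, monoid.mult = undefined, one = undefined,
     ring.zero = \<zero>\<^bsub>D\<^esub>, add = add D, module.smult = poly_act D \<phi>\<rparr>"

lemma restrict_scalars_simps [simp]:
  "carrier (restrict_scalars M) = carrier M" "\<zero>\<^bsub>restrict_scalars M\<^esub> = \<zero>\<^bsub>M\<^esub>"
  "x \<oplus>\<^bsub>restrict_scalars M\<^esub> y = x \<oplus>\<^bsub>M\<^esub> y" "r \<odot>\<^bsub>restrict_scalars M\<^esub> x = [:r:] \<odot>\<^bsub>M\<^esub> x"
  by (simp_all add: restrict_scalars_def)

lemma with_endo_simps [simp]:
  "carrier (with_endo D \<phi>) = carrier D" "\<zero>\<^bsub>with_endo D \<phi>\<^esub> = \<zero>\<^bsub>D\<^esub>"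
  "x \<oplus>\<^bsub>with_endo D \<phi>\<^esub> y = x \<oplus>\<^bsub>D\<^esub> y" "p \<odot>\<^bsub>with_endo D \<phi>\<^esub> x = poly_act D \<phi> p x"
  by (simp_all add: with_endo_def)

lemma type_module_restrict_scalars:
  fixes M :: "('a::idom poly, 'b, 'm) module_scheme"
  assumes "type_module M" shows "type_module (restrict_scalars M)"
proof -
  interpret type_module M by fact
  have "[:a + b:] = [:a:] + [:b:]" "[:a * b:] = [:a:] * [:b:]" for a b :: 'a by simp_all
  then show ?thesis
    by unfold_locales
      (auto simp: smult_l_distr smult_r_distr smult_assoc add_assoc pCons_one intro: add_comm
        simp del: add_pCons mult_pCons_left mult_pCons_right)
qed

context
  fixes D :: "('a::idom, 'b, 'm) module_scheme" (structure) and \<phi>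
  assumes D: "type_module D" and \<phi>: "\<phi> \<in> homs D D"
begin

interpretation type_module D by (rule D)

lemma poly_act_0 [simp]: "poly_act D \<phi> 0 x = \<zero>"
  by (simp add: poly_act_def)

lemma poly_act_pCons [simp]:
  "x \<in> carrier D \<Longrightarrow> poly_act D \<phi> (pCons a p) x = a \<odot> x \<oplus> \<phi> (poly_act D \<phi> p x)"
  using homs_zero[OF D D \<phi>] by (cases "p = 0 \<and> a = 0") (auto simp: poly_act_def)

lemma poly_act_closed [simp]: "x \<in> carrier D \<Longrightarrow> poly_act D \<phi> p x \<in> carrier D"
  by (induction p) (auto simp: homs_closed[OF \<phi>])

lemma type_module_with_endo: "type_module (with_endo D \<phi>)"
proof -
  have cl: "x \<in> carrier D \<Longrightarrow> \<phi> x \<in> carrier D" for x by (rule homs_closed[OF \<phi>])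
  have add: "poly_act D \<phi> (p + q) x = poly_act D \<phi> p x \<oplus> poly_act D \<phi> q x" if "x \<in> carrier D" for p q x
    using that by (induction p q rule: poly_induct2) (auto simp: cl smult_l_distr homs_add[OF \<phi>] madd_ac)
  have add': "poly_act D \<phi> p (x \<oplus> y) = poly_act D \<phi> p x \<oplus> poly_act D \<phi> p y"
    if "x \<in> carrier D" "y \<in> carrier D" for p x y
    using that by (induction p) (auto simp: cl smult_r_distr homs_add[OF \<phi>] madd_ac)
  have sm: "poly_act D \<phi> (Polynomial.smult a p) x = a \<odot> poly_act D \<phi> p x" if "x \<in> carrier D" for a p x
    using that by (induction p) (auto simp: cl smult_r_distr smult_assoc homs_smult[OF \<phi>])
  have mult: "poly_act D \<phi> (p * q) x = poly_act D \<phi> p (poly_act D \<phi> q x)" if "x \<in> carrier D" for p q x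
    using that by (induction p) (auto simp: cl sm add)
  show ?thesis
    by unfold_locales (auto simp: add add' mult madd_ac one_pCons homs_zero[OF D D \<phi>])
qed

text \<open>\<open>S[T]\<close> is generated over \<open>S\<close> by \<open>T\<close>, so a map
  that is linear over \<open>S\<close> and compatible with \<open>T\<close> is linear over all
  polynomials.\<close>

lemma with_endo_isos_iff:
  assumes N: "type_module (N :: ('a poly, 'c, 'n) module_scheme)"
  shows "f \<in> isos (with_endo D \<phi>) N \<longleftrightarrow>
    f \<in> isos D (restrict_scalars N) \<and> (\<forall>x\<in>carrier D. f (\<phi> x) = [:0, 1:] \<odot>\<^bsub>N\<^esub> f x)"
proof -
  interpret N: type_module N by fact
  have cl: "x \<in> carrier D \<Longrightarrow> \<phi> x \<in> carrier D" for x by (rule homs_closed[OF \<phi>])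
  have "f \<in> homs (with_endo D \<phi>) N \<longleftrightarrow>
    f \<in> homs D (restrict_scalars N) \<and> (\<forall>x\<in>carrier D. f (\<phi> x) = [:0, 1:] \<odot>\<^bsub>N\<^esub> f x)"
  proof
    assume f: "f \<in> homs (with_endo D \<phi>) N"
    have "f \<in> homs D (restrict_scalars N)"
    proof (rule homsI)
      fix r x assume x: "x \<in> carrier D"
      show "f (r \<odot> x) = r \<odot>\<^bsub>restrict_scalars N\<^esub> f x"
        using homs_smult[OF f, of x "[:r:]"] x homs_zero[OF D D \<phi>] by simp
    qed (use homs_ext[OF f] homs_closed[OF f] homs_add[OF f] in auto)
    moreover have "f (\<phi> x) = [:0, 1:] \<odot>\<^bsub>N\<^esub> f x" if "x \<in> carrier D" for x
      using homs_smult[OF f, of x "[:0, 1:]"] that homs_zero[OF D D \<phi>] by (simp add: cl)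
    ultimately show "f \<in> homs D (restrict_scalars N) \<and> (\<forall>x\<in>carrier D. f (\<phi> x) = [:0, 1:] \<odot>\<^bsub>N\<^esub> f x)" by blast
  next
    assume *: "f \<in> homs D (restrict_scalars N) \<and> (\<forall>x\<in>carrier D. f (\<phi> x) = [:0, 1:] \<odot>\<^bsub>N\<^esub> f x)"
    then have f: "f \<in> homs D (restrict_scalars N)" and T: "\<And>x. x \<in> carrier D \<Longrightarrow> f (\<phi> x) = [:0, 1:] \<odot>\<^bsub>N\<^esub> f x"
      by auto
    have fcl: "f x \<in> carrier N" if "x \<in> carrier D" for x using homs_closed[OF f that] by simp
    show "f \<in> homs (with_endo D \<phi>) N"
    proof (rule homsI)
      fix p x assume "x \<in> carrier (with_endo D \<phi>)"
      then have x: "x \<in> carrier D" by simp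
      have "f (poly_act D \<phi> p x) = p \<odot>\<^bsub>N\<^esub> f x"
      proof (induction p)
        case 0
        then show ?case using homs_zero[OF D type_module_restrict_scalars[OF N] f] x by (simp add: fcl)
      next
        case (pCons a p)
        have "f (poly_act D \<phi> (pCons a p) x) = [:a:] \<odot>\<^bsub>N\<^esub> f x \<oplus>\<^bsub>N\<^esub> [:0, 1:] \<odot>\<^bsub>N\<^esub> (p \<odot>\<^bsub>N\<^esub> f x)"
          using x homs_add[OF f, of "a \<odot> x" "\<phi> (poly_act D \<phi> p x)"] homs_smult[OF f, of x a]
          by (simp add: cl T pCons.IH)
        also have "\<dots> = ([:a:] + [:0, 1:] * p) \<odot>\<^bsub>N\<^esub> f x"
          using fcl[OF x] by (simp only: N.smult_l_distr N.smult_assoc)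
        also have "[:a:] + [:0, 1:] * p = pCons a p" by simp
        finally show ?case .
      qed
      then show "f (p \<odot>\<^bsub>with_endo D \<phi>\<^esub> x) = p \<odot>\<^bsub>N\<^esub> f x" by simp
    qed (use homs_ext[OF f] homs_closed[OF f] homs_add[OF f] in auto)
  qed
  then show ?thesis by (auto simp: isos_def)
qed

end

text \<open>
  Transporting multiplication by \<open>T\<close> along an isomorphism \<open>D \<cong> N\<close> of modules over \<open>S\<close> gives an
  endomorphism of \<open>D\<close>, and the isomorphisms that give the same endomorphism form a torsor under
  \<open>Aut N\<close>.
\<close>

lemma card_endos_of_class:
  assumes D: "type_module (D :: ('a::idom, 'b, 'm) module_scheme)" and finD: "finite (carrier D)"
    and N: "type_module (N :: ('a poly, 'c, 'n) module_scheme)"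
    and iso: "isomorphic D (restrict_scalars N)"
  shows "card {\<phi> \<in> homs D D. isomorphic (with_endo D \<phi>) N} * card (isos N N) = card (isos D D)"
proof -
  interpret D: type_module D by fact
  interpret N: type_module N by fact
  note RN = type_module_restrict_scalars[OF N]
  have finN: "finite (carrier N)" using isomorphic_finite[OF iso] finD by simp
  let ?I = "\<lambda>\<phi>. isos (with_endo D \<phi>) N"
  have U: "isos D (restrict_scalars N) = (\<Union>\<phi>\<in>homs D D. ?I \<phi>)"
  proof
    show "(\<Union>\<phi>\<in>homs D D. ?I \<phi>) \<subseteq> isos D (restrict_scalars N)"
      using with_endo_isos_iff[OF D _ N] by blast
    show "isos D (restrict_scalars N) \<subseteq> (\<Union>\<phi>\<in>homs D D. ?I \<phi>)"
    proof
      fix g assume g: "g \<in> isos D (restrict_scalars N)"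
      note hom = isos_homs[OF g]
      let ?h = "inv_into (carrier D) g"
      have img: "g ` carrier D = carrier N" and inj: "inj_on g (carrier D)"
        using isos_bij[OF g] by (auto simp: bij_betw_def)
      have gcl: "g x \<in> carrier N" if "x \<in> carrier D" for x using img that by auto
      have h: "?h y \<in> carrier D" "g (?h y) = y" if "y \<in> carrier N" for y
        using that img by (auto intro: inv_into_into f_inv_into_f)
      have hI: "?h y = x" if "x \<in> carrier D" "g x = y" for x y using that inj by auto
      define \<phi> where "\<phi> = (\<lambda>x\<in>carrier D. ?h ([:0, 1:] \<odot>\<^bsub>N\<^esub> g x))"
      have g\<phi>: "\<phi> x \<in> carrier D" "g (\<phi> x) = [:0, 1:] \<odot>\<^bsub>N\<^esub> g x" if "x \<in> carrier D" for x
        using that h gcl by (auto simp: \<phi>_def)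
      have eqI: "x = y" if "x \<in> carrier D" "y \<in> carrier D" "g x = g y" for x y
        using inj that by (auto dest: inj_onD)
      have "\<phi> \<in> homs D D"
      proof (rule homsI)
        fix x y assume xy: "x \<in> carrier D" "y \<in> carrier D"
        show "\<phi> (x \<oplus>\<^bsub>D\<^esub> y) = \<phi> x \<oplus>\<^bsub>D\<^esub> \<phi> y"
          by (rule eqI) (use xy g\<phi> gcl homs_add[OF hom] in \<open>auto simp: N.smult_r_distr\<close>)
      next
        fix r x assume x: "x \<in> carrier D"
        show "\<phi> (r \<odot>\<^bsub>D\<^esub> x) = r \<odot>\<^bsub>D\<^esub> \<phi> x"
          by (rule eqI) (use x g\<phi> gcl homs_smult[OF hom] in \<open>auto simp: N.smult_comm[of _ "[:0, 1:]"]\<close>)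
      qed (use g\<phi> in \<open>auto simp: \<phi>_def\<close>)
      moreover from this have "g \<in> ?I \<phi>" using with_endo_isos_iff[OF D _ N] g g\<phi> by blast
      ultimately show "g \<in> (\<Union>\<phi>\<in>homs D D. ?I \<phi>)" by blast
    qed
  qed
  have disj: "?I \<phi> \<inter> ?I \<psi> = {}" if "\<phi> \<in> homs D D" "\<psi> \<in> homs D D" "\<phi> \<noteq> \<psi>" for \<phi> \<psi>
  proof (rule ccontr)
    assume "?I \<phi> \<inter> ?I \<psi> \<noteq> {}"
    then obtain g where g: "g \<in> ?I \<phi>" "g \<in> ?I \<psi>" by blast
    have "inj_on g (carrier D)" using isos_bij[OF g(1)] by (simp add: bij_betw_def)
    moreover have "g (\<phi> x) = g (\<psi> x)" if "x \<in> carrier D" for x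
      using g that with_endo_isos_iff[OF D _ N] \<open>\<phi> \<in> homs D D\<close> \<open>\<psi> \<in> homs D D\<close> by metis
    ultimately have "\<phi> x = \<psi> x" if "x \<in> carrier D" for x
      using that homs_closed[OF \<open>\<phi> \<in> homs D D\<close> that] homs_closed[OF \<open>\<psi> \<in> homs D D\<close> that] by (meson inj_onD)
    then have "\<phi> = \<psi>" using homs_ext that by (metis extensionalityI)
    then show False using that by simp
  qed
  have "card (isos D D) = card (isos D (restrict_scalars N))"
    by (rule card_homs_isomorphic(2)[OF D D D isomorphic_refl[OF D] iso])
  also have "\<dots> = (\<Sum>\<phi>\<in>homs D D. card (?I \<phi>))"
    unfolding U by (rule card_UN_disjoint) (use finD finN disj in \<open>auto intro: finite_homs finite_isos\<close>)
  also have "\<dots> = (\<Sum>\<phi>\<in>homs D D. if isomorphic (with_endo D \<phi>) N then card (isos N N) else 0)"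
  proof (rule sum.cong[OF refl])
    fix \<phi> assume \<phi>: "\<phi> \<in> homs D D"
    show "card (?I \<phi>) = (if isomorphic (with_endo D \<phi>) N then card (isos N N) else 0)"
      using card_homs_isomorphic(2)[OF type_module_with_endo[OF D \<phi>] N N _ isomorphic_refl[OF N]]
      by (auto simp: isomorphic_def)
  qed
  also have "\<dots> = card {\<phi> \<in> homs D D. isomorphic (with_endo D \<phi>) N} * card (isos N N)"
    using finite_homs[OF finD finD] by (simp add: sum.If_cases Int_def)
  finally show ?thesis by simp
qed

section \<open>The zeta function of the polynomial ring as a weighted sum over types\<close>

context zeta_domain
begin

definition types_of_norm :: "nat \<Rightarrow> ('a set \<times> nat) multiset set" where
  "types_of_norm n = {Y. set_mset Y \<subseteq> prime_exps \<and> module_norm Y = n}"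

lemma module_norm_add_mset:
  "module_norm (add_mset p Y) = card (residues (fst p)) ^ snd p * module_norm Y"
  by (simp add: module_norm_def split_beta)

lemma module_norm_ge:
  "set_mset Y \<subseteq> prime_exps \<Longrightarrow> 2 ^ size Y \<le> module_norm Y"
proof (induction Y)
  case (add p Y)
  then have p: "fst p \<in> primes" "snd p \<ge> 1" by (auto simp: prime_exps_def)
  have "2 ^ 1 \<le> card (residues (fst p)) ^ 1" using residues_prime_gt_1[OF p(1)] by simp
  also have "\<dots> \<le> card (residues (fst p)) ^ snd p"
    using residues_prime_gt_1[OF p(1)] p(2) by (intro power_increasing) auto
  finally show ?case using add by (simp add: module_norm_add_mset mult_le_mono)
qed (simp add: module_norm_def)

lemma module_norm_pos: "set_mset Y \<subseteq> prime_exps \<Longrightarrow> module_norm Y > 0"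
  using module_norm_ge[of Y] by (metis gr0I le_zero_eq power_not_zero zero_neq_numeral)

lemma module_norm_member:
  assumes Y: "set_mset Y \<subseteq> prime_exps" and p: "(P, e) \<in># Y"
  shows "card (residues P) \<le> module_norm Y" "e < module_norm Y"
proof -
  obtain Z where Z: "Y = add_mset (P, e) Z" using p by (meson mset_add)
  have P: "P \<in> primes" "e \<ge> 1" using Y p by (auto simp: prime_exps_def)
  note q = residues_prime_gt_1[OF P(1)]
  have "module_norm Z > 0" using Y Z by (intro module_norm_pos) auto
  then have 1: "card (residues P) ^ e \<le> module_norm Y" by (simp add: Z module_norm_add_mset)
  have "card (residues P) ^ 1 \<le> card (residues P) ^ e" using q P by (intro power_increasing) auto
  with 1 show "card (residues P) \<le> module_norm Y" by simp
  have "e < 2 ^ e" by simp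
  also have "\<dots> \<le> card (residues P) ^ e" using q by (intro power_mono) auto
  finally show "e < module_norm Y" using 1 by simp
qed

text \<open>A fixed norm bounds the number of summands, their exponents and the sizes of their
  residue fields, and only finitely many primes have a residue field of bounded size.\<close>

lemma finite_types_of_norm: "finite (types_of_norm n)"
proof -
  let ?A = "{P \<in> primes. card (residues P) \<le> n} \<times> {..n}"
  have A: "finite ?A" using finite_small_primes[of n] by (simp add: primes_def)
  have "types_of_norm n \<subseteq> mset ` {xs. set xs \<subseteq> ?A \<and> length xs \<le> n}"
  proof
    fix Y assume "Y \<in> types_of_norm n"
    then have Y: "set_mset Y \<subseteq> prime_exps" "module_norm Y = n" by (auto simp: types_of_norm_def)
    obtain xs where xs: "mset xs = Y" using ex_mset by blast
    have "size Y < 2 ^ size Y" by simp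
    then have "length xs \<le> n" using module_norm_ge[OF Y(1)] Y(2) xs by (metis size_mset less_imp_le le_trans)
    moreover have "set xs \<subseteq> ?A"
    proof
      fix p assume "p \<in> set xs"
      then have "(fst p, snd p) \<in># Y" using xs by auto
      then show "p \<in> ?A" using module_norm_member[OF Y(1), of "fst p" "snd p"] Y
        by (auto simp: prime_exps_def)
    qed
    ultimately show "Y \<in> mset ` {xs. set xs \<subseteq> ?A \<and> length xs \<le> n}" using xs by blast
  qed
  then show ?thesis using finite_lists_length_le[OF A] finite_surj by blast
qed

definition type_rep :: "('a set \<times> nat) multiset \<Rightarrow> ('a, nat) module" where
  "type_rep Y = (SOME D. type_module D \<and> finite (carrier D) \<and> has_type D Y)"

lemma type_rep:
  assumes "set_mset Y \<subseteq> prime_exps"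
  shows "type_module (type_rep Y)" "finite (carrier (type_rep Y))" "has_type (type_rep Y) Y"
proof -
  have "\<exists>D :: ('a, nat) module. type_module D \<and> finite (carrier D) \<and> has_type D Y"
    using has_type_nat[OF assms] by blast
  from someI_ex[OF this] show "type_module (type_rep Y)" "finite (carrier (type_rep Y))" "has_type (type_rep Y) Y"
    unfolding type_rep_def by auto
qed

text \<open>Double counting on the set \<open>\<Omega>\<close> of pairs \<open>(Y, \<phi>)\<close>
  with \<open>\<phi>\<close> an endomorphism of the chosen module of type \<open>Y\<close>, weighted
  by the inverse of the number of automorphisms of that module. Grouped by the class of the
  resulting \<open>S[T]\<close>-module \<open>N\<close>, \<open>card_endos_of_class\<close> gives
  \<open>1 / |Aut N|\<close>; grouped by \<open>Y\<close>, \<open>card_homs_isos\<close> gives the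
  type weight.\<close>

lemma module_zeta_poly:
  defines "R \<equiv> (type_ring :: 'a poly ring)"
  shows "finite (finite_module_classes R n)"
    and "module_zeta R n = complex_of_real (\<Sum>Y\<in>types_of_norm n. type_weight Y)"
proof -
  let ?a = "\<lambda>Y. 1 / real (card (isos (type_rep Y) (type_rep Y)))"
  define Mods where "Mods = finite_modules R n"
  define rel where "rel = {(M, N). M \<in> Mods \<and> N \<in> Mods \<and> module_isos R M N \<noteq> {}}"
  have Mods: "M \<in> Mods \<longleftrightarrow> type_module M \<and> finite (carrier M) \<and> card (carrier M) = n" for M
    by (simp add: Mods_def finite_modules_def R_def module_iff_type_module)
  have rel: "(M, N) \<in> rel \<longleftrightarrow> M \<in> Mods \<and> N \<in> Mods \<and> isomorphic M N" for M N
    by (simp add: rel_def R_def module_isos_type_ring isomorphic_def)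
  have classes: "finite_module_classes R n = Mods // rel"
    by (simp add: finite_module_classes_def rel_def Mods_def)
  have equiv: "equiv Mods rel"
  proof (rule equivI)
    show "rel \<subseteq> Mods \<times> Mods" using rel by auto
    show "refl_on Mods rel" using rel isomorphic_refl Mods by (auto simp: refl_on_def)
    show "sym rel" using rel isomorphic_sym Mods by (auto simp: sym_def)
    show "trans rel"
    proof (rule transI)
      fix L M N assume "(L, M) \<in> rel" "(M, N) \<in> rel"
      then show "(L, N) \<in> rel" using isomorphic_trans[of L M N] by (auto simp: rel Mods)
    qed
  qed
  define \<Omega> where "\<Omega> = Sigma (types_of_norm n) (\<lambda>Y. homs (type_rep Y) (type_rep Y))"
  define W where "W = (\<lambda>(Y, \<phi>). with_endo (type_rep Y) \<phi>)"
  define \<kappa> where "\<kappa> \<omega> = rel `` {W \<omega>}" for \<omega>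
  have finH: "finite (homs (type_rep Y) (type_rep Y))" if "Y \<in> types_of_norm n" for Y
    using type_rep(2)[of Y] that by (auto simp: types_of_norm_def intro: finite_homs)
  have fin\<Omega>: "finite \<Omega>" unfolding \<Omega>_def using finite_types_of_norm finH by (intro finite_SigmaI) auto
  have W: "W \<omega> \<in> Mods" if "\<omega> \<in> \<Omega>" for \<omega>
  proof -
    obtain Y \<phi> where \<omega>: "\<omega> = (Y, \<phi>)" "Y \<in> types_of_norm n" "\<phi> \<in> homs (type_rep Y) (type_rep Y)"
      using \<open>\<omega> \<in> \<Omega>\<close> by (auto simp: \<Omega>_def)
    then have Y: "set_mset Y \<subseteq> prime_exps" "module_norm Y = n" by (auto simp: types_of_norm_def)
    show ?thesis unfolding Mods
      using type_module_with_endo[OF type_rep(1)[OF Y(1)] \<omega>(3)] type_rep[OF Y(1)] has_type_card[OF type_rep[OF Y(1)]] Y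
      by (simp add: W_def \<omega>)
  qed
  have type_eq: "isomorphic (type_rep Y) (restrict_scalars N) \<longleftrightarrow> has_type (restrict_scalars N) Y"
    if "Y \<in> types_of_norm n" "N \<in> Mods" for Y N
  proof -
    have Y: "set_mset Y \<subseteq> prime_exps" using that by (auto simp: types_of_norm_def)
    have N: "type_module (restrict_scalars N)" "finite (carrier (restrict_scalars N))"
      using that Mods by (auto intro: type_module_restrict_scalars)
    show ?thesis
      using has_type_isomorphic[OF type_rep(1)[OF Y] N(1) _ type_rep(3)[OF Y]]
        has_type_imp_isomorphic[OF type_rep(1,2)[OF Y] N type_rep(3)[OF Y]] by blast
  qed
  \<comment> \<open>All pairs that yield \<open>N\<close> share one \<open>Y\<close>, the type of
    \<open>N\<close> as an \<open>S\<close>-module.\<close>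
  have fibre: "\<exists>Y\<in>types_of_norm n. {\<omega> \<in> \<Omega>. isomorphic (W \<omega>) N} =
      {Y} \<times> {\<phi> \<in> homs (type_rep Y) (type_rep Y). isomorphic (with_endo (type_rep Y) \<phi>) N} \<and>
      isomorphic (type_rep Y) (restrict_scalars N)"
    if N: "N \<in> Mods" for N
  proof -
    have aN: "type_module (restrict_scalars N)" "finite (carrier (restrict_scalars N))" "type_module N"
      using N Mods by (auto intro: type_module_restrict_scalars)
    obtain Y where Y: "has_type (restrict_scalars N) Y" "card (carrier N) = module_norm Y"
      using has_type_exists[OF aN(1,2)] by auto
    then have Yn: "Y \<in> types_of_norm n" using N Mods by (auto simp: types_of_norm_def has_type_def)
    have uniq: "Z = Y" if Z: "Z \<in> types_of_norm n" "\<phi> \<in> homs (type_rep Z) (type_rep Z)"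
      "isomorphic (with_endo (type_rep Z) \<phi>) N" for Z \<phi>
    proof -
      have Z': "set_mset Z \<subseteq> prime_exps" using Z by (auto simp: types_of_norm_def)
      have "isomorphic (type_rep Z) (restrict_scalars N)"
        using Z(3) with_endo_isos_iff[OF type_rep(1)[OF Z'] Z(2) aN(3)] by (auto simp: isomorphic_def)
      then show ?thesis using type_eq[OF Z(1) N] Y has_type_unique by blast
    qed
    have "{\<omega> \<in> \<Omega>. isomorphic (W \<omega>) N} =
      {Y} \<times> {\<phi> \<in> homs (type_rep Y) (type_rep Y). isomorphic (with_endo (type_rep Y) \<phi>) N}"
    proof (rule Set.set_eqI)
      fix \<omega> :: "('a set \<times> nat) multiset \<times> (nat \<Rightarrow> nat)"
      obtain Z \<phi> where \<omega>: "\<omega> = (Z, \<phi>)" by fastforce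
      show "\<omega> \<in> {\<omega> \<in> \<Omega>. isomorphic (W \<omega>) N} \<longleftrightarrow> \<omega> \<in>
        {Y} \<times> {\<phi> \<in> homs (type_rep Y) (type_rep Y). isomorphic (with_endo (type_rep Y) \<phi>) N}"
        using uniq[of Z \<phi>] Yn unfolding \<omega> \<Omega>_def W_def mem_Collect_eq mem_Sigma_iff by auto
    qed
    then show ?thesis by (intro bexI[OF _ Yn] conjI iffD2[OF type_eq[OF Yn N] Y(1)])
  qed
  have \<kappa>_iff: "\<kappa> \<omega> = rel `` {N} \<longleftrightarrow> isomorphic (W \<omega>) N" if "\<omega> \<in> \<Omega>" "N \<in> Mods" for \<omega> N
    using eq_equiv_class_iff[OF equiv W[OF that(1)] that(2)] W[OF that(1)] that(2) by (simp add: \<kappa>_def rel)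
  have count: "(\<Sum>(Y, \<phi>)\<in>{\<omega> \<in> \<Omega>. \<kappa> \<omega> = rel `` {N}}. ?a Y) = 1 / real (card (isos N N))"
    and ex: "\<exists>\<omega>\<in>\<Omega>. \<kappa> \<omega> = rel `` {N}" if N: "N \<in> Mods" for N
  proof -
    have aN: "type_module N" "finite (carrier N)" using N Mods by auto
    obtain Y where Y: "Y \<in> types_of_norm n" "isomorphic (type_rep Y) (restrict_scalars N)"
      and eq: "{\<omega> \<in> \<Omega>. isomorphic (W \<omega>) N} =
      {Y} \<times> {\<phi> \<in> homs (type_rep Y) (type_rep Y). isomorphic (with_endo (type_rep Y) \<phi>) N}"
      using fibre[OF N] by blast
    let ?D = "type_rep Y"
    let ?E = "{\<phi> \<in> homs ?D ?D. isomorphic (with_endo ?D \<phi>) N}"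
    have D: "type_module ?D" "finite (carrier ?D)" using Y type_rep[of Y] by (auto simp: types_of_norm_def)
    have cards: "card ?E * card (isos N N) = card (isos ?D ?D)"
      by (rule card_endos_of_class[OF D aN(1) Y(2)])
    have pos: "card (isos ?D ?D) > 0" "card (isos N N) > 0"
      using isos_id[OF D(1)] isos_id[OF aN(1)] finite_isos[OF D(2) D(2)] finite_isos[OF aN(2) aN(2)]
      by (auto simp: card_gt_0_iff)
    have set_eq: "{\<omega> \<in> \<Omega>. \<kappa> \<omega> = rel `` {N}} = {Y} \<times> ?E"
      unfolding eq[symmetric] using \<kappa>_iff N by blast
    have "(\<Sum>(Y, \<phi>)\<in>{\<omega> \<in> \<Omega>. \<kappa> \<omega> = rel `` {N}}. ?a Y)
      = real (card ?E) / real (card (isos ?D ?D))"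
      unfolding set_eq by (simp add: sum.cartesian_product[symmetric])
    also have "\<dots> = 1 / real (card (isos N N))"
      using pos unfolding cards[symmetric] by (simp add: field_simps)
    finally show "(\<Sum>(Y, \<phi>)\<in>{\<omega> \<in> \<Omega>. \<kappa> \<omega> = rel `` {N}}. ?a Y) = 1 / real (card (isos N N))" .
    have "?E \<noteq> {}" using cards pos by (metis card.empty less_irrefl mult_0)
    then have "{\<omega> \<in> \<Omega>. \<kappa> \<omega> = rel `` {N}} \<noteq> {}" unfolding set_eq by simp
    then show "\<exists>\<omega>\<in>\<Omega>. \<kappa> \<omega> = rel `` {N}" by blast
  qed
  have img: "\<kappa> ` \<Omega> = Mods // rel"
  proof
    show "\<kappa> ` \<Omega> \<subseteq> Mods // rel" using W by (auto simp: \<kappa>_def intro: quotientI)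
    show "Mods // rel \<subseteq> \<kappa> ` \<Omega>"
    proof
      fix C assume "C \<in> Mods // rel"
      then obtain N where "N \<in> Mods" "C = rel `` {N}" by (rule quotientE)
      then show "C \<in> \<kappa> ` \<Omega>" using ex[of N] by auto
    qed
  qed
  show "finite (finite_module_classes R n)" unfolding classes img[symmetric] using fin\<Omega> by simp
  \<comment> \<open>The chosen representative belongs to its class, so the count for the class may
    be evaluated at it.\<close>
  have some: "(SOME M. M \<in> C) \<in> Mods" "rel `` {SOME M. M \<in> C} = C" if C: "C \<in> Mods // rel" for C
  proof -
    have "(SOME M. M \<in> C) \<in> C" using in_quotient_imp_non_empty[OF equiv C] by (simp add: some_in_eq)
    moreover obtain N where N: "N \<in> Mods" "C = rel `` {N}" using C by (rule quotientE)
    ultimately have *: "(N, SOME M. M \<in> C) \<in> rel" by simp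
    show "(SOME M. M \<in> C) \<in> Mods" using * by (simp add: rel)
    show "rel `` {SOME M. M \<in> C} = C"
      by (rule trans[OF equiv_class_eq[OF equiv *, symmetric] N(2)[symmetric]])
  qed
  have "(\<Sum>C\<in>Mods // rel. 1 / real (card (isos (SOME M. M \<in> C) (SOME M. M \<in> C))))
    = (\<Sum>C\<in>\<kappa> ` \<Omega>. \<Sum>(Y, \<phi>)\<in>{\<omega> \<in> \<Omega>. \<kappa> \<omega> = C}. ?a Y)"
    unfolding img
  proof (rule sum.cong[OF refl])
    fix C assume C: "C \<in> Mods // rel"
    show "1 / real (card (isos (SOME M. M \<in> C) (SOME M. M \<in> C))) =
      (\<Sum>(Y, \<phi>)\<in>{\<omega> \<in> \<Omega>. \<kappa> \<omega> = C}. ?a Y)"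
      using count[OF some(1)[OF C]] unfolding some(2)[OF C] by simp
  qed
  also have "\<dots> = (\<Sum>(Y, \<phi>)\<in>\<Omega>. ?a Y)"
    by (rule sum.group) (use fin\<Omega> in auto)
  also have "\<dots> = (\<Sum>Y\<in>types_of_norm n. \<Sum>\<phi>\<in>homs (type_rep Y) (type_rep Y). ?a Y)"
    unfolding \<Omega>_def by (rule sum.Sigma[symmetric]) (use finite_types_of_norm finH in auto)
  also have "\<dots> = (\<Sum>Y\<in>types_of_norm n. type_weight Y)"
  proof (rule sum.cong[OF refl])
    fix Y assume "Y \<in> types_of_norm n"
    then have Y: "set_mset Y \<subseteq> prime_exps" by (auto simp: types_of_norm_def)
    have "card (isos (type_rep Y) (type_rep Y)) > 0"
      using isos_id[OF type_rep(1)[OF Y]] finite_isos[OF type_rep(2)[OF Y] type_rep(2)[OF Y]]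
      by (auto simp: card_gt_0_iff)
    then show "(\<Sum>\<phi>\<in>homs (type_rep Y) (type_rep Y). ?a Y) = type_weight Y"
      using card_homs_isos[OF type_rep[OF Y]] by simp
  qed
  finally have total: "(\<Sum>C\<in>Mods // rel. 1 / real (card (isos (SOME M. M \<in> C) (SOME M. M \<in> C)))) = (\<Sum>Y\<in>types_of_norm n. type_weight Y)" .
  have "module_zeta R n = complex_of_real (\<Sum>C\<in>Mods // rel. 1 / real (card (isos (SOME M. M \<in> C) (SOME M. M \<in> C))))"
    unfolding module_zeta_def classes by (simp add: R_def module_isos_type_ring)
  then show "module_zeta R n = complex_of_real (\<Sum>Y\<in>types_of_norm n. type_weight Y)"
    unfolding total .
qed

end

section \<open>Dirichlet series of multisets\<close>

lemma mset_prod_add_replicate: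
  assumes "\<And>p. g p 0 = 1" "p \<notin># Z"
  shows "mset_prod g (Z + replicate_mset c p) = mset_prod g Z * g p c"
proof -
  let ?A = "insert p (set_mset Z)"
  have "mset_prod g (Z + replicate_mset c p) = (\<Prod>x\<in>?A. g x (count (Z + replicate_mset c p) x))"
    by (rule mset_prod_superset) (use assms in \<open>auto split: if_splits\<close>)
  also have "\<dots> = g p c * (\<Prod>x\<in>set_mset Z. g x (count (Z + replicate_mset c p) x))"
    using assms by (simp add: not_in_iff)
  also have "(\<Prod>x\<in>set_mset Z. g x (count (Z + replicate_mset c p) x)) = mset_prod g Z"
    unfolding mset_prod_def by (rule prod.cong) (use assms in auto)
  finally show ?thesis by (simp add: mult.commute)
qed

lemma finite_submultisets: "finite {Z. Z \<subseteq># (Y :: 'b multiset)}"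
proof -
  have "{Z. Z \<subseteq># Y} \<subseteq> mset ` {xs. set xs \<subseteq> set_mset Y \<and> length xs \<le> size Y}"
  proof
    fix Z assume Z: "Z \<in> {Z. Z \<subseteq># Y}"
    obtain xs where "mset xs = Z" using ex_mset by blast
    moreover from this have "set xs = set_mset Z" "length xs = size Z" by auto
    ultimately show "Z \<in> mset ` {xs. set xs \<subseteq> set_mset Y \<and> length xs \<le> size Y}"
      using Z size_mset_mono[of Z Y] set_mset_mono[of Z Y] by (intro image_eqI[of _ _ xs]) auto
  qed
  then show ?thesis using finite_lists_length_le[of "set_mset Y" "size Y"] finite_surj by blast
qed

text \<open>A submultiset of \<open>Y\<close> is an independent choice of a multiplicity
  \<open>c \<le> count Y p\<close> at each point, so the sum of products factors into local
  convolutions.\<close>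

lemma sum_submultisets_mset_prod:
  fixes g h :: "'b \<Rightarrow> nat \<Rightarrow> 'c::comm_semiring_1"
  assumes g: "\<And>p. g p 0 = 1" and h: "\<And>p. h p 0 = 1"
  shows "(\<Sum>Z | Z \<subseteq># Y. mset_prod g Z * mset_prod h (Y - Z)) = mset_prod (\<lambda>p m. \<Sum>c\<le>m. g p c * h p (m - c)) Y"
proof (induction Y rule: multiset_replicate_induct)
  case empty
  then show ?case by (simp add: mset_prod_def)
next
  case (replicate V p n)
  let ?C = "\<lambda>p m. \<Sum>c\<le>m. g p c * h p (m - c)"
  have V: "p \<notin># Z" "p \<notin># V - Z" if "Z \<subseteq># V" for Z
    using replicate(1) that by (auto dest: mset_subset_eqD in_diffD)
  have diff: "V + replicate_mset n p - (Z + replicate_mset c p) = (V - Z) + replicate_mset (n - c) p"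
    if "Z \<subseteq># V" "c \<le> n" for Z c
  proof (rule multiset_eqI)
    fix x show "count (V + replicate_mset n p - (Z + replicate_mset c p)) x = count ((V - Z) + replicate_mset (n - c) p) x"
      using that mset_subset_eq_count[OF that(1), of x] by auto
  qed
  have "(\<Sum>Z | Z \<subseteq># V + replicate_mset n p. mset_prod g Z * mset_prod h (V + replicate_mset n p - Z))
    = (\<Sum>(Z, c)\<in>{Z. Z \<subseteq># V} \<times> {..n}. (mset_prod g Z * mset_prod h (V - Z)) * (g p c * h p (n - c)))"
  proof (rule sum.reindex_bij_witness[of _ "\<lambda>(Z, c). Z + replicate_mset c p"
        "\<lambda>Z. (filter_mset (\<lambda>x. x \<noteq> p) Z, count Z p)"])
    fix Z assume Z: "Z \<in> {Z. Z \<subseteq># V + replicate_mset n p}"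
    have eq: "filter_mset (\<lambda>x. x \<noteq> p) Z + replicate_mset (count Z p) p = Z"
      by (rule multiset_eqI) simp
    then show "(\<lambda>(Z, c). Z + replicate_mset c p) (filter_mset (\<lambda>x. x \<noteq> p) Z, count Z p) = Z" by simp
    have cnt: "count Z x \<le> count V x + (if x = p then n else 0)" for x
      using mset_subset_eq_count[of Z "V + replicate_mset n p" x] Z by (simp split: if_splits)
    have mem: "filter_mset (\<lambda>x. x \<noteq> p) Z \<subseteq># V" "count Z p \<le> n"
      using cnt cnt[of p] replicate(1) by (auto simp: subseteq_mset_def not_in_iff split: if_splits)
        (metis add.right_neutral)
    then show "(filter_mset (\<lambda>x. x \<noteq> p) Z, count Z p) \<in> {Z. Z \<subseteq># V} \<times> {..n}" by simp
    have "mset_prod g Z = mset_prod g (filter_mset (\<lambda>x. x \<noteq> p) Z) * g p (count Z p)"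
      using mset_prod_add_replicate[of g p "filter_mset (\<lambda>x. x \<noteq> p) Z" "count Z p"] g eq by simp
    moreover have "mset_prod h (V + replicate_mset n p - Z) =
        mset_prod h (V - filter_mset (\<lambda>x. x \<noteq> p) Z) * h p (n - count Z p)"
      using diff[OF mem] mset_prod_add_replicate[of h p "V - filter_mset (\<lambda>x. x \<noteq> p) Z" "n - count Z p"]
        h V(2)[OF mem(1)] eq by simp
    ultimately show "(case (filter_mset (\<lambda>x. x \<noteq> p) Z, count Z p) of
          (Z, c) \<Rightarrow> mset_prod g Z * mset_prod h (V - Z) * (g p c * h p (n - c)))
        = mset_prod g Z * mset_prod h (V + replicate_mset n p - Z)"
      by (simp add: ac_simps)
  next
    fix q assume q: "q \<in> {Z. Z \<subseteq># V} \<times> {..n}"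
    obtain Z c where Zc: "q = (Z, c)" "Z \<subseteq># V" "c \<le> n" using q by auto
    have "filter_mset (\<lambda>x. x \<noteq> p) Z = Z" "filter_mset (\<lambda>x. x \<noteq> p) (replicate_mset c p) = {#}"
      using V(1)[OF Zc(2)] by (auto simp: filter_mset_eq_conv)
    then show "(\<lambda>Z. (filter_mset (\<lambda>x. x \<noteq> p) Z, count Z p)) ((\<lambda>(Z, c). Z + replicate_mset c p) q) = q"
      using V(1)[OF Zc(2)] by (simp add: Zc not_in_iff)
    show "(\<lambda>(Z, c). Z + replicate_mset c p) q \<in> {Z. Z \<subseteq># V + replicate_mset n p}"
      using Zc by (auto simp: subseteq_mset_def intro: add_mono)
  qed
  also have "\<dots> = (\<Sum>Z | Z \<subseteq># V. mset_prod g Z * mset_prod h (V - Z)) * ?C p n"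
    by (simp add: sum.cartesian_product[symmetric] sum_product)
  also have "\<dots> = mset_prod ?C V * ?C p n" by (simp only: replicate(3))
  also have "\<dots> = mset_prod ?C (V + replicate_mset n p)"
    using replicate(1) g h by (intro mset_prod_add_replicate[symmetric]) auto
  finally show ?case .
qed

section \<open>Gaussian binomial weights and their limit\<close>

definition gauss_weight :: "nat \<Rightarrow> nat \<Rightarrow> nat \<Rightarrow> real" where
  "gauss_weight J q m = (\<Prod>k<m. (1 - (1 / real q) ^ (J + k)) / (1 - (1 / real q) ^ Suc k))"

lemma gauss_weight_0 [simp]: "gauss_weight J q 0 = 1"
  by (simp add: gauss_weight_def)

text \<open>The factor with \<open>k = 0\<close> has numerator \<open>1 - 1\<close>: the empty
  product of zeta functions gives weight to the empty multiset only.\<close>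

lemma gauss_weight_zero_left: "gauss_weight 0 q (Suc m) = 0"
  by (simp add: gauss_weight_def prod.lessThan_Suc_shift del: prod.lessThan_Suc)

text \<open>
  With \<open>x = 1 / q\<close>, the value \<open>gauss_weight J q m\<close> is the \<open>x\<close>-binomial coefficient of \<open>J + m - 1\<close>
  over \<open>m\<close>, that is the complete homogeneous polynomial of degree \<open>m\<close> in \<open>1, x, \<dots>, x ^ (J - 1)\<close>;
  this is its Pascal recurrence.
\<close>

lemma gauss_weight_pascal:
  assumes "q > 1"
  shows "gauss_weight (Suc J) q (Suc m) = (1 / real q) ^ J * gauss_weight (Suc J) q m + gauss_weight J q (Suc m)"
proof -
  define x where "x = 1 / real q"
  have x: "0 < x" "x < 1" using assms by (auto simp: x_def)
  define N where "N = (\<Prod>k<m. 1 - x ^ (Suc J + k))"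
  define A where "A = (\<Prod>k<m. 1 - x ^ Suc k)"
  have xk: "x ^ Suc k < 1" for k using x power_Suc_less_one by blast
  have A: "A \<noteq> 0" unfolding A_def using xk by (auto simp del: power_Suc) (metis less_irrefl)
  have 1: "gauss_weight (Suc J) q m = N / A"
    by (simp add: gauss_weight_def N_def A_def x_def[symmetric] prod_dividef del: power_Suc)
  have 2: "gauss_weight (Suc J) q (Suc m) = N * (1 - x ^ (Suc J + m)) / (A * (1 - x ^ Suc m))"
    by (simp add: gauss_weight_def N_def A_def x_def[symmetric] prod_dividef del: power_Suc)
  have "(\<Prod>k<Suc m. 1 - x ^ (J + k)) = (1 - x ^ J) * N"
    by (simp add: prod.lessThan_Suc_shift N_def del: prod.lessThan_Suc)
  then have 3: "gauss_weight J q (Suc m) = (1 - x ^ J) * N / (A * (1 - x ^ Suc m))"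
    by (simp add: gauss_weight_def A_def x_def[symmetric] prod_dividef del: power_Suc)
  have m: "1 - x ^ Suc m \<noteq> 0" using xk[of m] by linarith
  have "N * (1 - x ^ (Suc J + m)) = x ^ J * (N * (1 - x ^ Suc m)) + (1 - x ^ J) * N"
    by (simp add: algebra_simps power_add)
  then show ?thesis unfolding 1 2 3 x_def[symmetric] using A m by (simp add: divide_simps del: power_Suc)
qed

text \<open>With \<open>x = 1 / q\<close>, this appends the variable \<open>x ^ J\<close> to
  \<open>1, x, ..., x ^ (J - 1)\<close> in the complete homogeneous polynomials; it is the local
  effect of one more zeta factor.\<close>

lemma gauss_weight_Suc:
  assumes "q > 1"
  shows "(\<Sum>c\<le>m. gauss_weight J q c * ((1 / real q) ^ J) ^ (m - c)) = gauss_weight (Suc J) q m"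
proof (induction m)
  case (Suc m)
  have "(\<Sum>c\<le>Suc m. gauss_weight J q c * ((1 / real q) ^ J) ^ (Suc m - c))
    = (\<Sum>c\<le>m. (1 / real q) ^ J * (gauss_weight J q c * ((1 / real q) ^ J) ^ (m - c))) + gauss_weight J q (Suc m)"
    by (simp add: Suc_diff_le ac_simps)
  also have "\<dots> = (1 / real q) ^ J * gauss_weight (Suc J) q m + gauss_weight J q (Suc m)"
    by (simp only: sum_distrib_left[symmetric] Suc)
  finally show ?case using gauss_weight_pascal[OF assms, of J m] by simp
qed simp

text \<open>The numerators \<open>1 - x ^ (J + k)\<close> tend to \<open>1\<close> since
  \<open>x = 1 / q < 1\<close>, and the denominators are those of \<open>q_weight\<close>. The limit
  in the product over \<open>j\<close> is reduced to this one.\<close>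

lemma gauss_weight_tendsto:
  assumes "q > 1"
  shows "(\<lambda>J. gauss_weight J q m) \<longlonglongrightarrow> q_weight q m"
proof -
  have x: "norm (1 / real q) < 1" using assms by simp
  have "(\<lambda>J. \<Prod>k<m. (1 - (1 / real q) ^ (J + k)) / (1 - (1 / real q) ^ Suc k))
    \<longlonglongrightarrow> (\<Prod>k<m. (1 - 0) / (1 - (1 / real q) ^ Suc k))"
  proof (intro tendsto_intros)
    fix k
    show "(\<lambda>J. (1 / real q) ^ (J + k)) \<longlonglongrightarrow> 0"
      using LIMSEQ_ignore_initial_segment[OF LIMSEQ_power_zero[OF x], of k] .
    have "(1 / real q) ^ Suc k < 1" using assms by (intro power_Suc_less_one) auto
    then show "1 - (1 / real q) ^ Suc k \<noteq> 0" by linarith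
  qed
  moreover have "q_weight q m = (\<Prod>k<m. (1 - 0) / (1 - (1 / real q) ^ Suc k))"
    by (simp add: q_weight_def prod.atLeast1_atMost_eq power_one_over)
  ultimately show ?thesis by (simp add: gauss_weight_def)
qed

text \<open>Coefficient 0 is meaningless, so series are only known to agree from 1 on; in a
  convolution at \<open>n \<ge> 1\<close> both indices are at least 1.\<close>

lemma dir_mult_cong:
  assumes "\<And>d. d \<ge> 1 \<Longrightarrow> f d = f' d" "\<And>d. d \<ge> 1 \<Longrightarrow> g d = g' d" "n \<ge> 1"
  shows "dir_mult f g n = dir_mult f' g' n"
  unfolding dir_mult_def
proof (rule sum.cong[OF refl])
  fix d assume "d \<in> {d. d dvd n}"
  then obtain k where k: "n = d * k" by auto
  then have "d \<noteq> 0" "k \<noteq> 0" using assms(3) by auto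
  then have "d \<ge> 1" "k \<ge> 1" by auto
  moreover from this have "n div d = k" using k by simp
  ultimately show "f d * g (n div d) = f' d * g' (n div d)" using assms by simp
qed

section \<open>Dirichlet series of weighted multisets and the product over exponents\<close>

context zeta_domain
begin

lemma module_norm_add: "module_norm (Y + Z) = module_norm Y * module_norm Z"
  by (simp add: module_norm_def)

definition types_in :: "('a set \<times> nat) set \<Rightarrow> nat \<Rightarrow> ('a set \<times> nat) multiset set" where
  "types_in E n = {Y. set_mset Y \<subseteq> E \<and> module_norm Y = n}"

definition type_series :: "('a set \<times> nat) set \<Rightarrow> (('a set \<times> nat) multiset \<Rightarrow> real) \<Rightarrow> dirichlet_series" where
  "type_series E w n = complex_of_real (\<Sum>Y\<in>types_in E n. w Y)"

lemma finite_types_in: "E \<subseteq> prime_exps \<Longrightarrow> finite (types_in E n)"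
  by (rule finite_subset[OF _ finite_types_of_norm[of n]]) (auto simp: types_in_def types_of_norm_def)

text \<open>The divisor \<open>d\<close> in the convolution is the norm of the first multiset of a
  pair, its cofactor that of the second.\<close>

lemma type_series_mult:
  assumes E: "E \<subseteq> prime_exps" "E' \<subseteq> prime_exps" and n: "n \<ge> 1"
  shows "dir_mult (type_series E v) (type_series E' w) n =
    complex_of_real (\<Sum>(Y, Z) | set_mset Y \<subseteq> E \<and> set_mset Z \<subseteq> E' \<and> module_norm Y * module_norm Z = n. v Y * w Z)"
proof -
  let ?S = "{(Y, Z). set_mset Y \<subseteq> E \<and> set_mset Z \<subseteq> E' \<and> module_norm Y * module_norm Z = n}"
  have fib: "{p \<in> ?S. module_norm (fst p) = d} = types_in E d \<times> types_in E' (n div d)" if "d dvd n" for d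
    using that n by (auto simp: types_in_def)
  have fin: "finite {d. d dvd n}" using n by (intro finite_divisors_nat) auto
  have "?S \<subseteq> (\<Union>d\<in>{d. d dvd n}. types_in E d \<times> types_in E' (n div d))"
  proof
    fix p assume p: "p \<in> ?S"
    then have d: "module_norm (fst p) dvd n" by auto
    then have "p \<in> types_in E (module_norm (fst p)) \<times> types_in E' (n div module_norm (fst p))"
      using fib[OF d] p by blast
    then show "p \<in> (\<Union>d\<in>{d. d dvd n}. types_in E d \<times> types_in E' (n div d))" using d by blast
  qed
  then have finS: "finite ?S"
    by (rule finite_subset) (use fin finite_types_in E in auto)
  have "(\<Sum>d | d dvd n. (\<Sum>Y\<in>types_in E d. v Y) * (\<Sum>Z\<in>types_in E' (n div d). w Z))
    = (\<Sum>d | d dvd n. \<Sum>(Y, Z)\<in>{p \<in> ?S. module_norm (fst p) = d}. v Y * w Z)"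
  proof (rule sum.cong[OF refl])
    fix d assume "d \<in> {d. d dvd n}"
    then have d: "d dvd n" by simp
    show "(\<Sum>Y\<in>types_in E d. v Y) * (\<Sum>Z\<in>types_in E' (n div d). w Z) =
        (\<Sum>(Y, Z)\<in>{p \<in> ?S. module_norm (fst p) = d}. v Y * w Z)"
      unfolding fib[OF d] sum_product sum.cartesian_product ..
  qed
  also have "\<dots> = (\<Sum>(Y, Z)\<in>?S. v Y * w Z)"
    by (rule sum.group[OF finS fin]) auto
  finally show ?thesis
    by (simp add: dir_mult_def type_series_def flip: of_real_mult of_real_sum)
qed

text \<open>Over one and the same set \<open>E\<close> a multiset can be split in many ways:
  \<open>(Y, Z)\<close> corresponds to the sum \<open>Y + Z\<close> with its submultiset
  \<open>Y\<close>.\<close>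

lemma type_series_convolution:
  assumes E: "E \<subseteq> prime_exps" and n: "n \<ge> 1"
  shows "dir_mult (type_series E v) (type_series E w) n = type_series E (\<lambda>Y. \<Sum>Z | Z \<subseteq># Y. v Z * w (Y - Z)) n"
proof -
  have "(\<Sum>(Y, Z) | set_mset Y \<subseteq> E \<and> set_mset Z \<subseteq> E \<and> module_norm Y * module_norm Z = n. v Y * w Z)
    = (\<Sum>(Y, Z)\<in>Sigma (types_in E n) (\<lambda>Y. {Z. Z \<subseteq># Y}). v Z * w (Y - Z))"
    by (rule sum.reindex_bij_witness[of _ "\<lambda>(Y, Z). (Z, Y - Z)" "\<lambda>(Y, Z). (Y + Z, Y)"])
      (auto simp: types_in_def module_norm_add simp flip: module_norm_add dest: in_diffD mset_subset_eqD)
  also have "\<dots> = (\<Sum>Y\<in>types_in E n. \<Sum>Z | Z \<subseteq># Y. v Z * w (Y - Z))"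
    by (rule sum.Sigma[symmetric]) (use finite_types_in[OF E] finite_submultisets in auto)
  finally show ?thesis by (simp only: type_series_mult[OF E E n] type_series_def)
qed

text \<open>Over disjoint sets a multiset splits in only one way, so no inner sum appears and the
  weight only has to be multiplicative.\<close>

lemma type_series_disjoint:
  assumes E: "E \<subseteq> prime_exps" "E' \<subseteq> prime_exps" "E \<inter> E' = {}" and n: "n \<ge> 1"
    and w: "\<And>Y Z. set_mset Y \<subseteq> E \<Longrightarrow> set_mset Z \<subseteq> E' \<Longrightarrow> w (Y + Z) = w Y * w Z"
  shows "dir_mult (type_series E w) (type_series E' w) n = type_series (E \<union> E') w n"
proof -
  have "(\<Sum>(Y, Z) | set_mset Y \<subseteq> E \<and> set_mset Z \<subseteq> E' \<and> module_norm Y * module_norm Z = n. w Y * w Z)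
    = (\<Sum>Y\<in>types_in (E \<union> E') n. w Y)"
  proof (rule sum.reindex_bij_witness[of _ "\<lambda>Y. (filter_mset (\<lambda>p. p \<in> E) Y, filter_mset (\<lambda>p. p \<notin> E) Y)" "\<lambda>(Y, Z). Y + Z"])
    fix p assume "p \<in> {(Y, Z). set_mset Y \<subseteq> E \<and> set_mset Z \<subseteq> E' \<and> module_norm Y * module_norm Z = n}"
    then obtain Y Z where p: "p = (Y, Z)" "set_mset Y \<subseteq> E" "set_mset Z \<subseteq> E'" "module_norm Y * module_norm Z = n"
      by auto
    have "filter_mset (\<lambda>p. p \<in> E) Y = Y" "filter_mset (\<lambda>p. p \<notin> E) Y = {#}"
      using p by (auto simp: filter_mset_eq_conv)
    moreover have "filter_mset (\<lambda>p. p \<in> E) Z = {#}" "filter_mset (\<lambda>p. p \<notin> E) Z = Z"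
      using p E(3) by (auto simp: filter_mset_eq_conv)
    ultimately show "(filter_mset (\<lambda>p. p \<in> E) (case p of (Y, Z) \<Rightarrow> Y + Z),
        filter_mset (\<lambda>p. p \<notin> E) (case p of (Y, Z) \<Rightarrow> Y + Z)) = p" by (simp add: p)
    show "(case p of (Y, Z) \<Rightarrow> Y + Z) \<in> types_in (E \<union> E') n"
      using p by (auto simp: types_in_def module_norm_add)
    show "w (case p of (Y, Z) \<Rightarrow> Y + Z) = (case p of (Y, Z) \<Rightarrow> w Y * w Z)"
      using p w by simp
  next
    fix Y assume "Y \<in> types_in (E \<union> E') n"
    then have Y: "set_mset Y \<subseteq> E \<union> E'" "module_norm Y = n" by (auto simp: types_in_def)
    have eq: "filter_mset (\<lambda>p. p \<in> E) Y + filter_mset (\<lambda>p. p \<notin> E) Y = Y"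
      using multiset_partition[of Y "\<lambda>p. p \<in> E"] by simp
    then show "(case (filter_mset (\<lambda>p. p \<in> E) Y, filter_mset (\<lambda>p. p \<notin> E) Y) of (Y, Z) \<Rightarrow> Y + Z) = Y" by simp
    have "module_norm (filter_mset (\<lambda>p. p \<in> E) Y) * module_norm (filter_mset (\<lambda>p. p \<notin> E) Y) = n"
      unfolding module_norm_add[symmetric] eq by (rule Y(2))
    then show "(filter_mset (\<lambda>p. p \<in> E) Y, filter_mset (\<lambda>p. p \<notin> E) Y)
      \<in> {(Y, Z). set_mset Y \<subseteq> E \<and> set_mset Z \<subseteq> E' \<and> module_norm Y * module_norm Z = n}"
      using Y(1) by auto
  qed
  then show ?thesis by (simp only: type_series_mult[OF E(1,2) n] type_series_def)
qed

lemma type_weight_add: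
  assumes "set_mset Y \<inter> set_mset Z = {}"
  shows "type_weight (Y + Z) = type_weight Y * type_weight Z"
proof -
  let ?g = "\<lambda>p. q_weight (card (residues (fst p)))"
  have "type_weight (Y + Z) = (\<Prod>p\<in>set_mset Y. ?g p (count (Y + Z) p)) * (\<Prod>p\<in>set_mset Z. ?g p (count (Y + Z) p))"
    unfolding type_weight_def mset_prod_def set_mset_union using assms by (intro prod.union_disjoint) auto
  also have "(\<Prod>p\<in>set_mset Y. ?g p (count (Y + Z) p)) = type_weight Y"
    unfolding type_weight_def mset_prod_def
  proof (rule prod.cong[OF refl])
    fix p assume "p \<in># Y"
    then have "count Z p = 0" using assms by (auto simp flip: not_in_iff)
    then show "?g p (count (Y + Z) p) = ?g p (count Y p)" by simp
  qed
  also have "(\<Prod>p\<in>set_mset Z. ?g p (count (Y + Z) p)) = type_weight Z"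
    unfolding type_weight_def mset_prod_def
  proof (rule prod.cong[OF refl])
    fix p assume "p \<in># Z"
    then have "count Y p = 0" using assms by (auto simp flip: not_in_iff)
    then show "?g p (count (Y + Z) p) = ?g p (count Z p)" by simp
  qed
  finally show ?thesis .
qed

lemma types_in_empty: "types_in {} n = (if n = 1 then {{#}} else {})"
  by (auto simp: types_in_def module_norm_def)

text \<open>Coefficient \<open>n\<close> of the partial products is constant once
  \<open>K \<ge> n\<close>, since exponents in a multiset of norm \<open>n\<close> are less than
  \<open>n\<close>.\<close>

lemma type_series_has_prod:
  "dir_has_prod (\<lambda>i. type_series (primes \<times> {i}) type_weight) (type_series prime_exps type_weight)"
  unfolding dir_has_prod_def
proof (intro allI impI)
  fix n :: nat assume n: "n \<ge> 1"
  let ?F = "\<lambda>i. type_series (primes \<times> {i}) type_weight"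
  have part: "dir_partial_prod ?F K m
      = type_series (primes \<times> {1..K}) type_weight m" if "m \<ge> 1" for K m
    using that
  proof (induction K arbitrary: m)
    case 0
    then show ?case by (simp add: dir_one_def type_series_def types_in_empty type_weight_def mset_prod_def)
  next
    case (Suc K)
    have "dir_partial_prod ?F (Suc K) m
      = dir_mult (type_series (primes \<times> {1..K}) type_weight) (type_series (primes \<times> {Suc K}) type_weight) m"
      unfolding dir_partial_prod.simps by (rule dir_mult_cong[OF Suc.IH refl Suc.prems])
    also have "\<dots> = type_series (primes \<times> {1..K} \<union> primes \<times> {Suc K}) type_weight m"
    proof (rule type_series_disjoint)
      fix Y Z assume "set_mset Y \<subseteq> primes \<times> {1..K}" "set_mset Z \<subseteq> primes \<times> {Suc K}"
      moreover have "(primes \<times> {1..K}) \<inter> (primes \<times> {Suc K}) = {}" by auto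
      ultimately have "set_mset Y \<inter> set_mset Z = {}" by blast
      then show "type_weight (Y + Z) = type_weight Y * type_weight Z" by (rule type_weight_add)
    qed (use Suc in \<open>auto simp: prime_exps_def\<close>)
    also have "primes \<times> {1..K} \<union> primes \<times> {Suc K} = primes \<times> {1..Suc K}" by auto
    finally show ?case .
  qed
  have "types_in (primes \<times> {1..K}) n = types_in prime_exps n" if "K \<ge> n" for K
  proof -
    have "Y \<in> types_in (primes \<times> {1..K}) n" if Y: "Y \<in> types_in prime_exps n" for Y
    proof -
      have "p \<in> primes \<times> {1..K}" if p: "p \<in># Y" for p
        using module_norm_member(2)[of Y "fst p" "snd p"] Y p \<open>K \<ge> n\<close>
        by (auto simp: types_in_def prime_exps_def)
      then show ?thesis using Y by (auto simp: types_in_def)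
    qed
    then show ?thesis by (auto simp: types_in_def prime_exps_def)
  qed
  then have "eventually (\<lambda>K. dir_partial_prod ?F K n
      = type_series prime_exps type_weight n) sequentially"
    by (intro eventually_sequentiallyI[of n]) (simp only: part[OF n] type_series_def)
  then show "(\<lambda>K. dir_partial_prod ?F K n)
      \<longlonglongrightarrow> type_series prime_exps type_weight n"
    by (rule tendsto_eventually)
qed

section \<open>The Dedekind zeta function and the product over its shifts\<close>

text \<open>Forgetting the exponents leaves a multiset of maximal ideals; this is the index of the
  corresponding ideal.\<close>

definition base_norm :: "('a set \<times> nat) multiset \<Rightarrow> nat" where
  "base_norm Y = prime_norm (image_mset fst Y)"

text \<open>Factorization of ideals: \<open>finite_index_ideal\<close> gives existence,
  \<open>inj_on_mset_ideal\<close> uniqueness, and \<open>residues_mset_ideal\<close> matches the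
  index with the norm.\<close>

lemma dedekind_zeta_card:
  assumes "n \<ge> 1"
  shows "dedekind_zeta (type_ring :: 'a ring) n = of_nat (card {Y. set_mset Y \<subseteq> primes \<and> prime_norm Y = n})"
proof -
  let ?R = "type_ring :: 'a ring"
  let ?I = "{I. ideal I ?R \<and> finite (carrier (?R Quot I)) \<and> ideal_index ?R I = n}"
  let ?Y = "{Y. set_mset Y \<subseteq> primes \<and> prime_norm Y = n}"
  have "?I = mset_ideal ` ?Y"
  proof (intro equalityI subsetI)
    fix I assume "I \<in> ?I"
    then have I: "is_ideal I" "finite (residues I)" "card (residues I) = n"
      by (auto simp: ideal_type_ring_iff residues_Quot)
    obtain Y where "set_mset Y \<subseteq> primes" "I = mset_ideal Y" using finite_index_ideal[OF I(1,2)] .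
    then show "I \<in> mset_ideal ` ?Y"
      using I(3) residues_mset_ideal[of Y] by auto
  next
    fix I assume "I \<in> mset_ideal ` ?Y"
    then obtain Y where Y: "set_mset Y \<subseteq> primes" "prime_norm Y = n" "I = mset_ideal Y" by auto
    note I = is_ideal_mset_ideal[OF Y(1)]
    show "I \<in> ?I"
      using I residues_Quot[OF I] residues_mset_ideal[OF Y(1)] Y by (simp add: ideal_type_ring_iff)
  qed
  moreover have "inj_on mset_ideal ?Y"
    using inj_on_mset_ideal by (rule inj_on_subset) auto
  ultimately show ?thesis by (simp add: dedekind_zeta_def card_image)
qed

lemma module_norm_base:
  "set_mset Y \<subseteq> primes \<times> {i} \<Longrightarrow> module_norm Y = base_norm Y ^ i"
proof (induction Y)
  case (add p Y)
  then have "snd p = i" by auto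
  then show ?case using add by (simp add: module_norm_add_mset base_norm_def prime_norm_def power_mult_distrib)
qed (simp add: module_norm_def base_norm_def prime_norm_def)

lemma card_base_norm:
  "card {Y. set_mset Y \<subseteq> primes \<times> {i} \<and> base_norm Y = n} = card {Y. set_mset Y \<subseteq> primes \<and> prime_norm Y = n}"
proof (rule bij_betw_same_card)
  have inv: "image_mset (\<lambda>P. (P, i)) (image_mset fst Y) = Y" if "set_mset Y \<subseteq> primes \<times> {i}" for Y
    using that by (induction Y) auto
  show "bij_betw (image_mset fst) {Y. set_mset Y \<subseteq> primes \<times> {i} \<and> base_norm Y = n} {Y. set_mset Y \<subseteq> primes \<and> prime_norm Y = n}"
  proof (rule bij_betw_byWitness[where f' = "image_mset (\<lambda>P. (P, i))"])
    show "image_mset fst ` {Y. set_mset Y \<subseteq> primes \<times> {i} \<and> base_norm Y = n} \<subseteq> {Y. set_mset Y \<subseteq> primes \<and> prime_norm Y = n}"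
      by (force simp: base_norm_def)
  qed (use inv in \<open>auto simp: base_norm_def multiset.map_comp comp_def\<close>)
qed

text \<open>An ideal of index \<open>n\<close>, read as a multiset on
  \<open>primes \<times> {i}\<close>, has module norm \<open>n ^ i\<close> and weight
  \<open>n ^ (-J)\<close>, which is the effect of substituting \<open>i * s + J\<close> for
  \<open>s\<close>. The shift is written \<open>int (Suc J) - 1\<close> to fit the factor with index
  \<open>j = Suc J\<close>, as products begin at index 1.\<close>

lemma dir_subst_zeta:
  assumes i: "i \<ge> 1" and N: "N \<ge> 1"
  shows "dir_subst i (int (Suc J) - 1) (dedekind_zeta (type_ring :: 'a ring)) N =
    type_series (primes \<times> {i}) (\<lambda>Y. (1 / real (base_norm Y)) ^ J) N"
proof -
  let ?T = "{n. n \<ge> 1 \<and> n ^ i = N}"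
  let ?S = "types_in (primes \<times> {i}) N"
  have E: "primes \<times> {i} \<subseteq> prime_exps" using i by (auto simp: prime_exps_def)
  have finT: "finite ?T"
  proof (rule finite_subset)
    show "?T \<subseteq> {..N}" using i by (auto intro: self_le_power)
  qed simp
  have base: "base_norm Y \<ge> 1 \<and> base_norm Y ^ i = N" if "Y \<in> ?S" for Y
    using that module_norm_base[of Y i] N i by (cases "base_norm Y") (auto simp: types_in_def power_0_left)
  have fib: "{Y \<in> ?S. base_norm Y = n} = {Y. set_mset Y \<subseteq> primes \<times> {i} \<and> base_norm Y = n}" if "n \<in> ?T" for n
    using that module_norm_base by (auto simp: types_in_def)
  have "(\<Sum>Y\<in>?S. (1 / real (base_norm Y)) ^ J) = (\<Sum>n\<in>?T. \<Sum>Y\<in>{Y \<in> ?S. base_norm Y = n}. (1 / real (base_norm Y)) ^ J)"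
    by (rule sum.group[symmetric]) (use finT finite_types_in[OF E] base in auto)
  also have "\<dots> = (\<Sum>n\<in>?T. real (card {Y. set_mset Y \<subseteq> primes \<and> prime_norm Y = n}) * (1 / real n) ^ J)"
  proof (rule sum.cong[OF refl])
    fix n assume n: "n \<in> ?T"
    have "(\<Sum>Y\<in>{Y \<in> ?S. base_norm Y = n}. (1 / real (base_norm Y)) ^ J) = real (card {Y \<in> ?S. base_norm Y = n}) * (1 / real n) ^ J"
      by simp
    then show "(\<Sum>Y\<in>{Y \<in> ?S. base_norm Y = n}. (1 / real (base_norm Y)) ^ J) = real (card {Y. set_mset Y \<subseteq> primes \<and> prime_norm Y = n}) * (1 / real n) ^ J"
      unfolding fib[OF n] card_base_norm .
  qed
  finally have "type_series (primes \<times> {i}) (\<lambda>Y. (1 / real (base_norm Y)) ^ J) N =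
     (\<Sum>n\<in>?T. of_nat (card {Y. set_mset Y \<subseteq> primes \<and> prime_norm Y = n}) * (1 / of_nat n) ^ J)"
    by (simp add: type_series_def)
  also have "\<dots> = dir_subst i (int (Suc J) - 1) (dedekind_zeta (type_ring :: 'a ring)) N"
    unfolding dir_subst_def
    by (rule sum.cong[OF refl]) (simp add: dedekind_zeta_card power_int_minus power_one_over inverse_eq_divide)
  finally show ?thesis by simp
qed

lemma mset_prod_power: "mset_prod (\<lambda>p m. f p ^ m) Y = (\<Prod>p\<in>#Y. f p)"
  by (simp add: mset_prod_def image_prod_mset_multiplicity)

text \<open>The product of the first \<open>J\<close> factors has the local weights
  \<open>gauss_weight J\<close>. As each coefficient is a finite sum of finite products, the limit
  in \<open>J\<close> may be taken in every local factor.\<close>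

lemma dedekind_zeta_has_prod:
  assumes i: "i \<ge> 1"
  shows "dir_has_prod (\<lambda>j. dir_subst i (int j - 1) (dedekind_zeta (type_ring :: 'a ring)))
    (type_series (primes \<times> {i}) type_weight)"
  unfolding dir_has_prod_def
proof (intro allI impI)
  fix n :: nat assume n: "n \<ge> 1"
  let ?E = "primes \<times> {i}"
  let ?F = "\<lambda>j. dir_subst i (int j - 1) (dedekind_zeta (type_ring :: 'a ring))"
  let ?w = "\<lambda>J. mset_prod (\<lambda>p. gauss_weight J (card (residues (fst p))))"
  have E: "?E \<subseteq> prime_exps" using i by (auto simp: prime_exps_def)
  have part: "dir_partial_prod ?F J m = type_series ?E (?w J) m" if "m \<ge> 1" for J m
    using that
  proof (induction J arbitrary: m)
    case 0
    have w0: "?w 0 Y = (if Y = {#} then 1 else 0)" for Y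
    proof (cases "Y = {#}")
      case False
      then obtain p where p: "p \<in># Y" by auto
      then obtain c where "count Y p = Suc c" by (metis not_in_iff not0_implies_Suc)
      then have "gauss_weight 0 (card (residues (fst p))) (count Y p) = 0" by (simp add: gauss_weight_zero_left)
      then show ?thesis using p False by (auto simp: mset_prod_def)
    qed (simp add: mset_prod_def)
    have "(\<Sum>Y\<in>types_in ?E m. ?w 0 Y) = (if {#} \<in> types_in ?E m then 1 else 0)"
      unfolding w0 using finite_types_in[OF E] by (simp add: sum.delta)
    then show ?case by (auto simp: dir_one_def type_series_def types_in_def module_norm_def)
  next
    case (Suc J)
    have "dir_partial_prod ?F (Suc J) m = dir_mult (type_series ?E (?w J)) (type_series ?E (\<lambda>Y. (1 / real (base_norm Y)) ^ J)) m"
      unfolding dir_partial_prod.simps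
      by (rule dir_mult_cong[OF _ _ Suc.prems]) (use Suc.IH dir_subst_zeta[OF i] in auto)
    also have "\<dots> = type_series ?E (\<lambda>Y. \<Sum>Z | Z \<subseteq># Y. ?w J Z * (1 / real (base_norm (Y - Z))) ^ J) m"
      by (rule type_series_convolution[OF E Suc.prems])
    also have "\<dots> = type_series ?E (?w (Suc J)) m"
      unfolding type_series_def
    proof (intro arg_cong[where f = complex_of_real] sum.cong[OF refl])
      fix Y assume "Y \<in> types_in ?E m"
      then have Y: "set_mset Y \<subseteq> ?E" by (simp add: types_in_def)
      let ?h = "\<lambda>p m. ((1 / real (card (residues (fst p)))) ^ J) ^ m"
      \<comment> \<open>Multiplicativity of \<open>base_norm\<close> puts the weight of the new
        factor into local form, so that the convolution can be evaluated one point at a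
        time.\<close>
      have h: "(1 / real (base_norm V)) ^ J = mset_prod ?h V" for V
        unfolding mset_prod_power
      proof (induction V)
        case (add p V)
        have "base_norm (add_mset p V) = card (residues (fst p)) * base_norm V"
          by (simp add: base_norm_def prime_norm_def)
        then have "(1 / real (base_norm (add_mset p V))) ^ J =
            (1 / real (card (residues (fst p)))) ^ J * (1 / real (base_norm V)) ^ J"
          by (simp add: power_divide power_mult_distrib)
        then show ?case by (simp only: add image_mset_add_mset prod_mset.add_mset)
      qed (simp add: base_norm_def prime_norm_def)
      have "(\<Sum>Z | Z \<subseteq># Y. ?w J Z * (1 / real (base_norm (Y - Z))) ^ J)
        = mset_prod (\<lambda>p m. \<Sum>c\<le>m. gauss_weight J (card (residues (fst p))) c * ?h p (m - c)) Y"
        unfolding h by (rule sum_submultisets_mset_prod) auto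
      also have "\<dots> = ?w (Suc J) Y"
        unfolding mset_prod_def
      proof (rule prod.cong[OF refl])
        fix p assume "p \<in># Y"
        then have "fst p \<in> primes" using Y by auto
        from residues_prime_gt_1[OF this]
        show "(\<Sum>c\<le>count Y p. gauss_weight J (card (residues (fst p))) c * ?h p (count Y p - c))
          = gauss_weight (Suc J) (card (residues (fst p))) (count Y p)" by (rule gauss_weight_Suc)
      qed
      finally show "(\<Sum>Z | Z \<subseteq># Y. ?w J Z * (1 / real (base_norm (Y - Z))) ^ J) = ?w (Suc J) Y" .
    qed
    finally show ?case .
  qed
  have "(\<lambda>J. type_series ?E (?w J) n) \<longlonglongrightarrow> type_series ?E type_weight n"
    unfolding type_series_def
  proof (intro tendsto_of_real tendsto_sum)
    fix Y assume "Y \<in> types_in ?E n"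
    then have Y: "set_mset Y \<subseteq> ?E" by (simp add: types_in_def)
    show "(\<lambda>J. ?w J Y) \<longlonglongrightarrow> type_weight Y"
      unfolding type_weight_def mset_prod_def
    proof (rule tendsto_prod)
      fix p assume "p \<in># Y"
      then have "fst p \<in> primes" using Y by auto
      from residues_prime_gt_1[OF this]
      show "(\<lambda>J. gauss_weight J (card (residues (fst p))) (count Y p))
        \<longlonglongrightarrow> q_weight (card (residues (fst p))) (count Y p)" by (rule gauss_weight_tendsto)
    qed
  qed
  then show "(\<lambda>J. dir_partial_prod ?F J n) \<longlonglongrightarrow> type_series ?E type_weight n"
    by (simp only: part[OF n])
qed

end

theorem proposition4p2:
  assumes "dedekind_domain TYPE('a::idom)"
    and "\<not> field (ring_of_type_algebra :: 'a ring)"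
    and "dedekind_zeta_defined (ring_of_type_algebra :: 'a ring)"
  shows "module_zeta_defined (ring_of_type_algebra :: 'a poly ring) \<and>
    (\<exists>F. (\<forall>i\<ge>1. dir_has_prod
              (\<lambda>j. dir_subst i (int j - 1) (dedekind_zeta (ring_of_type_algebra :: 'a ring))) (F i)) \<and>
         dir_has_prod F (module_zeta (ring_of_type_algebra :: 'a poly ring)))"
proof -
  have res: "finite (carrier (type_ring Quot P)) \<longleftrightarrow> finite (residues P)"
    "ideal_index type_ring P = card (residues P)"
    if "maximalideal P (type_ring :: 'a ring)" for P :: "'a set"
    using that residues_Quot[of P] by (auto simp: maximalideal_iff)
  \<comment> \<open>Since \<open>S\<close> is not a field, the zero ideal is not maximal, and so
    every maximal ideal has a uniformizer.\<close>
  interpret zeta_domain "TYPE('a)"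
  proof
    fix P :: "'a set" assume P: "maximalideal P type_ring"
    then have "finite (residues P)" using assms(3) res[OF P] by (auto simp: dedekind_zeta_defined_def)
    from uniformizer_exists[OF assms(1,2) P this] show "\<exists>t s. uniformizer P t s" by blast
  next
    fix B
    have "{P :: 'a set. maximalideal P type_ring \<and> card (residues P) \<le> B}
      = {P :: 'a set. maximalideal P type_ring \<and> ideal_index type_ring P \<le> B}"
      using res by auto
    then show "finite {P :: 'a set. maximalideal P type_ring \<and> card (residues P) \<le> B}"
      using assms(3) by (simp add: dedekind_zeta_defined_def)
  qed
  have "module_zeta (type_ring :: 'a poly ring) = type_series prime_exps type_weight"
    by (rule ext) (simp add: module_zeta_poly type_series_def types_in_def types_of_norm_def)
  \<comment> \<open>The witness \<open>F i\<close> collects the multisets whose exponents all equal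
    \<open>i\<close>; it is the inner product over \<open>j\<close>.\<close>
  then show ?thesis
    using module_zeta_poly(1) dedekind_zeta_has_prod type_series_has_prod
    by (auto simp: module_zeta_defined_def intro!: exI[of _ "\<lambda>i. type_series (primes \<times> {i}) type_weight"])
qed

end
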